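(* Let $A$, $B$, $A_1$, $B_1$, $B_2$, $B_3$, $C_1$, $C_1-A_1$ and $\mathbb{Y}$ be positive stable matrices in $\mathbb{C}^{r\times r}$ such that $A$, $B$, $A_1$, $C_1$, $\mathbb{Y}$ commute with each other, and let $z,w,v\in\mathbb{C}$ with $|z|<1$, $|w|<1$, $|v|<1$. (i) If $B-I$ is positive stable (so that the function with parameter $B-I$ is defined), then $$\begin{aligned}(B-(A+I))\,&F^{(3;A,B)}_{D,\mathbb{Y}}(A_1,B_1,B_2,B_3;C_1;z,w,v)\\&=(B-I)\,F^{(3;A,B-I)}_{D,\mathbb{Y}}(A_1,B_1,B_2,B_3;C_1;z,w,v)-A\,F^{(3;A+I,B)}_{D,\mathbb{Y}}(A_1,B_1,B_2,B_3;C_1;z,w,v).\end{aligned}$$ (ii) If $A-I$, $A_1-I$ and $C_1-A_1-I$ are positive stable (so that the functions with the shifted parameters are defined), then $$\begin{aligned}&B\,F^{(3;A,B)}_{D,\mathbb{Y}}(A_1,B_1,B_2,B_3;C_1;z,w,v)-B\,F^{(3;A-I,B)}_{D,\mathbb{Y}}(A_1,B_1,B_2,B_3;C_1;z,w,v)\\&\quad+[\mathfrak{B}(A_1,C_1-A_1)]^{-1}\,\mathfrak{B}(A_1-I,C_1-A_1-I)\,\mathbb{Y}\,F^{(3;A,B+I)}_{D,\mathbb{Y}}(A_1-I,B_1,B_2,B_3;C_1-2I;z,w,v)=0.\end{aligned}$$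
   Context: A matrix in $\mathbb{C}^{r\times r}$ is positive stable if all its eigenvalues have positive real part; $I$ is the identity matrix. For $t>0$ and a square matrix $M$, $t^M=\exp(M\ln t)$. The Pochhammer symbol is $(M)_0=I$, $(M)_n=M(M+I)\cdots(M+(n-1)I)$ for $n\ge1$. For positive stable $B$ and a square matrix $W$, ${}_1F_1(A;B;W)=\sum_{n\ge0}(A)_n\,[(B)_n]^{-1}\,\frac{W^n}{n!}$. For commuting positive stable $P,Q$, the beta matrix function is $\mathfrak{B}(P,Q)=\Gamma(P)\Gamma(Q)\Gamma^{-1}(P+Q)=\int_0^1t^{P-I}(1-t)^{Q-I}dt$, where $\Gamma(P)=\int_0^\infty e^{-t}t^{P-I}dt$. For positive stable $A,B,P,Q,\mathbb{Y}$, $$\mathfrak{B}_{\mathbb{Y}}^{(A,B)}(P,Q)=\int_0^1 {}_1F_1\!\left(A;B;-\frac{\mathbb{Y}}{t(1-t)}\right)t^{P-I}(1-t)^{Q-I}\,dt .$$ For positive stable $A,A_1,B,B_1,B_2,B_3,C_1,C_1-A_1,\mathbb{Y}$ the new extended Lauricella matrix function of three variables is $$\begin{aligned}F^{(3;A,B)}_{D,\mathbb{Y}}(A_1,B_1,B_2,B_3;C_1;z,w,v)=\sum_{m,n,p\ge0}&\mathfrak{B}_{\mathbb{Y}}^{(A,B)}(A_1+(m+n+p)I,C_1-A_1)[\mathfrak{B}(A_1,C_1-A_1)]^{-1}\\&\times(B_1)_m(B_2)_n(B_3)_p\frac{z^mw^nv^p}{m!\,n!\,p!}.\end{aligned}$$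 *)

theory Defs
  imports "HOL-Analysis.Analysis"
begin

text \<open>
  Square complex matrices of size \<open>r\<close> are elements of \<open>complex^'r^'r\<close>, with matrix product \<open>**\<close>
  and identity \<open>mat 1\<close>. The type class operations \<open>*\<close>, \<open>1\<close>, \<open>^\<close> on vectors are componentwise and
  are not used on matrices. Multiplication by a complex scalar \<open>c\<close> is written \<open>mat c ** M\<close>.
\<close>

type_synonym 'r cmat = "complex ^ 'r ^ 'r"

definition eigenvalue :: "'r::finite cmat \<Rightarrow> complex \<Rightarrow> bool" where
  "eigenvalue M l \<longleftrightarrow> (\<exists>x. x \<noteq> 0 \<and> M *v x = l *s x)"

definition positive_stable :: "'r::finite cmat \<Rightarrow> bool" where
  "positive_stable M \<longleftrightarrow> (\<forall>l. eigenvalue M l \<longrightarrow> Re l > 0)"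

primrec mat_pow :: "'r::finite cmat \<Rightarrow> nat \<Rightarrow> 'r cmat" where
  "mat_pow M 0 = mat 1"
| "mat_pow M (Suc n) = mat_pow M n ** M"

definition mat_exp :: "'r::finite cmat \<Rightarrow> 'r cmat" where
  "mat_exp M = (\<Sum>n. (1 / fact n) *\<^sub>R mat_pow M n)"

text \<open>\<open>mat_powr t M\<close> is \<open>t\<^sup>M\<close>, for \<open>t > 0\<close>.\<close>

definition mat_powr :: "real \<Rightarrow> 'r::finite cmat \<Rightarrow> 'r cmat" where
  "mat_powr t M = mat_exp (ln t *\<^sub>R M)"

primrec mat_pochhammer :: "'r::finite cmat \<Rightarrow> nat \<Rightarrow> 'r cmat" where
  "mat_pochhammer M 0 = mat 1"
| "mat_pochhammer M (Suc n) = mat_pochhammer M n ** (M + mat (of_nat n))"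

definition mat_1F1 :: "'r::finite cmat \<Rightarrow> 'r cmat \<Rightarrow> 'r cmat \<Rightarrow> 'r cmat" where
  "mat_1F1 A B W =
     (\<Sum>n. mat_pochhammer A n ** matrix_inv (mat_pochhammer B n) ** ((1 / fact n) *\<^sub>R mat_pow W n))"

definition mat_Gamma :: "'r::finite cmat \<Rightarrow> 'r cmat" where
  "mat_Gamma P = (LBINT t:{0<..}. exp (- t) *\<^sub>R mat_powr t (P - mat 1))"

definition mat_Beta :: "'r::finite cmat \<Rightarrow> 'r cmat \<Rightarrow> 'r cmat" where
  "mat_Beta P Q = mat_Gamma P ** mat_Gamma Q ** matrix_inv (mat_Gamma (P + Q))"

definition ext_Beta ::
  "'r::finite cmat \<Rightarrow> 'r cmat \<Rightarrow> 'r cmat \<Rightarrow> 'r cmat \<Rightarrow> 'r cmat \<Rightarrow> 'r cmat" where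
  "ext_Beta A B Y P Q =
     (LBINT t:{0<..<1}. mat_1F1 A B (- ((1 / (t * (1 - t))) *\<^sub>R Y))
        ** mat_powr t (P - mat 1) ** mat_powr (1 - t) (Q - mat 1))"

text \<open>
  \<open>ext_Lauricella_D A B Y A1 B1 B2 B3 C1 z w v\<close> is
  $F^{(3;A,B)}_{D,Y}(A_1,B_1,B_2,B_3;C_1;z,w,v)$. The triple series is taken as an unordered sum.
\<close>

definition ext_Lauricella_D ::
  "'r::finite cmat \<Rightarrow> 'r cmat \<Rightarrow> 'r cmat \<Rightarrow> 'r cmat \<Rightarrow> 'r cmat \<Rightarrow> 'r cmat \<Rightarrow> 'r cmat \<Rightarrow> 'r cmat
     \<Rightarrow> complex \<Rightarrow> complex \<Rightarrow> complex \<Rightarrow> 'r cmat" where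
  "ext_Lauricella_D A B Y A1 B1 B2 B3 C1 z w v =
     (\<Sum>\<^sub>\<infinity>(m, n, p) \<in> (UNIV :: (nat \<times> nat \<times> nat) set).
        ext_Beta A B Y (A1 + mat (of_nat (m + n + p))) (C1 - A1)
        ** matrix_inv (mat_Beta A1 (C1 - A1))
        ** mat_pochhammer B1 m ** mat_pochhammer B2 n ** mat_pochhammer B3 p
        ** mat (z ^ m * w ^ n * v ^ p / (fact m * fact n * fact p)))"

end

theory Submission
  imports Defs "HOL-Computational_Algebra.Fundamental_Theorem_Algebra"
begin

text \<open>
  Both identities hold termwise in the triple series, because the integrands of the extended beta
  functions satisfy the contiguous relations of \<open>\<^sub>1F\<^sub>1\<close> with \<open>x = -Y/(t(1-t))\<close>; in (ii) the factor \<open>x\<close>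
  also turns \<open>t\<^sup>P\<^sup>-\<^sup>I (1-t)\<^sup>Q\<^sup>-\<^sup>I\<close> into \<open>Y\<close> times the weight of \<open>(P - I, Q - I)\<close>. What remains is
  convergence. A positive stable matrix has an exponentially decaying semigroup \<open>exp (-s M)\<close>, by
  induction on the factors of an annihilating polynomial. If \<open>B - A\<close> is positive stable, Euler's
  integral shows that \<open>\<^sub>1F\<^sub>1(A; B; -s Y)\<close> stays bounded for \<open>s \<ge> 0\<close>; the general case follows by
  lowering the second parameter from \<open>B + k\<close>. So the integrands are dominated by the beta weight,
  and the triple series by a product of binomial series. The constant of Euler's integral is
  invertible because a weight whose moments all annihilate a matrix forces that matrix to vanish
  (Weierstrass), and the gamma matrix is invertible because otherwise its kernel would contain an
  eigenvector, on which it acts as the nonzero scalar \<open>\<Gamma>(l)\<close>.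
\<close>

section \<open>The Banach algebra of square matrices\<close>

text \<open>An integral of a function that is not integrable and an \<open>infsum\<close> of a
  family that is not summable are 0 by default, so a relation between integrands or terms says
  nothing about the values before every function involved is known to converge. The obstacle is the
  argument -Y/(t(1-t)): it escapes to infinity at both endpoints, where the crude estimate of the
  entire series by exp(norm) exceeds every power of t. Only decay along the ray -sY keeps the
  integrand below the beta weight. Positive stability is a spectral condition and the matrices need
  not be diagonalisable, so it is converted once into the norm estimate \<open>exp_stable\<close>,
  which all later bounds use. The matrices B1, B2, B3 are not assumed to commute with anything. They
  stay at the right end of each term, and relations are multiplied from the left only. What has to
  be moved is built from A, B, A1, C1, Y by products, inverses, limits and integrals;
  \<open>bicommutant\<close> is the device that lets commutation survive all of these
  operations.\<close>

text \<open>A copy of the matrix type in which \<open>*\<close>, \<open>1\<close>, \<open>^\<close> and \<open>exp\<close> of the type classes are the matrix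
  operations. The class \<open>real_normed_algebra_1\<close> requires \<open>norm 1 = 1\<close>, hence the operator norm.\<close>

typedef 'r sqmat = "UNIV :: (complex^'r::finite^'r) set"
  morphisms mat_of sq ..

setup_lifting type_definition_sqmat

lemma matrix_mult_add_rdistrib: "(M + N) ** K = M ** K + N ** (K :: complex^'n::finite^'m::finite)"
  by (simp add: matrix_matrix_mult_def vec_eq_iff distrib_right sum.distrib)

lemma linear_matrix_vector_mult: "linear ((*v) (M :: complex^'n::finite^'m::finite))"
  by (intro linearI; simp add: matrix_vector_mult_def vec_eq_iff ring_distribs sum.distrib scaleR_sum_right)

lemma bounded_linear_matrix_vector_mult:
  "bounded_linear ((*v) (M :: complex^'n::finite^'m::finite))"
  using linear_matrix_vector_mult linear_conv_bounded_linear by blast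

instantiation sqmat :: (finite) ring_1
begin
lift_definition zero_sqmat :: "'a sqmat" is 0 .
lift_definition one_sqmat :: "'a sqmat" is "mat 1" .
lift_definition plus_sqmat :: "'a sqmat \<Rightarrow> 'a sqmat \<Rightarrow> 'a sqmat" is "(+)" .
lift_definition minus_sqmat :: "'a sqmat \<Rightarrow> 'a sqmat \<Rightarrow> 'a sqmat" is "(-)" .
lift_definition uminus_sqmat :: "'a sqmat \<Rightarrow> 'a sqmat" is uminus .
lift_definition times_sqmat :: "'a sqmat \<Rightarrow> 'a sqmat \<Rightarrow> 'a sqmat" is "(**)" .
instance
proof
  have "mat 1 \<noteq> (0 :: complex^'a^'a)"
    by (simp add: vec_eq_iff mat_def)
  then show "(0 :: 'a sqmat) \<noteq> 1"
    by transfer simp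
qed (transfer; simp add: matrix_mul_assoc matrix_add_ldistrib matrix_mult_add_rdistrib)+
end

instantiation sqmat :: (finite) real_algebra_1
begin
lift_definition scaleR_sqmat :: "real \<Rightarrow> 'a sqmat \<Rightarrow> 'a sqmat" is "(*\<^sub>R)" .
instance
  by (intro_classes; transfer;
      simp add: scaleR_add_right scaleR_add_left vec_eq_iff matrix_matrix_mult_def scaleR_sum_right)
end

instantiation sqmat :: (finite) real_normed_algebra_1
begin
lift_definition norm_sqmat :: "'a sqmat \<Rightarrow> real" is "\<lambda>M. onorm ((*v) M)" .
definition dist_sqmat :: "'a sqmat \<Rightarrow> 'a sqmat \<Rightarrow> real" where
  "dist_sqmat X Y = norm (X - Y)"
definition sgn_sqmat :: "'a sqmat \<Rightarrow> 'a sqmat" where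
  "sgn_sqmat X = X /\<^sub>R norm X"
definition uniformity_sqmat :: "('a sqmat \<times> 'a sqmat) filter" where
  "uniformity_sqmat = (INF e\<in>{0<..}. principal {(X, Y). dist X Y < e})"
definition open_sqmat :: "'a sqmat set \<Rightarrow> bool" where
  "open_sqmat U = (\<forall>X\<in>U. eventually (\<lambda>(X', Y). X' = X \<longrightarrow> Y \<in> U) uniformity)"
instance
proof
  note bl = bounded_linear_matrix_vector_mult
  show "norm X = 0 \<longleftrightarrow> X = 0" for X :: "'a sqmat"
  proof transfer
    fix M :: "complex^'a^'a"
    show "onorm ((*v) M) = 0 \<longleftrightarrow> M = 0"
      unfolding onorm_eq_0[OF bl] by (metis matrix_eq matrix_vector_mult_0)
  qed
  have sum: "(*v) (M + N) = (\<lambda>x. M *v x + N *v x)" for M N :: "complex^'a^'a"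
    by (simp add: fun_eq_iff matrix_vector_mult_def vec_eq_iff distrib_right sum.distrib)
  show "norm (X + Y) \<le> norm X + norm Y" for X Y :: "'a sqmat"
    by transfer (unfold sum, rule onorm_triangle[OF bl bl])
  have scale: "(*v) (a *\<^sub>R M) = (\<lambda>x. a *\<^sub>R (M *v x))" for a and M :: "complex^'a^'a"
    by (simp add: fun_eq_iff matrix_vector_mult_def vec_eq_iff scaleR_sum_right)
  show "norm (a *\<^sub>R X) = \<bar>a\<bar> * norm X" for a and X :: "'a sqmat"
    by transfer (unfold scale, rule onorm_scaleR[OF bl])
  have comp: "(*v) (M ** N) = (*v) M \<circ> (*v) N" for M N :: "complex^'a^'a"
    by (simp add: fun_eq_iff matrix_vector_mul_assoc)
  show "norm (X * Y) \<le> norm X * norm Y" for X Y :: "'a sqmat"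
    by transfer (unfold comp, rule onorm_compose[OF bl bl])
  have one: "(*v) (mat 1) = (\<lambda>x :: complex^'a. x)"
    by (simp add: fun_eq_iff)
  show "norm (1 :: 'a sqmat) = 1"
    by transfer (unfold one, rule onorm_id)
qed (simp_all add: dist_sqmat_def sgn_sqmat_def uniformity_sqmat_def open_sqmat_def)
end

section \<open>Equivalence of the operator norm with the Euclidean matrix norm\<close>

lemma matrix_vector_mult_axis_nth: "(M *v axis j 1) $ i = (M :: complex^'n::finite^'m::finite) $ i $ j"
  by (simp add: matrix_vector_mult_def axis_def if_distrib[of "(*) _"] cong: if_cong)

lemma norm_mat_of_entry: "norm (mat_of X $ i $ j) \<le> norm X"
proof -
  have "norm (mat_of X $ i $ j) \<le> norm (mat_of X *v axis j 1)"
    by (metis matrix_vector_mult_axis_nth Finite_Cartesian_Product.norm_nth_le)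
  also have "\<dots> \<le> onorm ((*v) (mat_of X)) * norm (axis j 1 :: complex^'a)"
    by (rule onorm[OF bounded_linear_matrix_vector_mult])
  also have "\<dots> = norm X"
    by (simp add: norm_sqmat.rep_eq)
  finally show ?thesis .
qed

text \<open>With \<open>bounded_linear_sq\<close> this makes the two matrix types linearly
  homeomorphic. Completeness, second countability and the final transfer of series and integrals all
  pass through this pair.\<close>

lemma bounded_linear_mat_of: "bounded_linear (mat_of :: 'r::finite sqmat \<Rightarrow> _)"
proof (rule bounded_linear_intro)
  fix X :: "'r sqmat"
  have "norm (mat_of X) \<le> (\<Sum>i\<in>UNIV. norm (mat_of X $ i))"
    unfolding norm_vec_def by (rule L2_set_le_sum) simp
  also have "\<dots> \<le> (\<Sum>i\<in>(UNIV :: 'r set). \<Sum>j\<in>(UNIV :: 'r set). norm (mat_of X $ i $ j))"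
    unfolding norm_vec_def[of "mat_of X $ _"] by (intro sum_mono L2_set_le_sum) simp
  also have "\<dots> \<le> (\<Sum>i\<in>(UNIV :: 'r set). \<Sum>j\<in>(UNIV :: 'r set). norm X)"
    by (intro sum_mono norm_mat_of_entry)
  finally show "norm (mat_of X) \<le> norm X * (real CARD('r) * real CARD('r))"
    by (simp add: mult_ac)
qed (transfer; simp)+

lemma bounded_linear_sq: "bounded_linear (sq :: _ \<Rightarrow> 'r::finite sqmat)"
proof -
  have "linear (sq :: _ \<Rightarrow> 'r sqmat)"
    by (intro linearI; simp add: eq_onp_same_args plus_sqmat.abs_eq scaleR_sqmat.abs_eq)
  then show ?thesis
    using linear_conv_bounded_linear by blast
qed

instance sqmat :: (finite) banach
proof
  fix X :: "nat \<Rightarrow> 'a sqmat"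
  assume "Cauchy X"
  then have "Cauchy (\<lambda>n. mat_of (X n))"
    by (rule bounded_linear.Cauchy[OF bounded_linear_mat_of])
  then obtain L where "(\<lambda>n. mat_of (X n)) \<longlonglongrightarrow> L"
    using Cauchy_convergent_iff convergent_def by blast
  from bounded_linear.tendsto[OF bounded_linear_sq this]
  have "X \<longlonglongrightarrow> sq L"
    by (simp add: mat_of_inverse)
  then show "convergent X"
    by (rule convergentI)
qed

text \<open>Bochner integrals of \<open>sqmat\<close>-valued functions are taken in this class; a
  countable basis is pulled back along \<open>mat_of\<close>.\<close>

instance sqmat :: (finite) second_countable_topology
proof
  obtain B :: "(complex^'a^'a) set set" where B: "countable B" "topological_basis B"
    using ex_countable_basis by blast
  have "topological_basis ((\<lambda>b. mat_of -` b) ` B :: 'a sqmat set set)"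
    unfolding topological_basis_def
  proof safe
    fix b assume "b \<in> B"
    then show "open (mat_of -` b :: 'a sqmat set)"
      using topological_basis_open[OF B(2)] bounded_linear_mat_of
      by (intro open_vimage) (auto intro: bounded_linear.continuous_on continuous_on_id)
  next
    fix U :: "'a sqmat set" assume "open U"
    then have "open (sq -` U)"
      by (intro open_vimage bounded_linear.continuous_on[OF bounded_linear_sq] continuous_on_id)
    then obtain B' where B': "B' \<subseteq> B" "\<Union>B' = sq -` U"
      using B(2) unfolding topological_basis_def by blast
    have "\<Union>((\<lambda>b. mat_of -` b) ` B') = mat_of -` (\<Union>B')"
      by auto
    also have "\<dots> = U"
      using B'(2) by (auto simp: mat_of_inverse)
    finally show "\<exists>B''\<subseteq>(\<lambda>b. mat_of -` b) ` B. \<Union>B'' = U"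
      using B'(1) by (intro exI[of _ "(\<lambda>b. mat_of -` b) ` B'"]) auto
  qed
  then show "\<exists>B::'a sqmat set set. countable B \<and> open = generate_topology B"
    using B(1) topological_basis_imp_subbasis by (intro exI[of _ "(\<lambda>b. mat_of -` b) ` B"]) auto
qed

lemma mat_of_sq [simp]: "mat_of (sq M) = M"
  by (simp add: sq_inverse)

lemma sq_mat_of [simp]: "sq (mat_of X) = X"
  by (rule mat_of_inverse)

lemma sq_mult: "sq (M ** N) = sq M * sq N"
  by (simp add: times_sqmat.abs_eq)

lemma sq_diff: "sq (M - N) = sq M - sq N" and sq_scaleR: "sq (c *\<^sub>R M) = c *\<^sub>R sq M"
  by (simp_all add: bounded_linear.linear[OF bounded_linear_sq] linear_diff linear_scale)

lemma sq_one: "sq (mat 1) = 1"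
  by (simp add: one_sqmat.abs_eq)

lemma sq_eq_iff: "sq M = sq N \<longleftrightarrow> M = N"
  by (metis mat_of_sq)

lemma left_right_inverse_sqmat: "X * Y = 1 \<longleftrightarrow> Y * X = (1 :: 'r::finite sqmat)"
  by transfer (rule matrix_left_right_inverse)

text \<open>A kernel vector is repeated in every column, so that later arguments can speak of
  annihilated matrices and stay inside the algebra.\<close>

lemma noninvertible_imp_annihilates:
  fixes X :: "'r::finite sqmat"
  assumes "\<nexists>Y. X * Y = 1"
  obtains Z where "Z \<noteq> 0" "X * Z = 0"
proof -
  have "\<nexists>N. N ** mat_of X = mat 1"
    using assms by (metis left_right_inverse_sqmat sq_mat_of sq_mult sq_one)
  then obtain x where x: "mat_of X *v x = 0" "x \<noteq> 0"
    using matrix_left_invertible_ker[of "mat_of X"] by blast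
  define N :: "complex^'r^'r" where "N = (\<chi> i j. x $ i)"
  have "N \<noteq> 0"
    using x(2) by (auto simp: N_def vec_eq_iff)
  moreover have "mat_of X ** N = 0"
    using x(1) by (simp add: N_def vec_eq_iff matrix_matrix_mult_def matrix_vector_mult_def)
  ultimately show ?thesis
    using that[of "sq N"] by (metis mat_of_sq sq_mult sq_mat_of zero_sqmat.abs_eq zero_sqmat.rep_eq)
qed

subsection \<open>Complex scalars\<close>

text \<open>The algebra is declared over the reals only; complex scalars, needed for eigenvalues,
  enter as central elements.\<close>

definition cscalar :: "complex \<Rightarrow> 'r::finite sqmat" where
  "cscalar c = sq (mat c)"

lemma mat_mult_eq_scaleC: "mat c ** M = (\<chi> i j. c * (M :: complex^'n::finite^'n) $ i $ j)"
  by (simp add: vec_eq_iff matrix_matrix_mult_def mat_def if_distrib if_distribR sum.delta' cong: if_cong)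

lemma mult_mat_eq_scaleC: "M ** mat c = (\<chi> i j. c * (M :: complex^'n::finite^'n) $ i $ j)"
  by (simp add: vec_eq_iff matrix_matrix_mult_def mat_def if_distrib if_distribR sum.delta' mult.commute cong: if_cong)

lemma cscalar_commute: "cscalar c * X = X * cscalar c"
  unfolding cscalar_def by transfer (simp add: mat_mult_eq_scaleC mult_mat_eq_scaleC)

lemma mat_add_complex: "mat (a + b) = mat a + (mat b :: complex^'n::finite^'n)"
  by (simp add: mat_def vec_eq_iff)

lemma bounded_linear_cscalar: "bounded_linear (cscalar :: complex \<Rightarrow> 'r::finite sqmat)"
proof -
  have "linear (mat :: complex \<Rightarrow> complex^'r^'r)"
    by (intro linearI; simp add: mat_def vec_eq_iff)
  then show ?thesis
    unfolding cscalar_def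
    using bounded_linear_compose[OF bounded_linear_sq] linear_conv_bounded_linear by blast
qed

lemma cscalar_diff: "cscalar (a - b) = cscalar a - cscalar b" and cscalar_0: "cscalar 0 = 0"
  by (simp_all add: linear_diff linear_0 bounded_linear.linear[OF bounded_linear_cscalar])

lemma cscalar_mult: "cscalar (a * b) = cscalar a * cscalar b"
  unfolding cscalar_def sq_mult[symmetric] sq_eq_iff
  by (simp add: mat_mult_eq_scaleC) (simp add: mat_def vec_eq_iff)

lemma cscalar_1: "cscalar 1 = 1"
  by (simp add: cscalar_def sq_one)

lemma cscalar_of_real: "cscalar (of_real x) = x *\<^sub>R 1"
  unfolding cscalar_def sq_one[symmetric] sq_scaleR[symmetric] sq_eq_iff
  by (simp add: mat_def vec_eq_iff complex_eq_iff)

text \<open>The inequality used for \<open>c\<close> and for \<open>inverse c\<close> gives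
  equality, so norms can be moved across a scalar exponential in both directions.\<close>

lemma norm_cscalar_mult: "norm (cscalar c * X) = cmod c * norm (X :: 'r::finite sqmat)"
proof -
  have n: "norm (c *s x) = cmod c * norm x" for c and x :: "complex^'r"
    by (simp add: norm_vec_def norm_mult L2_set_right_distrib)
  have le: "norm (cscalar c * Z) \<le> cmod c * norm Z" for c and Z :: "'r sqmat"
  proof -
    have "(mat c ** mat_of Z) *v x = c *s (mat_of Z *v x)" for x
      by (simp add: mat_mult_eq_scaleC matrix_vector_mult_def vec_eq_iff sum_distrib_left mult.assoc)
    then show ?thesis
      using onorm[OF bounded_linear_matrix_vector_mult, of "mat_of Z"]
      by (auto simp: cscalar_def norm_sqmat.rep_eq times_sqmat.rep_eq n mult.assoc
          intro!: onorm_le mult_left_mono)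
  qed
  show ?thesis
  proof (cases "c = 0")
    case False
    have "norm X = norm (cscalar (inverse c) * (cscalar c * X))"
      using False by (simp add: mult.assoc[symmetric] cscalar_mult[symmetric] cscalar_1)
    also have "\<dots> \<le> cmod (inverse c) * norm (cscalar c * X)"
      by (rule le)
    finally have "cmod c * norm X \<le> norm (cscalar c * X)"
      using False by (simp add: norm_inverse) (simp add: field_simps)
    then show ?thesis
      using le[of c X] by simp
  qed (simp add: cscalar_0)
qed

lemma exp_cscalar: "exp (cscalar c :: 'r::finite sqmat) = cscalar (exp c)"
proof -
  have pow: "(cscalar c :: 'r sqmat) ^ n = cscalar (c ^ n)" for n
    by (induction n) (simp_all add: cscalar_1 cscalar_mult)
  have "(\<lambda>n. cscalar (c ^ n /\<^sub>R fact n) :: 'r sqmat) sums cscalar (exp c)"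
    by (intro bounded_linear.sums[OF bounded_linear_cscalar] exp_converges)
  then have "(\<lambda>n. (cscalar c :: 'r sqmat) ^ n /\<^sub>R fact n) sums cscalar (exp c)"
    by (simp add: pow linear_scale bounded_linear.linear[OF bounded_linear_cscalar])
  then show ?thesis
    using exp_converges sums_unique2 by blast
qed

section \<open>Exponential stability\<close>

text \<open>With s = - ln t this bounds t^M by a positive power of t on (0,1], the form in which it
  makes beta integrals converge. The factor \<open>C\<close> may have to exceed 1 when
  \<open>M\<close> is not normal.\<close>

definition exp_stable :: "'a::{real_normed_algebra_1,banach} \<Rightarrow> bool" where
  "exp_stable M \<longleftrightarrow> (\<exists>C \<delta>. \<delta> > 0 \<and> (\<forall>s\<ge>0. norm (exp (- (s *\<^sub>R M))) \<le> C * exp (- (\<delta> * s))))"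

text \<open>Commuting exponentials multiply, so decay rates add. This makes \<open>P + Q\<close> an
  admissible argument of the gamma function.\<close>

lemma exp_stable_add:
  fixes M N :: "'a::{real_normed_algebra_1,banach}"
  assumes "exp_stable M" "exp_stable N" and comm: "M * N = N * M"
  shows "exp_stable (M + N)"
proof -
  obtain C \<delta> where M: "\<delta> > 0" "\<And>s. s \<ge> 0 \<Longrightarrow> norm (exp (- (s *\<^sub>R M))) \<le> C * exp (- (\<delta> * s))"
    using assms(1) unfolding exp_stable_def by blast
  obtain D \<epsilon> where N: "\<epsilon> > 0" "\<And>s. s \<ge> 0 \<Longrightarrow> norm (exp (- (s *\<^sub>R N))) \<le> D * exp (- (\<epsilon> * s))"
    using assms(2) unfolding exp_stable_def by blast
  have "norm (exp (- (s *\<^sub>R (M + N)))) \<le> (C * D) * exp (- ((\<delta> + \<epsilon>) * s))" if "s \<ge> 0" for s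
  proof -
    have "exp (- (s *\<^sub>R (M + N))) = exp (- (s *\<^sub>R M) + - (s *\<^sub>R N))"
      by (simp add: scaleR_add_right)
    also have "\<dots> = exp (- (s *\<^sub>R M)) * exp (- (s *\<^sub>R N))"
      by (rule exp_add_commuting) (simp add: comm)
    also have "norm \<dots> \<le> (C * exp (- (\<delta> * s))) * (D * exp (- (\<epsilon> * s)))"
      by (rule order_trans[OF norm_mult_ineq])
        (meson M(2) N(2) that mult_mono norm_ge_zero order_trans)
    also have "\<dots> = (C * D) * exp (- ((\<delta> + \<epsilon>) * s))"
      by (simp add: exp_add[symmetric] algebra_simps)
    finally show ?thesis .
  qed
  then show ?thesis
    unfolding exp_stable_def using M(1) N(1) by (intro exI[of _ "C * D"] exI[of _ "\<delta> + \<epsilon>"]) auto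
qed

lemma exp_of_real_add:
  "exp (of_real c + M) = exp c *\<^sub>R exp (M :: 'a::{real_normed_algebra_1,banach})"
proof -
  have "of_real c * M = M * of_real c"
    by (simp add: of_real_def)
  from exp_add_commuting[OF this] show ?thesis
    by (simp only: exp_of_real scaleR_conv_of_real)
qed

lemma exp_stable_add_of_real:
  assumes "exp_stable (M :: 'a::{real_normed_algebra_1,banach})" "c \<ge> 0"
  shows "exp_stable (M + of_real c)"
proof -
  obtain C \<delta> where M: "\<delta> > 0" "\<And>s. s \<ge> 0 \<Longrightarrow> norm (exp (- (s *\<^sub>R M))) \<le> C * exp (- (\<delta> * s))"
    using assms(1) unfolding exp_stable_def by blast
  have "norm (exp (- (s *\<^sub>R (M + of_real c)))) \<le> C * exp (- (\<delta> * s))" if "s \<ge> 0" for s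
  proof -
    have "- (s *\<^sub>R (M + of_real c)) = of_real (- (s * c)) + - (s *\<^sub>R M)"
      by (simp add: scaleR_conv_of_real distrib_left)
    then have "norm (exp (- (s *\<^sub>R (M + of_real c)))) = exp (- (s * c)) * norm (exp (- (s *\<^sub>R M)))"
      by (simp only: exp_of_real_add norm_scaleR) simp
    also have "\<dots> \<le> 1 * norm (exp (- (s *\<^sub>R M)))"
      by (intro mult_right_mono) (use that assms(2) in auto)
    finally show ?thesis
      using M(2)[OF that] by simp
  qed
  then show ?thesis
    unfolding exp_stable_def using M(1) by blast
qed

lemma exp_stable_add_of_nat:
  assumes "exp_stable (M :: 'a::{real_normed_algebra_1,banach})"
  shows "exp_stable (M + of_nat n)"
  using exp_stable_add_of_real[OF assms, of "real n"] by simp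

text \<open>The growth of exp(-sM) is at most exp(s norm M), which a shift by more than the norm
  overcomes, whatever the spectrum of \<open>M\<close>.\<close>

lemma exp_stable_add_large:
  assumes "norm (M :: 'a::{real_normed_algebra_1,banach}) < c"
  shows "exp_stable (M + of_real c)"
proof -
  have "norm (exp (- (s *\<^sub>R (M + of_real c)))) \<le> 1 * exp (- ((c - norm M) * s))" if "s \<ge> 0" for s
  proof -
    have "- (s *\<^sub>R (M + of_real c)) = of_real (- (s * c)) + - (s *\<^sub>R M)"
      by (simp add: scaleR_conv_of_real distrib_left)
    then have "norm (exp (- (s *\<^sub>R (M + of_real c)))) = exp (- (s * c)) * norm (exp (- (s *\<^sub>R M)))"
      by (simp only: exp_of_real_add norm_scaleR) simp
    also have "\<dots> \<le> exp (- (s * c)) * exp (s * norm M)"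
      using norm_exp[of "- (s *\<^sub>R M)"] that by (intro mult_left_mono) auto
    also have "\<dots> = 1 * exp (- ((c - norm M) * s))"
      by (simp add: exp_add[symmetric] algebra_simps)
    finally show ?thesis .
  qed
  then show ?thesis
    unfolding exp_stable_def using assms by (intro exI[of _ 1] exI[of _ "c - norm M"]) auto
qed

lemma exp_commute:
  fixes X Y :: "'a::{real_normed_algebra_1,banach}"
  assumes "X * Y = Y * X"
  shows "exp X * Y = Y * exp X"
proof -
  have *: "X ^ n * Y = Y * X ^ n" for n
    by (rule power_commuting_commutes[OF assms])
  have "exp X * Y = (\<Sum>n. (X ^ n /\<^sub>R fact n) * Y)"
    unfolding exp_def by (rule suminf_mult2) (rule summable_exp_generic)
  also have "\<dots> = (\<Sum>n. Y * (X ^ n /\<^sub>R fact n))"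
    by (simp add: *)
  also have "\<dots> = Y * exp X"
    unfolding exp_def by (rule suminf_mult) (rule summable_exp_generic)
  finally show ?thesis .
qed

text \<open>Only the constant term of the series survives. For X a multiple of M - l and Z an
  eigenvector for l, this shows that exponentials of M act on Z as scalars.\<close>

lemma exp_mult_eq_of_annihilates:
  fixes X Z :: "'a::{real_normed_algebra_1,banach}"
  assumes "X * Z = 0"
  shows "exp X * Z = Z"
proof -
  have "exp X * Z = (\<Sum>n. (X ^ n /\<^sub>R fact n) * Z)"
    unfolding exp_def by (rule suminf_mult2) (rule summable_exp_generic)
  also have "\<dots> = (\<Sum>n\<in>{0}. (X ^ n /\<^sub>R fact n) * Z)"
  proof (rule suminf_finite)
    fix n :: nat assume "n \<notin> {0}"
    then obtain k where "n = Suc k"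
      using not0_implies_Suc by auto
    then show "(X ^ n /\<^sub>R fact n) * Z = 0"
      using assms by (simp add: power_Suc2 mult.assoc del: power_Suc)
  qed simp
  finally show ?thesis
    by simp
qed

subsection \<open>Annihilating polynomials and eigenvalues\<close>

lemma power_linear_dependence:
  fixes X :: "'r::finite sqmat"
  obtains N and c :: "nat \<Rightarrow> real" where "\<exists>i\<le>N. c i \<noteq> 0" "(\<Sum>i\<le>N. c i *\<^sub>R X ^ i) = 0"
proof -
  define N where "N = DIM(complex^'r^'r)"
  define f where "f = (\<lambda>i. mat_of (X ^ i))"
  \<comment> \<open>Linear dependence is a property of sets, so a repetition among the powers has to
    supply its relation separately. \<open>N\<close> is the real dimension, hence
    \<open>N + 1\<close> distinct powers are dependent.\<close>
  show thesis
  proof (cases "inj_on f {..N}")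
    case False
    then obtain i j where ij: "i \<le> N" "j \<le> N" "i \<noteq> j" "f i = f j"
      unfolding inj_on_def by auto
    then have "X ^ i = X ^ j"
      unfolding f_def by (metis sq_mat_of)
    with ij have "(\<Sum>k\<le>N. (of_bool (k = i) - of_bool (k = j)) *\<^sub>R X ^ k) = 0"
      by (simp add: scaleR_left_diff_distrib sum_subtractf of_bool_def if_distrib[of "\<lambda>x. x *\<^sub>R _"] cong: if_cong)
    then show thesis
      using ij by (intro that[of N "\<lambda>k. of_bool (k = i) - of_bool (k = j)"]) (auto intro!: exI[of _ i])
  next
    case True
    then have "card (f ` {..N}) > DIM(complex^'r^'r)"
      by (simp add: card_image N_def)
    then have "dependent (f ` {..N})"
      using dependent_biggerset by blast
    then obtain u where u: "\<exists>v\<in>f ` {..N}. u v \<noteq> 0" "(\<Sum>v\<in>f ` {..N}. u v *\<^sub>R v) = 0"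
      using dependent_finite[of "f ` {..N}"] by auto
    have "sq (\<Sum>i\<le>N. u (f i) *\<^sub>R f i) = 0"
      using u(2) True by (simp add: sum.reindex linear_0[OF bounded_linear.linear[OF bounded_linear_sq]])
    then have "(\<Sum>i\<le>N. u (f i) *\<^sub>R X ^ i) = 0"
      by (simp add: linear_sum[OF bounded_linear.linear[OF bounded_linear_sq]] sq_scaleR f_def)
    then show thesis
      using u(1) by (intro that[of N "\<lambda>i. u (f i)"]) auto
  qed
qed

definition lin_factors :: "'r::finite sqmat \<Rightarrow> complex list \<Rightarrow> 'r sqmat" where
  "lin_factors X L = prod_list (map (\<lambda>l. X - cscalar l) L)"

text \<open>Every complex root splits off one factor, and evaluation at \<open>X\<close> respects
  the factorisation because \<open>X\<close> commutes with its powers and with scalars.\<close>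

lemma poly_factors_sqmat:
  fixes X :: "'r::finite sqmat"
  assumes "p \<noteq> 0"
  shows "\<exists>L c. c \<noteq> 0 \<and> (\<Sum>i\<le>degree p. cscalar (coeff p i) * X ^ i) = lin_factors X L * cscalar c"
  using assms
proof (induction "degree p" arbitrary: p)
  case 0
  then have "coeff p 0 \<noteq> 0"
    using leading_coeff_0_iff[of p] by simp
  moreover have "(\<Sum>i\<le>degree p. cscalar (coeff p i) * X ^ i) = lin_factors X [] * cscalar (coeff p 0)"
    unfolding lin_factors_def 0(1)[symmetric] by simp
  ultimately show ?case
    by blast
next
  case (Suc n)
  then obtain l where "poly p l = 0"
    using alg_closed_imp_poly_has_root[of p] by auto
  then obtain q where q: "p = [:-l, 1:] * q"
    by (metis poly_eq_0_iff_dvd dvdE)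
  with Suc have "q \<noteq> 0"
    by auto
  have "degree p = degree [:-l, 1:] + degree q"
    unfolding q by (rule degree_mult_eq) (use \<open>q \<noteq> 0\<close> in auto)
  with Suc have n: "n = degree q"
    by simp
  have "coeff p i = coeff (pCons 0 q) i - l * coeff q i" for i
    by (simp add: q)
  then have "(\<Sum>i\<le>degree p. cscalar (coeff p i) * X ^ i) =
      (\<Sum>i\<le>Suc n. cscalar (coeff (pCons 0 q) i) * X ^ i) - (\<Sum>i\<le>Suc n. cscalar l * (cscalar (coeff q i) * X ^ i))"
    unfolding Suc(2)[symmetric]
    by (simp only: cscalar_diff cscalar_mult left_diff_distrib sum_subtractf mult.assoc)
  \<comment> \<open>The coefficient of index 0 in \<open>pCons 0 q\<close> is 0; dropping it and
    shifting the index extracts one factor \<open>X\<close>.\<close>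
  also have "(\<Sum>i\<le>Suc n. cscalar (coeff (pCons 0 q) i) * X ^ i) = (\<Sum>i\<le>n. X * (cscalar (coeff q i) * X ^ i))"
  proof -
    have "cscalar a * X ^ Suc i = X * (cscalar a * X ^ i)" for a i
      unfolding power_Suc by (simp only: mult.assoc[symmetric] cscalar_commute[of a X])
    then show ?thesis
      by (subst sum.atMost_Suc_shift) (simp add: cscalar_0 del: power_Suc)
  qed
  also have "(\<Sum>i\<le>Suc n. cscalar l * (cscalar (coeff q i) * X ^ i)) = (\<Sum>i\<le>n. cscalar l * (cscalar (coeff q i) * X ^ i))"
    by (simp add: n coeff_eq_0 cscalar_0)
  finally have "(\<Sum>i\<le>degree p. cscalar (coeff p i) * X ^ i) =
      (X - cscalar l) * (\<Sum>i\<le>degree q. cscalar (coeff q i) * X ^ i)"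
    by (simp add: n left_diff_distrib sum_distrib_left sum_subtractf)
  moreover obtain L c where "c \<noteq> 0" "(\<Sum>i\<le>degree q. cscalar (coeff q i) * X ^ i) = lin_factors X L * cscalar c"
    using Suc(1)[OF n \<open>q \<noteq> 0\<close>] by blast
  ultimately show ?case
    by (intro exI[of _ "l # L"] exI[of _ c]) (simp add: lin_factors_def mult.assoc)
qed

text \<open>A weak form of Cayley-Hamilton: the list may contain numbers that are not eigenvalues,
  and \<open>exp_decay_of_factors\<close> has to discard them.\<close>

lemma ex_annihilating_factors:
  fixes X :: "'r::finite sqmat"
  obtains L where "lin_factors X L = 0"
proof -
  obtain N and a :: "nat \<Rightarrow> real" where a: "\<exists>i\<le>N. a i \<noteq> 0" "(\<Sum>i\<le>N. a i *\<^sub>R X ^ i) = 0"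
    by (rule power_linear_dependence)
  define p where "p = (\<Sum>i\<le>N. monom (complex_of_real (a i)) i)"
  have coeff: "coeff p i = (if i \<le> N then of_real (a i) else 0)" for i
    by (simp add: p_def coeff_sum sum.delta')
  with a(1) have "p \<noteq> 0"
    by (metis coeff_0 of_real_eq_0_iff)
  have "degree p \<le> N"
    by (rule degree_le) (simp add: coeff)
  then have "(\<Sum>i\<le>degree p. cscalar (coeff p i) * X ^ i) = (\<Sum>i\<le>N. cscalar (coeff p i) * X ^ i)"
    by (intro sum.mono_neutral_left) (auto simp: coeff_eq_0 cscalar_0)
  also have "\<dots> = 0"
    using a(2) by (simp add: coeff cscalar_of_real)
  finally obtain L c where "c \<noteq> 0" "lin_factors X L * cscalar c = 0"
    using poly_factors_sqmat[OF \<open>p \<noteq> 0\<close>, of X] by metis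
  then have "lin_factors X L * cscalar (c * inverse c) = 0"
    by (simp only: cscalar_mult mult.assoc[symmetric] mult_zero_left)
  with \<open>c \<noteq> 0\<close> show thesis
    by (intro that[of L]) (simp add: cscalar_1)
qed

text \<open>From left to right the eigenvector is repeated in all columns; from right to left any
  nonzero column of \<open>Z\<close> is an eigenvector.\<close>

lemma eigenvalue_iff_sqmat:
  "eigenvalue M l \<longleftrightarrow> (\<exists>Z. Z \<noteq> 0 \<and> sq M * Z = cscalar l * Z)" for M :: "complex^'r::finite^'r"
proof
  assume "eigenvalue M l"
  then obtain x where x: "x \<noteq> 0" "M *v x = l *s x"
    unfolding eigenvalue_def by blast
  define N :: "complex^'r^'r" where "N = (\<chi> i j. x $ i)"
  have "N \<noteq> 0"
    using x(1) by (auto simp: N_def vec_eq_iff)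
  moreover have "M ** N = mat l ** N"
  proof -
    have "(M ** N) $ i $ j = (M *v x) $ i" for i j
      by (simp add: N_def matrix_matrix_mult_def matrix_vector_mult_def)
    then have "M ** N = (\<chi> i j. l * N $ i $ j)"
      unfolding x(2) by (simp add: vec_eq_iff N_def)
    then show ?thesis
      by (simp only: mat_mult_eq_scaleC)
  qed
  ultimately show "\<exists>Z. Z \<noteq> 0 \<and> sq M * Z = cscalar l * Z"
    unfolding cscalar_def
    by (intro exI[of _ "sq N"]) (simp only: sq_mult[symmetric] zero_sqmat.abs_eq sq_eq_iff simp_thms)
next
  assume "\<exists>Z. Z \<noteq> 0 \<and> sq M * Z = cscalar l * Z"
  then obtain Z where Z: "Z \<noteq> 0" "sq M * Z = cscalar l * Z"
    by blast
  define N where "N = mat_of Z"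
  have sqN: "Z = sq N"
    by (simp add: N_def)
  have N: "N \<noteq> 0" "M ** N = mat l ** N"
    using Z unfolding sqN cscalar_def
    by (simp_all only: sq_mult[symmetric] zero_sqmat.abs_eq sq_eq_iff simp_thms)
  then obtain i j where "N $ i $ j \<noteq> 0"
    by (auto simp: vec_eq_iff)
  then have "column j N \<noteq> 0"
    by (auto simp: column_def vec_eq_iff)
  moreover have "M *v column j N = l *s column j N"
  proof -
    have "(M *v column j N) $ i = (M ** N) $ i $ j" for i
      by (simp add: column_def matrix_matrix_mult_def matrix_vector_mult_def)
    then show ?thesis
      unfolding N(2) mat_mult_eq_scaleC by (simp add: column_def vec_eq_iff)
  qed
  ultimately show "eigenvalue M l"
    unfolding eigenvalue_def by blast
qed

lemma lin_factors_commute: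
  assumes "Y * X = X * Y"
  shows "lin_factors X L * Y = Y * lin_factors X L"
proof (induction L)
  case (Cons l L)
  have "lin_factors X (l # L) * Y = (X - cscalar l) * (lin_factors X L * Y)"
    by (simp add: lin_factors_def mult.assoc)
  also have "\<dots> = (X * Y - cscalar l * Y) * lin_factors X L"
    by (simp add: Cons left_diff_distrib mult.assoc)
  also have "\<dots> = Y * lin_factors X (l # L)"
    by (simp add: assms cscalar_commute lin_factors_def right_diff_distrib mult.assoc[symmetric])
  finally show ?case .
qed (simp add: lin_factors_def)

text \<open>The definition puts the head factor on the left. On the right end it can be absorbed
  into the annihilated matrix, which is how the inductions over the list proceed.\<close>

lemma lin_factors_Cons: "lin_factors X (l # L) = lin_factors X L * (X - cscalar l)"
proof -
  have "(X - cscalar l) * X = X * (X - cscalar l)"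
    by (simp add: left_diff_distrib right_diff_distrib) (rule cscalar_commute)
  from lin_factors_commute[OF this, of L] show ?thesis
    by (simp add: lin_factors_def)
qed

text \<open>Multiply \<open>Z\<close> by the factors X - l one at a time: the last nonzero product
  is an eigenvector. Any \<open>G\<close> commuting with \<open>X\<close> passes through the
  factors, so it still annihilates this product.\<close>

lemma ex_eigenvector_in_annihilator:
  fixes X Z :: "'r::finite sqmat"
  assumes "Z \<noteq> 0"
  obtains l W where "W \<noteq> 0" "X * W = cscalar l * W" "\<And>G. G * X = X * G \<Longrightarrow> G * Z = 0 \<Longrightarrow> G * W = 0"
proof -
  have "\<exists>l W. W \<noteq> 0 \<and> X * W = cscalar l * W \<and> (\<forall>G. G * X = X * G \<longrightarrow> G * Z = 0 \<longrightarrow> G * W = 0)"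
    if "lin_factors X L * Z = 0" for L
    using that assms
  proof (induction L arbitrary: Z)
    case Nil
    then show ?case
      by (simp add: lin_factors_def)
  next
    case (Cons l L)
    show ?case
    proof (cases "(X - cscalar l) * Z = 0")
      case True
      then show ?thesis
        using Cons.prems by (intro exI[of _ l] exI[of _ Z]) (auto simp: left_diff_distrib)
    next
      case False
      moreover have "lin_factors X L * ((X - cscalar l) * Z) = 0"
        using Cons.prems(1) by (simp only: lin_factors_Cons mult.assoc)
      ultimately obtain l' W where W: "W \<noteq> 0" "X * W = cscalar l' * W"
        "\<And>G. G * X = X * G \<Longrightarrow> G * ((X - cscalar l) * Z) = 0 \<Longrightarrow> G * W = 0"
        using Cons.IH[of "(X - cscalar l) * Z"] by blast
      have "G * W = 0" if "G * X = X * G" "G * Z = 0" for G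
      proof (rule W(3)[OF that(1)])
        have "G * (X - cscalar l) = (X - cscalar l) * G"
          by (simp add: left_diff_distrib right_diff_distrib that(1) cscalar_commute[of l G])
        then show "G * ((X - cscalar l) * Z) = 0"
          by (simp add: mult.assoc[symmetric]) (simp add: mult.assoc that(2))
      qed
      with W show ?thesis
        by blast
    qed
  qed
  moreover obtain L where "lin_factors X L = 0"
    by (rule ex_annihilating_factors)
  ultimately show thesis
    using that by (metis mult_zero_left)
qed

text \<open>Peeling off one factor \<open>X - l\<close> turns the decay of \<open>exp (-s X) (X - l) Z\<close> into a bound on the
  derivative of \<open>exp (s (l - X)) Z\<close>.\<close>

lemma exp_decay_step:
  fixes X Z :: "'r::finite sqmat"
  assumes bound: "\<And>s. s \<ge> 0 \<Longrightarrow> norm (exp (- (s *\<^sub>R X)) * ((X - cscalar l) * Z)) \<le> C * exp (- (\<delta> * s))"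
    and l: "\<delta> < Re l"
  shows "\<exists>C. \<forall>s\<ge>0. norm (exp (- (s *\<^sub>R X)) * Z) \<le> C * exp (- (\<delta> * s))"
proof -
  define N where "N = cscalar l - X"
  \<comment> \<open>Chosen so that \<open>D * exp ((Re l - \<delta>) * s)\<close> has derivative
    \<open>C * exp ((Re l - \<delta>) * s)\<close>, the bound on the derivative of
    \<open>G\<close>.\<close>
  define D where "D = C / (Re l - \<delta>)"
  define G where "G = (\<lambda>s. exp (s *\<^sub>R N) * Z)"
  have C: "C \<ge> 0"
    using order_trans[OF norm_ge_zero bound[of 0]] by simp
  have expN: "exp (s *\<^sub>R N) = cscalar (exp (s *\<^sub>R l)) * exp (- (s *\<^sub>R X))" for s
  proof -
    have "s *\<^sub>R N = cscalar (s *\<^sub>R l) + - (s *\<^sub>R X)"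
      by (simp add: N_def scaleR_diff_right linear_scale[OF bounded_linear.linear[OF bounded_linear_cscalar]])
    then show ?thesis
      by (simp only: exp_cscalar[symmetric]) (rule exp_add_commuting, rule cscalar_commute)
  qed
  have norm_expN: "norm (exp (s *\<^sub>R N) * W) = exp (Re l * s) * norm (exp (- (s *\<^sub>R X)) * W)" for s W
    by (simp add: expN mult.assoc norm_cscalar_mult mult.commute)
  have G': "(G has_vector_derivative exp (s *\<^sub>R N) * (N * Z)) (at s)" for s
    unfolding G_def
    using bounded_linear.has_vector_derivative[OF bounded_linear_mult_left exp_scaleR_has_vector_derivative_right[of N s UNIV], of Z]
    by (simp add: mult.assoc)
  have bound': "norm (exp (s *\<^sub>R N) * (N * Z)) \<le> C * exp ((Re l - \<delta>) * s)" if "s \<ge> 0" for s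
  proof -
    have "exp (s *\<^sub>R N) * (N * Z) = - (exp (s *\<^sub>R N) * ((X - cscalar l) * Z))"
      by (simp add: N_def algebra_simps)
    then have "norm (exp (s *\<^sub>R N) * (N * Z)) = exp (Re l * s) * norm (exp (- (s *\<^sub>R X)) * ((X - cscalar l) * Z))"
      by (simp add: norm_expN)
    also have "\<dots> \<le> exp (Re l * s) * (C * exp (- (\<delta> * s)))"
      by (intro mult_left_mono bound that) simp
    also have "\<dots> = C * exp ((Re l - \<delta>) * s)"
      by (simp add: exp_add[symmetric] algebra_simps)
    finally show ?thesis .
  qed
  have "norm (exp (- (s *\<^sub>R X)) * Z) \<le> (norm Z + D) * exp (- (\<delta> * s))" if "s > 0" for s
  proof -
    have "norm (G s - G 0) \<le> D * exp ((Re l - \<delta>) * s) - D * exp ((Re l - \<delta>) * 0)"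
    proof (rule differentiable_bound_general[OF that])
      show "continuous_on {0..s} G"
        by (intro continuous_at_imp_continuous_on ballI) (rule has_vector_derivative_continuous[OF G'])
      show "continuous_on {0..s} (\<lambda>s. D * exp ((Re l - \<delta>) * s))"
        by (intro continuous_intros)
      show "(G has_vector_derivative exp (x *\<^sub>R N) * (N * Z)) (at x)" for x
        by (rule G')
      show "((\<lambda>s. D * exp ((Re l - \<delta>) * s)) has_vector_derivative C * exp ((Re l - \<delta>) * x)) (at x)" for x
        unfolding has_real_derivative_iff_has_vector_derivative[symmetric] D_def
        by (rule derivative_eq_intros refl)+ (use l in simp)
      show "norm (exp (x *\<^sub>R N) * (N * Z)) \<le> C * exp ((Re l - \<delta>) * x)" if "0 < x" for x
        by (rule bound') (use that in simp)
    qed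
    also have "\<dots> \<le> D * exp ((Re l - \<delta>) * s)"
      using C l by (simp add: D_def)
    finally have "norm (G s) \<le> norm Z + D * exp ((Re l - \<delta>) * s)"
      using norm_triangle_sub[of "G s" "G 0"] by (simp add: G_def)
    then have "exp (Re l * s) * norm (exp (- (s *\<^sub>R X)) * Z) \<le> norm Z + D * exp ((Re l - \<delta>) * s)"
      unfolding G_def norm_expN .
    \<comment> \<open>The exponential is at least 1 because \<delta> < \<open>Re l\<close> and
      \<open>s\<close> is positive.\<close>
    also have "\<dots> \<le> norm Z * exp ((Re l - \<delta>) * s) + D * exp ((Re l - \<delta>) * s)"
      using l that by (intro add_right_mono mult_le_cancel_left1[THEN iffD2]) auto
    also have "\<dots> = exp (Re l * s) * ((norm Z + D) * exp (- (\<delta> * s)))"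
      by (simp add: left_diff_distrib exp_diff exp_minus field_simps)
    finally show ?thesis
      by simp
  qed
  moreover have "norm (exp (- (0 *\<^sub>R X)) * Z) \<le> (norm Z + D) * exp (- (\<delta> * 0))"
    using C l by (simp add: D_def)
  ultimately show ?thesis
    by (intro exI[of _ "norm Z + D"]) (metis order_le_less)
qed

text \<open>A factor whose number is not an eigenvalue is injective and can be cancelled. The others
  cost one application of \<open>exp_decay_step\<close> each, always with the same \<delta>: lying
  strictly below all their real parts, it absorbs the polynomial growth caused by repeated
  eigenvalues.\<close>

lemma exp_decay_of_factors:
  fixes M :: "complex^'r::finite^'r"
  assumes "lin_factors (sq M) L * Z = 0" "\<And>l. l \<in> set L \<Longrightarrow> eigenvalue M l \<Longrightarrow> \<delta> < Re l"
  shows "\<exists>C. \<forall>s\<ge>0. norm (exp (- (s *\<^sub>R sq M)) * Z) \<le> C * exp (- (\<delta> * s))"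
  using assms
proof (induction L arbitrary: Z)
  case Nil
  then show ?case
    by (intro exI[of _ 0]) (simp add: lin_factors_def)
next
  case (Cons l L)
  show ?case
  proof (cases "eigenvalue M l")
    case False
    have "(sq M - cscalar l) * (lin_factors (sq M) L * Z) = 0"
      using Cons.prems(1) by (simp add: lin_factors_def mult.assoc)
    then have "lin_factors (sq M) L * Z = 0"
      using False by (auto simp: eigenvalue_iff_sqmat left_diff_distrib)
    then show ?thesis
      using Cons by simp
  next
    case True
    have "lin_factors (sq M) L * ((sq M - cscalar l) * Z) = 0"
      using Cons.prems(1) by (simp add: lin_factors_Cons mult.assoc)
    from Cons.IH[OF this] Cons.prems(2) obtain C
      where "\<And>s. s \<ge> 0 \<Longrightarrow> norm (exp (- (s *\<^sub>R sq M)) * ((sq M - cscalar l) * Z)) \<le> C * exp (- (\<delta> * s))"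
      by auto
    then show ?thesis
      by (rule exp_decay_step) (use Cons.prems(2) True in auto)
  qed
qed

text \<open>Both directions are used: the forward one for estimates, the backward one to locate
  eigenvalues of a stable matrix when proving that it or its gamma matrix is invertible.\<close>

theorem positive_stable_iff_exp_stable:
  fixes M :: "complex^'r::finite^'r"
  shows "positive_stable M \<longleftrightarrow> exp_stable (sq M)"
proof
  assume ps: "positive_stable M"
  obtain L where L: "lin_factors (sq M) L = 0"
    by (rule ex_annihilating_factors)
  \<comment> \<open>The element 1 keeps the set nonempty, so that \<open>Min S\<close> is meaningful
    even if no listed number is an eigenvalue.\<close>
  define S where "S = insert 1 (Re ` {l \<in> set L. eigenvalue M l})"
  have S: "finite S" "S \<noteq> {}" "\<And>x. x \<in> S \<Longrightarrow> x > 0"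
    using ps by (auto simp: S_def positive_stable_def)
  define \<delta> where "\<delta> = Min S / 2"
  have "\<delta> > 0"
    using S by (simp add: \<delta>_def)
  moreover have "\<delta> < Re l" if "l \<in> set L" "eigenvalue M l" for l
  proof -
    have "Min S \<le> Re l"
      by (rule Min_le[OF S(1)]) (use that in \<open>auto simp: S_def\<close>)
    with \<open>\<delta> > 0\<close> show ?thesis
      unfolding \<delta>_def by linarith
  qed
  ultimately show "exp_stable (sq M)"
    using exp_decay_of_factors[of M L 1 \<delta>] L by (auto simp: exp_stable_def)
next
  assume "exp_stable (sq M)"
  then obtain C \<delta> where C: "\<delta> > 0" "\<And>s. s \<ge> 0 \<Longrightarrow> norm (exp (- (s *\<^sub>R sq M))) \<le> C * exp (- (\<delta> * s))"
    unfolding exp_stable_def by blast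
  have "Re l > 0" if ev: "eigenvalue M l" for l
  proof (rule ccontr)
    assume "\<not> Re l > 0"
    then have l: "Re l \<le> 0"
      by simp
    obtain Z where Z: "Z \<noteq> 0" "sq M * Z = cscalar l * Z"
      using iffD1[OF eigenvalue_iff_sqmat ev] by blast
    have "norm Z \<le> C * exp (- (\<delta> * s)) * norm Z" if "s \<ge> 0" for s
    proof -
      \<comment> \<open>\<open>N\<close> annihilates the eigenvector, so exp(-sM) acts on it as
        exp(-sl), whose modulus is at least 1 when \<open>Re l\<close> is not positive. This
        contradicts decay.\<close>
      define N where "N = s *\<^sub>R (cscalar l - sq M)"
      have "N * Z = 0"
        by (simp add: N_def left_diff_distrib Z)
      then have "exp N * Z = Z"
        by (rule exp_mult_eq_of_annihilates)
      moreover have "- (s *\<^sub>R sq M) = cscalar (- (s *\<^sub>R l)) + N"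
        by (simp add: N_def scaleR_diff_right linear_scale linear_neg bounded_linear.linear[OF bounded_linear_cscalar])
      ultimately have "exp (- (s *\<^sub>R sq M)) * Z = cscalar (exp (- (s *\<^sub>R l))) * Z"
        by (simp only: exp_add_commuting[OF cscalar_commute] exp_cscalar mult.assoc)
      then have "exp (- (s * Re l)) * norm Z = norm (exp (- (s *\<^sub>R sq M)) * Z)"
        by (simp add: norm_cscalar_mult)
      moreover have "1 \<le> exp (- (s * Re l))"
        using that l by (simp add: mult_nonneg_nonpos)
      ultimately have "norm Z \<le> norm (exp (- (s *\<^sub>R sq M)) * Z)"
        by (metis mult_le_cancel_right1 norm_ge_zero not_less)
      also have "\<dots> \<le> norm (exp (- (s *\<^sub>R sq M))) * norm Z"
        by (rule norm_mult_ineq)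
      also have "\<dots> \<le> C * exp (- (\<delta> * s)) * norm Z"
        by (intro mult_right_mono C(2) that) simp
      finally show ?thesis .
    qed
    then have ge: "1 \<le> C * exp (- (\<delta> * s))" if "s \<ge> 0" for s
      using Z(1) that by fastforce
    have "((\<lambda>s. C * exp (- (\<delta> * s))) \<longlongrightarrow> C * 0) at_top"
      using C(1) by (intro tendsto_mult tendsto_const filterlim_compose[OF exp_at_bot])
        (auto simp: filterlim_uminus_at_bot intro!: filterlim_tendsto_pos_mult_at_top[OF tendsto_const] filterlim_ident)
    then have "1 \<le> C * 0"
      by (rule tendsto_lowerbound) (auto intro!: eventually_mono[OF eventually_ge_at_top[of 0]] ge)
    then show False
      by simp
  qed
  then show "positive_stable M"
    by (auto simp: positive_stable_def)
qed

lemma exp_stable_invertible: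
  fixes X :: "'r::finite sqmat"
  assumes "exp_stable X"
  obtains Y where "X * Y = 1" "Y * X = 1"
proof -
  have "\<exists>Y. X * Y = 1"
  proof (rule ccontr)
    assume "\<nexists>Y. X * Y = 1"
    then obtain Z where "Z \<noteq> 0" "X * Z = 0"
      by (rule noninvertible_imp_annihilates)
    then have "eigenvalue (mat_of X) 0"
      by (auto simp: eigenvalue_iff_sqmat cscalar_0)
    moreover have "positive_stable (mat_of X)"
      using assms by (simp add: positive_stable_iff_exp_stable)
    ultimately show False
      by (auto simp: positive_stable_def)
  qed
  then show thesis
    using that left_right_inverse_sqmat by blast
qed

section \<open>Matrix powers and beta-type integrals\<close>

definition rpow :: "real \<Rightarrow> 'a \<Rightarrow> 'a::{real_normed_algebra_1,banach}" where
  "rpow t M = exp (ln t *\<^sub>R M)"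

lemma rpow_add_of_real:
  assumes "t > 0"
  shows "rpow t (M + of_real c) = (t powr c) *\<^sub>R rpow t M"
proof -
  have "ln t *\<^sub>R (M + of_real c) = of_real (c * ln t) + ln t *\<^sub>R M"
    by (simp add: scaleR_conv_of_real distrib_left mult.commute flip: of_real_mult)
  then show ?thesis
    using assms by (simp only: rpow_def exp_of_real_add) (simp add: powr_def)
qed

lemma rpow_diff_1:
  assumes "t > 0"
  shows "rpow t M = t *\<^sub>R rpow t (M - 1)"
  using rpow_add_of_real[OF assms, of "M - 1" 1] assms by simp

lemma norm_rpow_diff_1: "t > 0 \<Longrightarrow> norm (rpow t (M - 1)) = norm (rpow t M) / t"
  using rpow_diff_1[of t M] by simp

lemma rpow_add_of_nat:
  assumes "t > 0"
  shows "rpow t (M + of_nat n) = t ^ n *\<^sub>R rpow t M"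
  using rpow_add_of_real[OF assms, of M "real n"] assms by (simp add: powr_realpow)

lemma rpow_commute: "M * X = X * M \<Longrightarrow> rpow t M * X = X * rpow t M"
  unfolding rpow_def by (rule exp_commute) simp

lemma rpow_has_vector_derivative:
  assumes "t > 0"
  shows "((\<lambda>t. rpow t M) has_vector_derivative (1 / t) *\<^sub>R (M * rpow t M)) (at t)"
proof -
  have "(ln has_vector_derivative (1 / t)) (at t)"
    using DERIV_ln_divide[OF assms] by (simp add: has_real_derivative_iff_has_vector_derivative)
  from vector_diff_chain_at[OF this exp_scaleR_has_vector_derivative_left[of M "ln t"]]
  show ?thesis
    by (simp add: o_def rpow_def)
qed

lemma continuous_on_rpow:
  assumes "\<And>x. x \<in> S \<Longrightarrow> f x > 0" "continuous_on S f"
  shows "continuous_on S (\<lambda>x. rpow (f x) M)"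
proof -
  have "continuous_on {0<..} (\<lambda>t. rpow t M)"
    by (intro continuous_at_imp_continuous_on ballI)
      (auto intro: has_vector_derivative_continuous[OF rpow_has_vector_derivative])
  then show ?thesis
    by (rule continuous_on_compose2) (use assms in auto)
qed

lemma exp_stable_rpow_bound:
  assumes "exp_stable M"
  obtains C \<delta> where "\<delta> > 0" "C \<ge> 0" "\<And>t. 0 < t \<Longrightarrow> t \<le> 1 \<Longrightarrow> norm (rpow t M) \<le> C * t powr \<delta>"
proof -
  obtain C \<delta> where C: "\<delta> > 0" "\<And>s. s \<ge> 0 \<Longrightarrow> norm (exp (- (s *\<^sub>R M))) \<le> C * exp (- (\<delta> * s))"
    using assms unfolding exp_stable_def by blast
  have "C \<ge> 0"
    using order_trans[OF norm_ge_zero C(2)[of 0]] by simp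
  moreover have "norm (rpow t M) \<le> C * t powr \<delta>" if "0 < t" "t \<le> 1" for t
    using C(2)[of "- ln t"] that by (simp add: rpow_def powr_def)
  ultimately show thesis
    using that C(1) by blast
qed

lemma norm_rpow_ge_1:
  assumes "t \<ge> 1"
  shows "norm (rpow t M) \<le> t powr norm M"
  using norm_exp[of "ln t *\<^sub>R M"] assms by (simp add: rpow_def powr_def mult.commute)

lemma set_integral_bounded_linear:
  fixes f :: "'c \<Rightarrow> 'a::{banach, second_countable_topology}"
    and T :: "'a \<Rightarrow> 'b::{banach, second_countable_topology}"
  assumes "bounded_linear T" "set_integrable M A f"
  shows "set_integrable M A (\<lambda>x. T (f x))"
    and "(LINT x:A|M. T (f x)) = T (LINT x:A|M. f x)"
proof -
  have "indicator A x *\<^sub>R T (f x) = T (indicator A x *\<^sub>R f x)" for x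
    by (simp add: linear_scale[OF bounded_linear.linear[OF assms(1)]])
  then show "set_integrable M A (\<lambda>x. T (f x))" "(LINT x:A|M. T (f x)) = T (LINT x:A|M. f x)"
    using integrable_bounded_linear[OF assms(1)] integral_bounded_linear[OF assms(1)] assms(2)
    by (simp_all add: set_integrable_def set_lebesgue_integral_def)
qed

definition beta_weight :: "'a \<Rightarrow> 'a \<Rightarrow> real \<Rightarrow> 'a::{real_normed_algebra_1,banach}" where
  "beta_weight P Q t = rpow t (P - 1) * rpow (1 - t) (Q - 1)"

lemma continuous_on_beta_weight: "continuous_on {0<..<1} (beta_weight P Q)"
  unfolding beta_weight_def by (intro continuous_intros continuous_on_rpow) auto

text \<open>The scalar beta integrand with exponents \<delta> and \<epsilon> dominates. The bounded
  factor \<open>h\<close> is left general so that the moments and the hypergeometric kernel are both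
  covered.\<close>

lemma beta_weight_integrable:
  fixes P Q :: "'a::{real_normed_algebra_1, banach, second_countable_topology}"
  assumes "exp_stable P" "exp_stable Q"
    and h: "set_borel_measurable lborel {0<..<1} h"
    and bound: "\<And>t. 0 < t \<Longrightarrow> t < 1 \<Longrightarrow> norm (h t) \<le> K"
  shows "set_integrable lborel {0<..<1} (\<lambda>t. h t * beta_weight P Q t)"
proof -
  obtain C \<delta> where C: "\<delta> > 0" "C \<ge> 0" "\<And>t. 0 < t \<Longrightarrow> t \<le> 1 \<Longrightarrow> norm (rpow t P) \<le> C * t powr \<delta>"
    by (rule exp_stable_rpow_bound[OF assms(1)]) (rule that)
  obtain D \<epsilon> where D: "\<epsilon> > 0" "D \<ge> 0" "\<And>t. 0 < t \<Longrightarrow> t \<le> 1 \<Longrightarrow> norm (rpow t Q) \<le> D * t powr \<epsilon>"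
    by (rule exp_stable_rpow_bound[OF assms(2)]) (rule that)
  have K: "K \<ge> 0"
    using order_trans[OF norm_ge_zero bound[of "1/2"]] by simp
  have "set_integrable lborel {0<..<1} (\<lambda>t. t powr (\<delta> - 1) * (1 - t) powr (\<epsilon> - 1))"
    by (rule set_integrable_subset[OF integrable_Beta[OF C(1) D(1)]]) auto
  then have dom: "set_integrable lborel {0<..<1} (\<lambda>t. (K * C * D) * (t powr (\<delta> - 1) * (1 - t) powr (\<epsilon> - 1)))"
    by (rule set_integrable_mult_right)
  show ?thesis
  proof (rule set_integrable_bound[OF dom])
    have "set_borel_measurable lborel {0<..<1} (beta_weight P Q)"
      unfolding set_borel_measurable_def
      using borel_measurable_continuous_on_indicator[OF _ continuous_on_beta_weight[of P Q]] by simp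
    with h have "(\<lambda>t. (indicator {0<..<1} t *\<^sub>R h t) * (indicator {0<..<1} t *\<^sub>R beta_weight P Q t))
        \<in> borel_measurable lborel"
      unfolding set_borel_measurable_def by measurable
    also have "(\<lambda>t. (indicator {0<..<1} t *\<^sub>R h t) * (indicator {0<..<1} t *\<^sub>R beta_weight P Q t)) =
        (\<lambda>t::real. indicator {0<..<1} t *\<^sub>R (h t * beta_weight P Q t))"
      by (auto simp: fun_eq_iff indicator_def)
    finally show "set_borel_measurable lborel {0<..<1} (\<lambda>t. h t * beta_weight P Q t)"
      unfolding set_borel_measurable_def .
    show "AE t in lborel. t \<in> {0<..<1} \<longrightarrow> norm (h t * beta_weight P Q t)
        \<le> norm ((K * C * D) * (t powr (\<delta> - 1) * (1 - t) powr (\<epsilon> - 1)))"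
    proof (intro AE_I2 impI)
      fix t :: real assume "t \<in> {0<..<1}"
      then have t: "0 < t" "t < 1"
        by auto
      have "norm (rpow t (P - 1)) \<le> C * t powr (\<delta> - 1)"
        using C(3)[of t] t divide_right_mono[of _ _ t] by (simp add: norm_rpow_diff_1 powr_diff)
      moreover have "norm (rpow (1 - t) (Q - 1)) \<le> D * (1 - t) powr (\<epsilon> - 1)"
        using D(3)[of "1 - t"] t divide_right_mono[of _ _ "1 - t"] by (simp add: norm_rpow_diff_1 powr_diff)
      ultimately have "norm (beta_weight P Q t) \<le> (C * t powr (\<delta> - 1)) * (D * (1 - t) powr (\<epsilon> - 1))"
        unfolding beta_weight_def using C(2)
        by (intro order_trans[OF norm_mult_ineq] mult_mono) auto
      then have "norm (h t * beta_weight P Q t) \<le> K * ((C * t powr (\<delta> - 1)) * (D * (1 - t) powr (\<epsilon> - 1)))"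
        using bound[OF t] K by (intro order_trans[OF norm_mult_ineq] mult_mono) auto
      also have "\<dots> \<le> norm ((K * C * D) * (t powr (\<delta> - 1) * (1 - t) powr (\<epsilon> - 1)))"
        by (simp add: mult_ac)
      finally show "norm (h t * beta_weight P Q t) \<le> norm ((K * C * D) * (t powr (\<delta> - 1) * (1 - t) powr (\<epsilon> - 1)))" .
    qed
  qed
qed

text \<open>Lebesgue and gauge integrals are matched on the Euclidean side of \<open>mat_of\<close>.
  The derivative may be unbounded at both endpoints, where only \<open>F\<close> is
  continuous.\<close>

lemma set_integral_derivative_sqmat:
  fixes F :: "real \<Rightarrow> 'r::finite sqmat"
  assumes F: "continuous_on {0..1} F" "\<And>u. 0 < u \<Longrightarrow> u < 1 \<Longrightarrow> (F has_vector_derivative f u) (at u)"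
    and f: "set_integrable lborel {0<..<1} f"
  shows "(LBINT u:{0<..<1}. f u) = F 1 - F 0"
proof -
  have "((\<lambda>u. mat_of (f u)) has_integral (mat_of (F 1) - mat_of (F 0))) {0..1}"
    using F by (intro fundamental_theorem_of_calculus_interior)
      (auto intro!: bounded_linear.continuous_on[OF bounded_linear_mat_of]
        bounded_linear.has_vector_derivative[OF bounded_linear_mat_of])
  then have "integral {0<..<1} (\<lambda>u. mat_of (f u)) = mat_of (F 1) - mat_of (F 0)"
    unfolding integral_open_interval_real[symmetric] by (rule integral_unique)
  moreover have "(LBINT u:{0<..<1}. mat_of (f u)) = integral {0<..<1} (\<lambda>u. mat_of (f u))"
    by (rule set_borel_integral_eq_integral(2)[OF set_integral_bounded_linear(1)[OF bounded_linear_mat_of f]])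
  ultimately have "mat_of (LBINT u:{0<..<1}. f u) = mat_of (F 1 - F 0)"
    by (simp add: set_integral_bounded_linear(2)[OF bounded_linear_mat_of f] minus_sqmat.rep_eq)
  then show ?thesis
    by (metis sq_mat_of)
qed

text \<open>The extension by \<open>0\<close> to the endpoints has to be explicit because \<open>ln 0 = 0\<close>
  makes \<open>rpow 0 P = 1\<close>.\<close>

lemma continuous_on_rpow_product:
  fixes P Q :: "'a::{real_normed_algebra_1, banach}"
  assumes "exp_stable P" "exp_stable Q"
  shows "continuous_on {0..1} (\<lambda>u. if 0 < u \<and> u < 1 then rpow u P * rpow (1 - u) Q else 0)"
    (is "continuous_on _ ?F")
proof -
  obtain C \<delta> where C: "\<delta> > 0" "C \<ge> 0" "\<And>t. 0 < t \<Longrightarrow> t \<le> 1 \<Longrightarrow> norm (rpow t P) \<le> C * t powr \<delta>"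
    by (rule exp_stable_rpow_bound[OF assms(1)]) (rule that)
  obtain D \<epsilon> where D: "\<epsilon> > 0" "D \<ge> 0" "\<And>t. 0 < t \<Longrightarrow> t \<le> 1 \<Longrightarrow> norm (rpow t Q) \<le> D * t powr \<epsilon>"
    by (rule exp_stable_rpow_bound[OF assms(2)]) (rule that)
  \<comment> \<open>A continuous majorant that vanishes at 0 and 1; it forces the limits
    there.\<close>
  define b where "b = (\<lambda>u. (C * u powr \<delta>) * (D * (1 - u) powr \<epsilon>))"
  have le: "norm (?F u) \<le> b u" for u
    unfolding b_def using C D by (auto intro!: order_trans[OF norm_mult_ineq] mult_mono)
  have cont_b: "continuous_on {0..1} b"
    unfolding b_def using C(1) D(1) by (intro continuous_intros continuous_on_powr') auto
  have "continuous_on {0<..<1} ?F"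
    by (rule continuous_on_eq[of _ "\<lambda>u. rpow u P * rpow (1 - u) Q"])
      (auto intro!: continuous_intros continuous_on_rpow)
  then have inner: "isCont ?F u" if "0 < u" "u < 1" for u
    using that by (simp add: continuous_on_eq_continuous_at)
  show ?thesis
    unfolding continuous_on_eq_continuous_within
  proof
    fix u :: real assume "u \<in> {0..1}"
    show "continuous (at u within {0..1}) ?F"
    proof (cases "0 < u \<and> u < 1")
      case True
      then show ?thesis
        using inner continuous_at_imp_continuous_at_within by blast
    next
      case False
      with \<open>u \<in> {0..1}\<close> have "b u = 0"
        using C(1) D(1) by (auto simp: b_def)
      with cont_b \<open>u \<in> {0..1}\<close> have "(b \<longlongrightarrow> 0) (at u within {0..1})"
        unfolding continuous_on_def by metis
      then have "(?F \<longlongrightarrow> 0) (at u within {0..1})"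
        by (rule Lim_null_comparison[OF always_eventually, rotated]) (use le in blast)
      with False show ?thesis
        unfolding continuous_within by auto
    qed
  qed
qed

text \<open>The beta integral with first parameter \<open>P + of_nat n\<close>. For
  \<open>P = A\<close>, \<open>Q = B - A\<close> these are the coefficients of Euler's integral up
  to a constant.\<close>

definition beta_moment :: "'r::finite sqmat \<Rightarrow> 'r sqmat \<Rightarrow> nat \<Rightarrow> 'r sqmat" where
  "beta_moment P Q n = (LBINT u:{0<..<1}. u ^ n *\<^sub>R beta_weight P Q u)"

lemma beta_moment_integrable:
  fixes P Q :: "'r::finite sqmat"
  assumes "exp_stable P" "exp_stable Q"
  shows "set_integrable lborel {0<..<1} (\<lambda>u. u ^ n *\<^sub>R beta_weight P Q u)"
proof -
  have "set_integrable lborel {0<..<1} (\<lambda>u. (u ^ n *\<^sub>R 1) * beta_weight P Q u)"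
  proof (rule beta_weight_integrable[OF assms, where K = 1])
    have "continuous_on {0<..<1} (\<lambda>u::real. u ^ n *\<^sub>R (1 :: 'r sqmat))"
      by (intro continuous_intros)
    then show "set_borel_measurable lborel {0<..<1} (\<lambda>u::real. u ^ n *\<^sub>R (1 :: 'r sqmat))"
      unfolding set_borel_measurable_def
      using borel_measurable_continuous_on_indicator[of "{0<..<1::real}"] by simp
  qed (simp add: power_le_one)
  then show ?thesis
    by simp
qed

text \<open>Integrate the derivative of u^(P+n) (1-u)^Q, which vanishes at both ends by
  stability.\<close>

lemma beta_moment_Suc:
  fixes P Q :: "'r::finite sqmat"
  assumes "exp_stable P" "exp_stable Q" and comm: "P * Q = Q * P"
  shows "(P + Q + of_nat n) * beta_moment P Q (Suc n) = (P + of_nat n) * beta_moment P Q n"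
proof -
  \<comment> \<open>That derivative is (P+n) u^n (1-u) - Q u^(n+1) times the beta weight;
    \<open>f\<close> collects it by powers of \<open>u\<close>.\<close>
  define f where "f = (\<lambda>u. (P + of_nat n) * (u ^ n *\<^sub>R beta_weight P Q u)
    - (P + Q + of_nat n) * (u ^ Suc n *\<^sub>R beta_weight P Q u))"
  define F where "F = (\<lambda>u. if 0 < u \<and> u < 1 then rpow u (P + of_nat n) * rpow (1 - u) Q else 0)"
  have int: "set_integrable lborel {0<..<1} (\<lambda>u. X * (u ^ k *\<^sub>R beta_weight P Q u))"
    "(LBINT u:{0<..<1}. X * (u ^ k *\<^sub>R beta_weight P Q u)) = X * beta_moment P Q k" for X k
    using set_integral_bounded_linear[OF bounded_linear_mult_right[of X] beta_moment_integrable[OF assms(1,2), of k]]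
    by (simp_all only: beta_moment_def)
  have "(LBINT u:{0<..<1}. f u) = F 1 - F 0"
  proof (rule set_integral_derivative_sqmat)
    show "continuous_on {0..1} F"
      unfolding F_def by (intro continuous_on_rpow_product exp_stable_add_of_nat assms)
    show "set_integrable lborel {0<..<1} f"
      unfolding f_def by (intro set_integral_diff int)
    fix u :: real assume u: "0 < u" "u < 1"
    define a where "a = rpow u (P - 1)"
    define b where "b = rpow (1 - u) (Q - 1)"
    have a: "rpow u (P + of_nat n) = u ^ Suc n *\<^sub>R a"
      using u rpow_diff_1[of u P] by (simp add: a_def rpow_add_of_nat)
    have b: "rpow (1 - u) Q = (1 - u) *\<^sub>R b"
      using u rpow_diff_1[of "1 - u" Q] by (simp add: b_def)
    have aQ: "a * Q = Q * a"
      unfolding a_def by (rule rpow_commute) (simp add: comm left_diff_distrib right_diff_distrib)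
    have "((\<lambda>u. 1 - u) has_vector_derivative - 1) (at u)"
      by (auto intro!: derivative_eq_intros)
    from vector_diff_chain_at[OF this rpow_has_vector_derivative[of "1 - u" Q]] u
    have dQ: "((\<lambda>u. rpow (1 - u) Q) has_vector_derivative - ((1 / (1 - u)) *\<^sub>R (Q * rpow (1 - u) Q))) (at u)"
      by (simp add: o_def)
    have "rpow u (P + of_nat n) * - ((1 / (1 - u)) *\<^sub>R (Q * rpow (1 - u) Q)) = - (u ^ Suc n *\<^sub>R (Q * (a * b)))"
      using u unfolding a b by (simp add: mult.assoc[symmetric] aQ)
    moreover have "(1 / u) *\<^sub>R ((P + of_nat n) * rpow u (P + of_nat n)) * rpow (1 - u) Q
        = (u ^ n * (1 - u)) *\<^sub>R ((P + of_nat n) * (a * b))"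
      using u unfolding a b by (simp add: mult.assoc)
    moreover have "- (u ^ Suc n *\<^sub>R (Q * (a * b))) + (u ^ n * (1 - u)) *\<^sub>R ((P + of_nat n) * (a * b)) = f u"
      by (simp add: f_def beta_weight_def a_def[symmetric] b_def[symmetric] algebra_simps)
    ultimately have "((\<lambda>u. rpow u (P + of_nat n) * rpow (1 - u) Q) has_vector_derivative f u) (at u)"
      using has_vector_derivative_mult[OF rpow_has_vector_derivative[OF u(1), of "P + of_nat n"] dQ] by (simp only:)
    then show "(F has_vector_derivative f u) (at u)"
      by (rule has_vector_derivative_transform_within_open[of _ _ _ "{0<..<1}"]) (use u in \<open>auto simp: F_def\<close>)
  qed
  also have "(LBINT u:{0<..<1}. f u) = (P + of_nat n) * beta_moment P Q n - (P + Q + of_nat n) * beta_moment P Q (Suc n)"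
    unfolding f_def by (subst set_integral_diff(2)) (simp_all only: int)
  finally show ?thesis
    by (simp add: F_def)
qed

text \<open>The vanishing moments make \<open>f\<close> orthogonal to every polynomial
  \<open>g\<close>. If \<open>g\<close> is within e of \<open>f\<close>, the integral of f^2 equals
  that of (f - g) f and is at most e times the integral of |f|.\<close>

lemma vanishing_moments_imp_zero:
  fixes f :: "real \<Rightarrow> real"
  assumes cont: "continuous_on {0..1} f" and mom: "\<And>n. integral {0..1} (\<lambda>u. u ^ n * f u) = 0"
    and "x \<in> {0..1}"
  shows "f x = 0"
proof -
  define K where "K = integral {0..1} (\<lambda>u. \<bar>f u\<bar>)"
  have intf: "(\<lambda>u. p u * f u) integrable_on {0..1}" if "continuous_on {0..1} p" for p :: "real \<Rightarrow> real"
    using that by (intro integrable_continuous_interval continuous_intros cont)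
  have le: "integral {0..1} (\<lambda>u. f u * f u) \<le> e * K" if "e > 0" for e
  proof -
    obtain g where g: "polynomial_function g" "\<And>u. u \<in> {0..1} \<Longrightarrow> norm (f u - g u) < e"
      using Stone_Weierstrass_polynomial_function[OF compact_Icc cont \<open>e > 0\<close>] by blast
    have contg: "continuous_on {0..1} g"
      using g(1) by (rule continuous_on_polymonial_function)
    obtain a n where a: "g = (\<lambda>x. \<Sum>i\<le>n. a i * x ^ i)"
      using g(1) by (metis real_polynomial_function_eq real_polynomial_function_iff_sum)
    have "integral {0..1} (\<lambda>u. g u * f u) = integral {0..1} (\<lambda>u. \<Sum>i\<le>n. a i * (u ^ i * f u))"
      by (simp add: a sum_distrib_right mult.assoc)
    also have "\<dots> = (\<Sum>i\<le>n. integral {0..1} (\<lambda>u. a i * (u ^ i * f u)))"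
      by (intro integral_sum integrable_continuous_interval continuous_intros cont) auto
    also have "\<dots> = 0"
      by (simp add: mom)
    finally have "integral {0..1} (\<lambda>u. f u * f u) = integral {0..1} (\<lambda>u. f u * f u) - integral {0..1} (\<lambda>u. g u * f u)"
      by simp
    also have "\<dots> = integral {0..1} (\<lambda>u. f u * f u - g u * f u)"
      by (intro integral_diff[symmetric] intf cont contg)
    also have "\<dots> \<le> integral {0..1} (\<lambda>u. e * \<bar>f u\<bar>)"
    proof (rule integral_le)
      show "(\<lambda>u. f u * f u - g u * f u) integrable_on {0..1}"
        by (intro integrable_diff intf cont contg)
      show "(\<lambda>u. e * \<bar>f u\<bar>) integrable_on {0..1}"
        by (intro integrable_continuous_interval continuous_intros cont)
      fix u :: real assume u: "u \<in> {0..1}"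
      have "f u * f u - g u * f u \<le> \<bar>f u - g u\<bar> * \<bar>f u\<bar>"
        by (simp add: left_diff_distrib[symmetric] abs_mult[symmetric])
      also have "\<dots> \<le> e * \<bar>f u\<bar>"
        using g(2)[OF u] by (intro mult_right_mono) auto
      finally show "f u * f u - g u * f u \<le> e * \<bar>f u\<bar>" .
    qed
    finally show ?thesis
      by (simp add: K_def)
  qed
  have "integral {0..1} (\<lambda>u. f u * f u) \<le> 0"
  proof (rule field_le_epsilon)
    fix e :: real assume "e > 0"
    have "K \<ge> 0"
      unfolding K_def by (intro integral_nonneg integrable_continuous_interval continuous_intros cont) auto
    then have "e / (K + 1) * K \<le> e"
      using \<open>e > 0\<close> by (simp add: field_simps)
    then show "integral {0..1} (\<lambda>u. f u * f u) \<le> 0 + e"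
      using le[of "e / (K + 1)"] \<open>K \<ge> 0\<close> \<open>e > 0\<close> by simp
  qed
  moreover have "integral {0..1} (\<lambda>u. f u * f u) \<ge> 0"
    by (intro integral_nonneg intf cont) auto
  ultimately have "((\<lambda>u. f u * f u) has_integral 0) (cbox 0 1)"
    using integrable_integral[OF intf[OF cont]] by simp
  from has_integral_0_cbox_imp_0[OF _ _ this, of x] have "f x * f x = 0"
    using cont \<open>x \<in> {0..1}\<close> by (auto intro!: continuous_intros)
  then show ?thesis
    by simp
qed

text \<open>After multiplication by u(1-u) the weight becomes u^P (1-u)^Q, continuous on the closed
  interval, and its product with \<open>Z\<close> has only zero moments. At one interior point both
  powers are invertible, so \<open>Z\<close> itself is 0.\<close>

lemma beta_moments_annihilate_imp_zero:
  fixes P Q :: "'r::finite sqmat"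
  assumes stable: "exp_stable P" "exp_stable Q" and mom: "\<And>n. beta_moment P Q n * Z = 0"
  shows "Z = 0"
proof -
  define F where "F = (\<lambda>u. if 0 < u \<and> u < 1 then rpow u P * rpow (1 - u) Q else 0)"
  define G where "G = (\<lambda>u. mat_of (F u * Z))"
  have blZ: "bounded_linear (\<lambda>X. mat_of (X * Z))"
    using bounded_linear_compose[OF bounded_linear_mat_of bounded_linear_mult_left] .
  have contG: "continuous_on {0..1} G"
    unfolding G_def F_def by (intro bounded_linear.continuous_on[OF blZ] continuous_on_rpow_product stable)
  have zero: "integral {0..1} (\<lambda>u. u ^ n *\<^sub>R G u) = 0" for n
  proof -
    \<comment> \<open>The difference of two consecutive moments realises the factor u^n
      u(1-u).\<close>
    define k where "k = (\<lambda>u. u ^ Suc n *\<^sub>R beta_weight P Q u - u ^ Suc (Suc n) *\<^sub>R beta_weight P Q u)"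
    have k: "set_integrable lborel {0<..<1} k"
      unfolding k_def by (intro set_integral_diff beta_moment_integrable stable)
    have "(LBINT u:{0<..<1}. k u) = beta_moment P Q (Suc n) - beta_moment P Q (Suc (Suc n))"
      unfolding k_def beta_moment_def by (intro set_integral_diff beta_moment_integrable stable)
    then have "(LBINT u:{0<..<1}. k u) * Z = 0"
      by (simp only: left_diff_distrib mom diff_self)
    then have "(LBINT u:{0<..<1}. mat_of (k u * Z)) = 0"
      by (simp add: set_integral_bounded_linear(2)[OF blZ k] zero_sqmat.rep_eq)
    then have "integral {0<..<1} (\<lambda>u. mat_of (k u * Z)) = 0"
      using set_borel_integral_eq_integral(2)[OF set_integral_bounded_linear(1)[OF blZ k]] by simp
    also have "integral {0<..<1} (\<lambda>u. mat_of (k u * Z)) = integral {0<..<1} (\<lambda>u. u ^ n *\<^sub>R G u)"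
    proof (rule integral_cong)
      fix u :: real assume "u \<in> {0<..<1}"
      then have u: "0 < u" "u < 1"
        by auto
      have "F u = (u * (1 - u)) *\<^sub>R beta_weight P Q u"
        using u rpow_diff_1[of u P] rpow_diff_1[of "1 - u" Q]
        by (simp add: F_def beta_weight_def)
      moreover have "k u = u ^ n *\<^sub>R ((u * (1 - u)) *\<^sub>R beta_weight P Q u)"
      proof -
        have "u ^ Suc n - u ^ Suc (Suc n) = u ^ n * (u * (1 - u))"
          by (simp add: algebra_simps)
        then show ?thesis
          unfolding k_def scaleR_left_diff_distrib[symmetric] by simp
      qed
      ultimately have "k u = u ^ n *\<^sub>R F u"
        by simp
      then show "mat_of (k u * Z) = u ^ n *\<^sub>R G u"
        by (simp add: G_def scaleR_sqmat.rep_eq)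
    qed
    finally show ?thesis
      by (simp add: integral_open_interval_real)
  qed
  \<comment> \<open>The moment argument is for real functions, so it is applied to each
    coordinate.\<close>
  have "G (1/2) \<bullet> b = 0" if "b \<in> Basis" for b
  proof (rule vanishing_moments_imp_zero[where x = "1/2"])
    show "continuous_on {0..1} (\<lambda>u. G u \<bullet> b)"
      by (intro continuous_intros contG)
    fix n
    have "(\<lambda>u. u ^ n *\<^sub>R G u) integrable_on {0..1}"
      by (intro integrable_continuous_interval continuous_intros contG)
    from integral_linear[OF this bounded_linear_inner_left[of b]]
    show "integral {0..1} (\<lambda>u. u ^ n * (G u \<bullet> b)) = 0"
      by (simp add: o_def zero)
  qed simp
  then have "G (1/2) = 0"
    using euclidean_eq_iff[of "G (1/2)" 0] by simp
  then have "rpow (1/2) P * rpow (1/2) Q * Z = 0"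
    by (simp add: G_def F_def) (metis sq_mat_of zero_sqmat.abs_eq)
  \<comment> \<open>Both powers are exponentials and can be cancelled one after the other.\<close>
  moreover have "exp (- X) * (exp X * W) = W" for X W :: "'r sqmat"
    by (simp add: mult.assoc[symmetric] exp_minus_inverse[of "- X", simplified])
  ultimately show ?thesis
    unfolding rpow_def mult.assoc by (metis mult_zero_right)
qed

section \<open>Commuting families and inverses\<close>

text \<open>Everything that commutes with whatever commutes with \<open>S\<close>. Membership is
  preserved by products, inverses, exponentials, limits and integrals, so commutation is derived
  from how a matrix is built; pairwise commutation alone would have to be proved anew for each
  pair.\<close>

definition bicommutant :: "'a::times set \<Rightarrow> 'a set" where
  "bicommutant S = {X. \<forall>Y. (\<forall>s\<in>S. s * Y = Y * s) \<longrightarrow> X * Y = Y * X}"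

definition sq_inv :: "'r::finite sqmat \<Rightarrow> 'r sqmat" where
  "sq_inv X = sq (matrix_inv (mat_of X))"

lemma sq_inv:
  assumes "X * Y = 1"
  shows "X * sq_inv X = 1" "sq_inv X * X = 1"
proof -
  have "invertible (mat_of X)"
    using assms invertible_right_inverse[of "mat_of X"]
    by (metis one_sqmat.rep_eq times_sqmat.rep_eq)
  then have "mat_of X ** matrix_inv (mat_of X) = mat 1" "matrix_inv (mat_of X) ** mat_of X = mat 1"
    unfolding invertible_def matrix_inv_def by (metis (mono_tags, lifting) someI_ex)+
  then show "X * sq_inv X = 1" "sq_inv X * X = 1"
    by (metis sq_inv_def sq_mult sq_mat_of sq_one)+
qed

lemma commute_of_inverses:
  fixes X V Y :: "'a::monoid_mult"
  assumes "X * V = 1" "V * X = 1" "X * Y = Y * X"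
  shows "V * Y = Y * V"
proof -
  have "V * Y = V * (Y * X) * V"
    by (simp add: mult.assoc assms(1))
  also have "\<dots> = V * X * (Y * V)"
    by (simp only: assms(3)[symmetric] mult.assoc)
  finally show ?thesis
    by (simp add: assms(2))
qed

lemma bicommutantI:
  "(\<And>Y. (\<And>s. s \<in> S \<Longrightarrow> s * Y = Y * s) \<Longrightarrow> X * Y = Y * X) \<Longrightarrow> X \<in> bicommutant S"
  by (simp add: bicommutant_def)

lemma bicommutantD:
  "X \<in> bicommutant S \<Longrightarrow> (\<And>s. s \<in> S \<Longrightarrow> s * Y = Y * s) \<Longrightarrow> X * Y = Y * X"
  by (simp add: bicommutant_def)

lemma bicommutant_base: "s \<in> S \<Longrightarrow> s \<in> bicommutant S"
  by (simp add: bicommutant_def)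

text \<open>A commutative \<open>S\<close> lies in its own commutant, so \<open>Y\<close> commutes
  with each element of \<open>S\<close>, and then \<open>X\<close> commutes with
  \<open>Y\<close>.\<close>

lemma bicommutant_commute:
  assumes "\<And>s t. s \<in> S \<Longrightarrow> t \<in> S \<Longrightarrow> s * t = t * s" "X \<in> bicommutant S" "Y \<in> bicommutant S"
  shows "X * Y = Y * X"
proof (rule bicommutantD[OF assms(2)])
  fix s assume "s \<in> S"
  with assms(1) have "Y * s = s * Y"
    by (intro bicommutantD[OF assms(3)])
  then show "s * Y = Y * s" ..
qed

lemma bicommutant_limit:
  fixes f :: "nat \<Rightarrow> 'a::real_normed_algebra"
  assumes "f \<longlonglongrightarrow> L" "\<And>n. f n \<in> bicommutant S"
  shows "L \<in> bicommutant S"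
proof (rule bicommutantI)
  fix Y assume Y: "\<And>s. s \<in> S \<Longrightarrow> s * Y = Y * s"
  have "f n * Y = Y * f n" for n
    using assms(2)[of n] Y by (rule bicommutantD)
  moreover have "(\<lambda>n. f n * Y) \<longlonglongrightarrow> L * Y" "(\<lambda>n. Y * f n) \<longlonglongrightarrow> Y * L"
    using assms(1) by (auto intro: tendsto_intros)
  ultimately show "L * Y = Y * L"
    using LIMSEQ_unique by auto
qed

lemma bicommutant_add: "X \<in> bicommutant S \<Longrightarrow> Y \<in> bicommutant S \<Longrightarrow> X + Y \<in> bicommutant S"
  and bicommutant_diff: "X \<in> bicommutant S \<Longrightarrow> Y \<in> bicommutant S \<Longrightarrow> X - Y \<in> bicommutant S"
  and bicommutant_mult: "X \<in> bicommutant S \<Longrightarrow> Y \<in> bicommutant S \<Longrightarrow> X * Y \<in> bicommutant S"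
  and bicommutant_one: "1 \<in> bicommutant S"
  and bicommutant_scaleR: "X \<in> bicommutant S \<Longrightarrow> c *\<^sub>R X \<in> bicommutant S"
  and bicommutant_minus: "X \<in> bicommutant S \<Longrightarrow> - X \<in> bicommutant S"
  for X Y :: "'a::real_algebra_1"
  by (simp_all add: bicommutant_def distrib_left distrib_right left_diff_distrib right_diff_distrib)
    (metis mult.assoc)

lemma bicommutant_of_nat: "of_nat n \<in> bicommutant (S :: 'a::real_algebra_1 set)"
  by (simp add: bicommutant_def mult_of_nat_commute)

lemma bicommutant_power: "X \<in> bicommutant S \<Longrightarrow> X ^ n \<in> bicommutant (S :: 'a::real_algebra_1 set)"
  by (induction n) (simp_all add: bicommutant_one bicommutant_mult)

lemma bicommutant_exp:
  "X \<in> bicommutant S \<Longrightarrow> exp X \<in> bicommutant (S :: 'a::{real_normed_algebra_1,banach} set)"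
  by (simp add: bicommutant_def exp_commute)

lemma bicommutant_rpow: "X \<in> bicommutant S \<Longrightarrow> rpow t X \<in> bicommutant S"
  unfolding rpow_def by (intro bicommutant_exp bicommutant_scaleR)

lemma bicommutant_sq_inv:
  assumes "X \<in> bicommutant S" "X * V = 1"
  shows "sq_inv X \<in> bicommutant S"
  using assms commute_of_inverses[OF sq_inv(1)[OF assms(2)] sq_inv(2)[OF assms(2)]]
  by (simp add: bicommutant_def)

lemma bicommutant_set_integral:
  fixes f :: "'b \<Rightarrow> 'a::{real_normed_algebra_1, banach, second_countable_topology}"
  assumes "set_integrable M A f" "\<And>x. x \<in> A \<Longrightarrow> f x \<in> bicommutant S"
  shows "(LINT x:A|M. f x) \<in> bicommutant S"
proof (rule bicommutantI)
  fix Y assume Y: "\<And>s. s \<in> S \<Longrightarrow> s * Y = Y * s"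
  have "(LINT x:A|M. f x) * Y = (LINT x:A|M. f x * Y)"
    by (rule set_integral_bounded_linear(2)[OF bounded_linear_mult_left assms(1), symmetric])
  also have "\<dots> = (LINT x:A|M. Y * f x)"
  proof -
    have "indicator A x *\<^sub>R (f x * Y) = indicator A x *\<^sub>R (Y * f x)" for x
      using bicommutantD[OF assms(2)[of x] Y] by (cases "x \<in> A") auto
    then show ?thesis
      by (simp only: set_lebesgue_integral_def)
  qed
  also have "\<dots> = Y * (LINT x:A|M. f x)"
    by (rule set_integral_bounded_linear(2)[OF bounded_linear_mult_right assms(1)])
  finally show "(LINT x:A|M. f x) * Y = Y * (LINT x:A|M. f x)" .
qed

lemmas bicommutant_intros = bicommutant_add bicommutant_diff bicommutant_mult bicommutant_one
  bicommutant_scaleR bicommutant_minus bicommutant_of_nat bicommutant_power bicommutant_rpow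

lemma of_nat_mult_eq_scaleR: "of_nat n * X = real n *\<^sub>R (X :: 'r::finite sqmat)"
  by (simp add: scaleR_conv_of_real)

section \<open>The confluent hypergeometric series\<close>

primrec poch :: "'a::ring_1 \<Rightarrow> nat \<Rightarrow> 'a" where
  "poch M 0 = 1"
| "poch M (Suc n) = poch M n * (M + of_nat n)"

lemma poch_Suc_left: "poch M (Suc n) = M * poch (M + 1) n"
  by (induction n) (simp_all add: mult.assoc add.assoc)

lemma bicommutant_poch: "M \<in> bicommutant S \<Longrightarrow> poch M n \<in> bicommutant (S :: 'a::real_algebra_1 set)"
  by (induction n) (simp_all add: bicommutant_intros)

lemma poch_invertible:
  fixes B :: "'r::finite sqmat"
  assumes "exp_stable B"
  shows "\<exists>V. poch B n * V = 1"
proof (induction n)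
  case (Suc n)
  then obtain V where V: "poch B n * V = 1"
    by blast
  obtain U where U: "(B + of_nat n) * U = 1"
    using exp_stable_invertible[OF exp_stable_add_of_nat[OF assms]] by blast
  have "poch B (Suc n) * (U * V) = poch B n * ((B + of_nat n) * U) * V"
    by (simp add: mult.assoc)
  then show ?case
    using U V by auto
qed (auto intro: exI[of _ 1])

definition hyp_coeff :: "'r::finite sqmat \<Rightarrow> 'r sqmat \<Rightarrow> nat \<Rightarrow> 'r sqmat" where
  "hyp_coeff A B n = poch A n * sq_inv (poch B n)"

lemma bicommutant_hyp_coeff:
  assumes "A \<in> bicommutant S" "B \<in> bicommutant S" "exp_stable B"
  shows "hyp_coeff A B n \<in> bicommutant S"
proof -
  obtain V where "poch B n * V = 1"
    using poch_invertible[OF assms(3)] by blast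
  then show ?thesis
    unfolding hyp_coeff_def using assms by (intro bicommutant_mult bicommutant_sq_inv bicommutant_poch)
qed

lemma poch_commute_self: "poch M n * M = M * poch (M :: 'a::real_algebra_1) n"
  using bicommutantD[OF bicommutant_poch[OF bicommutant_base[of M "{M}"]], of M] by simp

lemma sq_inv_poch_Suc:
  fixes B :: "'r::finite sqmat"
  assumes "exp_stable B"
  shows "sq_inv (poch B (Suc n)) * (B + of_nat n) = sq_inv (poch B n)"
proof -
  obtain V where V: "poch B n * V = 1"
    using poch_invertible[OF assms] by blast
  obtain W where W: "poch B (Suc n) * W = 1"
    using poch_invertible[OF assms] by blast
  have "poch B (Suc n) = (B + of_nat n) * poch B n"
    by (simp add: distrib_left distrib_right poch_commute_self mult_of_nat_commute)
  with sq_inv(2)[OF W] have *: "sq_inv (poch B (Suc n)) * (B + of_nat n) * poch B n = 1"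
    by (simp add: mult.assoc)
  have "sq_inv (poch B (Suc n)) * (B + of_nat n) = sq_inv (poch B (Suc n)) * (B + of_nat n) * (poch B n * sq_inv (poch B n))"
    by (simp only: sq_inv(1)[OF V] mult_1_right)
  also have "\<dots> = sq_inv (poch B n)"
    by (simp only: mult.assoc[symmetric] * mult_1_left)
  finally show ?thesis .
qed

text \<open>Both equations compare the two factorisations of \<open>poch B (Suc n)\<close>:
  \<open>B * poch (B + 1) n\<close> and \<open>poch B n * (B + of_nat n)\<close>.\<close>

lemma sq_inv_poch_shift:
  fixes B :: "'r::finite sqmat"
  assumes "exp_stable B"
  shows "B * sq_inv (poch B n) = (B + of_nat n) * sq_inv (poch (B + 1) n)"
    and "B * sq_inv (poch B (Suc n)) = sq_inv (poch (B + 1) n)"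
proof -
  have B1: "exp_stable (B + 1)"
    using exp_stable_add_of_nat[OF assms, of 1] by simp
  obtain V where V: "poch (B + 1) n * V = 1"
    using poch_invertible[OF B1] by blast
  obtain W where W: "poch B (Suc n) * W = 1"
    using poch_invertible[OF assms] by blast
  have comm: "X * Y = Y * X" if "X \<in> bicommutant {B}" "Y \<in> bicommutant {B}" for X Y
    using bicommutant_commute[OF _ that] by simp
  have B: "B \<in> bicommutant {B}"
    by (simp add: bicommutant_base)
  have I1: "sq_inv (poch (B + 1) n) \<in> bicommutant {B}"
    by (rule bicommutant_sq_inv[OF _ V]) (intro bicommutant_poch bicommutant_intros B)
  have I: "sq_inv (poch B m) \<in> bicommutant {B}" for m
    using poch_invertible[OF assms, of m] bicommutant_sq_inv bicommutant_poch B by blast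
  show 2: "B * sq_inv (poch B (Suc n)) = sq_inv (poch (B + 1) n)"
  proof -
    have "B * sq_inv (poch B (Suc n)) = sq_inv (poch B (Suc n)) * B * (poch (B + 1) n * sq_inv (poch (B + 1) n))"
      by (simp only: sq_inv(1)[OF V] mult_1_right comm[OF B I])
    also have "\<dots> = sq_inv (poch B (Suc n)) * poch B (Suc n) * sq_inv (poch (B + 1) n)"
      by (simp only: poch_Suc_left mult.assoc)
    finally show ?thesis
      by (simp only: sq_inv(2)[OF W] mult_1_left)
  qed
  have "B * sq_inv (poch B n) = B * sq_inv (poch B (Suc n)) * (B + of_nat n)"
    by (simp only: mult.assoc sq_inv_poch_Suc[OF assms])
  also have "\<dots> = (B + of_nat n) * sq_inv (poch (B + 1) n)"
    unfolding 2 by (intro comm bicommutant_intros B I1)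
  finally show "B * sq_inv (poch B n) = (B + of_nat n) * sq_inv (poch (B + 1) n)" .
qed

section \<open>Relations between series coefficients for commuting parameters\<close>

context
  fixes A B :: "'r::finite sqmat"
  assumes stable: "exp_stable B" and comm: "A * B = B * A"
begin

lemma pair_commute: "X \<in> bicommutant {A, B} \<Longrightarrow> Y \<in> bicommutant {A, B} \<Longrightarrow> X * Y = Y * X"
  by (rule bicommutant_commute[of "{A, B}"]) (use comm in auto)

lemma pair_base: "A \<in> bicommutant {A, B}" "B \<in> bicommutant {A, B}"
  by (simp_all add: bicommutant_base)

lemma hyp_coeff_Suc:
  "(B + of_nat n) * hyp_coeff A B (Suc n) = (A + of_nat n) * hyp_coeff A B n"
proof -
  have I: "sq_inv (poch B m) \<in> bicommutant {A, B}" for m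
    using poch_invertible[OF stable, of m] bicommutant_sq_inv bicommutant_poch pair_base by blast
  have "(B + of_nat n) * hyp_coeff A B (Suc n) = hyp_coeff A B (Suc n) * (B + of_nat n)"
    by (intro pair_commute bicommutant_intros bicommutant_hyp_coeff pair_base stable)
  also have "\<dots> = poch A (Suc n) * sq_inv (poch B n)"
    by (simp only: hyp_coeff_def mult.assoc sq_inv_poch_Suc[OF stable])
  also have "poch A (Suc n) = (A + of_nat n) * poch A n"
    unfolding poch.simps by (intro pair_commute bicommutant_intros bicommutant_poch pair_base)
  finally show ?thesis
    by (simp only: hyp_coeff_def mult.assoc)
qed

text \<open>On the term of degree n the factor \<open>B + of_nat n\<close> is the operator B + x
  d/dx; this and \<open>hyp_coeff_raise_A\<close> become first-order differential relations of the
  series.\<close>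

lemma hyp_coeff_lower_B: "B * hyp_coeff A B n = (B + of_nat n) * hyp_coeff A (B + 1) n"
proof -
  have "B * hyp_coeff A B n = poch A n * (B * sq_inv (poch B n))"
    using pair_commute[OF pair_base(2) bicommutant_poch[OF pair_base(1)], of n]
    by (simp add: hyp_coeff_def mult.assoc[symmetric])
  also have "\<dots> = (poch A n * (B + of_nat n)) * sq_inv (poch (B + 1) n)"
    by (simp only: sq_inv_poch_shift(1)[OF stable] mult.assoc)
  also have "poch A n * (B + of_nat n) = (B + of_nat n) * poch A n"
    by (intro pair_commute bicommutant_intros bicommutant_poch pair_base)
  finally show ?thesis
    by (simp only: hyp_coeff_def mult.assoc)
qed

lemma hyp_coeff_raise_A: "A * hyp_coeff (A + 1) B n = (A + of_nat n) * hyp_coeff A B n"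
proof -
  have "A * hyp_coeff (A + 1) B n = poch A (Suc n) * sq_inv (poch B n)"
    by (simp only: hyp_coeff_def poch_Suc_left mult.assoc)
  also have "poch A (Suc n) = (A + of_nat n) * poch A n"
    unfolding poch.simps by (intro pair_commute bicommutant_intros bicommutant_poch pair_base)
  finally show ?thesis
    by (simp only: hyp_coeff_def mult.assoc)
qed

text \<open>The Pochhammer symbols of A and A - 1 of length n + 1 share the factor
  \<open>poch A n\<close>, with cofactors A + n and A - 1 that differ by n + 1.\<close>

lemma hyp_coeff_diff_A:
  "B * hyp_coeff A B (Suc n) - B * hyp_coeff (A - 1) B (Suc n) = of_nat (Suc n) * hyp_coeff A (B + 1) n"
proof -
  have "poch A (Suc n) = (A + of_nat n) * poch A n"
    unfolding poch.simps by (intro pair_commute bicommutant_intros bicommutant_poch pair_base)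
  moreover have "poch (A - 1) (Suc n) = (A - 1) * poch A n"
    by (simp only: poch_Suc_left diff_add_cancel)
  ultimately have "poch A (Suc n) - poch (A - 1) (Suc n) = of_nat (Suc n) * poch A n"
    by (simp add: algebra_simps)
  then have "B * hyp_coeff A B (Suc n) - B * hyp_coeff (A - 1) B (Suc n)
      = B * (of_nat (Suc n) * poch A n) * sq_inv (poch B (Suc n))"
    by (simp only: hyp_coeff_def mult.assoc[symmetric] right_diff_distrib[symmetric] left_diff_distrib[symmetric])
  also have "B * (of_nat (Suc n) * poch A n) = of_nat (Suc n) * poch A n * B"
    by (intro pair_commute bicommutant_intros bicommutant_poch pair_base)
  finally show ?thesis
    by (simp only: hyp_coeff_def mult.assoc sq_inv_poch_shift(2)[OF stable])
qed

text \<open>The ratio (A + n)/(B + n) of consecutive coefficients tends to 1, so the norms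
  eventually at most double. Geometric growth is enough against the factorials of the
  series.\<close>

lemma hyp_coeff_bound: "\<exists>C\<ge>0. \<forall>n. norm (hyp_coeff A B n) \<le> C * 2 ^ n"
proof -
  define a where "a = (\<lambda>n. norm (hyp_coeff A B n))"
  \<comment> \<open>From here on norm A + n is at most 2 (n - norm B), and the summand 1 keeps n -
    norm B positive. The constant \<open>C\<close> absorbs the initial segment.\<close>
  define N where "N = nat \<lceil>norm A + 2 * norm B + 1\<rceil>"
  define C where "C = (\<Sum>k\<le>N. a k)"
  have step: "a (Suc n) \<le> 2 * a n" if "n \<ge> N" for n
  proof -
    have n: "real n \<ge> norm A + 2 * norm B + 1"
      using that unfolding N_def by linarith
    have "(real n - norm B) * a (Suc n) \<le> norm (of_nat n * hyp_coeff A B (Suc n)) - norm (B * hyp_coeff A B (Suc n))"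
      using norm_mult_ineq[of B "hyp_coeff A B (Suc n)"]
      by (simp add: a_def left_diff_distrib of_nat_mult_eq_scaleR)
    also have "\<dots> \<le> norm ((B + of_nat n) * hyp_coeff A B (Suc n))"
      using norm_diff_ineq[of "of_nat n * hyp_coeff A B (Suc n)" "B * hyp_coeff A B (Suc n)"]
      by (simp add: distrib_right add.commute)
    also have "\<dots> \<le> norm (A + of_nat n) * a n"
      unfolding hyp_coeff_Suc a_def by (rule norm_mult_ineq)
    also have "\<dots> \<le> (2 * (real n - norm B)) * a n"
    proof (rule mult_right_mono)
      have "norm (A + of_nat n) \<le> norm A + real n"
        using norm_triangle_ineq[of A "of_nat n"] by simp
      also have "norm A + real n \<le> 2 * (real n - norm B)"
        using n by (simp add: algebra_simps)
      finally show "norm (A + of_nat n) \<le> 2 * (real n - norm B)" .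
    qed (simp add: a_def)
    finally have "(real n - norm B) * a (Suc n) \<le> (real n - norm B) * (2 * a n)"
      by (simp add: mult_ac)
    moreover have "real n - norm B > 0"
      using n norm_ge_zero[of A] norm_ge_zero[of B] by linarith
    ultimately show ?thesis
      by (simp only: mult_le_cancel_left_pos)
  qed
  have le: "a n \<le> C" if "n \<le> N" for n
    unfolding C_def using that by (intro member_le_sum) (auto simp: a_def)
  have "C \<ge> 0"
    unfolding C_def by (intro sum_nonneg) (simp add: a_def)
  have "a n \<le> C * 2 ^ n" for n
  proof (induction n)
    case 0
    then show ?case
      using le[of 0] by simp
  next
    case (Suc n)
    show ?case
    proof (cases "Suc n \<le> N")
      case True
      have "C * 1 \<le> C * 2 ^ Suc n"
        using \<open>C \<ge> 0\<close> by (intro mult_left_mono) (simp_all add: one_le_power del: power_Suc)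
      with le[OF True] show ?thesis
        by simp
    next
      case False
      then show ?thesis
        using step[of n] Suc by simp
    qed
  qed
  with \<open>C \<ge> 0\<close> show ?thesis
    unfolding a_def by blast
qed

end

text \<open>For \<open>j = 0\<close> this is the hypergeometric series; the shifted series are its images under
  \<open>x\<^sup>j d\<^sup>j/dx\<^sup>j\<close>.\<close>

definition hyp_term :: "'r::finite sqmat \<Rightarrow> 'r sqmat \<Rightarrow> nat \<Rightarrow> 'r sqmat \<Rightarrow> nat \<Rightarrow> 'r sqmat" where
  "hyp_term A B j X m = hyp_coeff A B (m + j) * (X ^ (m + j) /\<^sub>R fact m)"

definition hyp :: "'r::finite sqmat \<Rightarrow> 'r sqmat \<Rightarrow> nat \<Rightarrow> 'r sqmat \<Rightarrow> 'r sqmat" where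
  "hyp A B j X = (\<Sum>m. hyp_term A B j X m)"

lemma hyp_sums:
  assumes "exp_stable B" "A * B = B * A"
  shows "hyp_term A B j X sums hyp A B j X"
proof -
  obtain C where C: "C \<ge> 0" "\<And>n. norm (hyp_coeff A B n) \<le> C * 2 ^ n"
    using hyp_coeff_bound[OF assms] by blast
  have "summable (\<lambda>m. (C * (2 * norm X) ^ j) * ((2 * norm X) ^ m /\<^sub>R fact m))"
    by (intro summable_mult summable_exp_generic)
  then have "summable (hyp_term A B j X)"
  proof (rule summable_comparison_test'[where N = 0])
    fix m
    have "norm (hyp_term A B j X m) \<le> (C * 2 ^ (m + j)) * (norm X ^ (m + j) / fact m)"
      unfolding hyp_term_def using C
      by (intro order_trans[OF norm_mult_ineq] mult_mono)
        (auto simp: divide_inverse mult.commute intro!: mult_left_mono norm_power_ineq)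
    also have "\<dots> = (C * (2 * norm X) ^ j) * ((2 * norm X) ^ m /\<^sub>R fact m)"
      by (simp add: power_add power_mult_distrib divide_inverse mult_ac)
    finally show "norm (hyp_term A B j X m) \<le> (C * (2 * norm X) ^ j) * ((2 * norm X) ^ m /\<^sub>R fact m)" .
  qed
  then show ?thesis
    unfolding hyp_def by (rule summable_sums)
qed

text \<open>The term with index m has degree m + j, so the weight m is x d/dx - j, which carries x^j
  d^j/dx^j to the same operator of order j + 1.\<close>

lemma of_nat_hyp_term_sums:
  assumes "exp_stable B" "A * B = B * A"
  shows "(\<lambda>m. of_nat m * hyp_term A B j X m) sums hyp A B (Suc j) X"
proof -
  have "of_nat (Suc m) * hyp_term A B j X (Suc m) = hyp_term A B (Suc j) X m" for m
    by (simp add: hyp_term_def of_nat_mult_eq_scaleR divide_simps del: of_nat_Suc power_Suc)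
  then have "(\<lambda>m. of_nat (Suc m) * hyp_term A B j X (Suc m)) sums hyp A B (Suc j) X"
    using hyp_sums[OF assms, of "Suc j" X] by simp
  from sums_Suc[OF this] show ?thesis
    by simp
qed

text \<open>The coefficient factor B + (m + j) is split: j joins B, and the weight m raises the
  order of the derivative. Every series on the right has second parameter \<open>B + 1\<close>,
  which is what an induction on that parameter needs.\<close>

lemma hyp_lower_B:
  assumes "exp_stable B" "A * B = B * A"
  shows "B * hyp A B j X = (B + of_nat j) * hyp A (B + 1) j X + hyp A (B + 1) (Suc j) X"
proof -
  have B1: "exp_stable (B + 1)" "A * (B + 1) = (B + 1) * A"
    using exp_stable_add_of_nat[OF assms(1), of 1] assms(2) by (simp_all add: distrib_left distrib_right)
  have "(\<lambda>m. (B + of_nat j) * hyp_term A (B + 1) j X m + of_nat m * hyp_term A (B + 1) j X m) sums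
      ((B + of_nat j) * hyp A (B + 1) j X + hyp A (B + 1) (Suc j) X)"
    by (intro sums_add sums_mult hyp_sums of_nat_hyp_term_sums B1)
  moreover have "(B + of_nat j) * hyp_term A (B + 1) j X m + of_nat m * hyp_term A (B + 1) j X m
      = B * hyp_term A B j X m" for m
  proof -
    have "B * hyp_term A B j X m = (B + of_nat (m + j)) * hyp_term A (B + 1) j X m"
      by (simp only: hyp_term_def mult.assoc[symmetric] hyp_coeff_lower_B[OF assms])
    then show ?thesis
      by (simp add: distrib_right add_ac)
  qed
  ultimately show ?thesis
    using sums_unique2[OF sums_mult[OF hyp_sums[OF assms]]] by simp
qed

lemma hyp_raise_A:
  assumes "exp_stable B" "A * B = B * A"
  shows "A * hyp (A + 1) B j X = (A + of_nat j) * hyp A B j X + hyp A B (Suc j) X"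
proof -
  have A1: "(A + 1) * B = B * (A + 1)"
    using assms(2) by (simp add: distrib_left distrib_right)
  have "(\<lambda>m. (A + of_nat j) * hyp_term A B j X m + of_nat m * hyp_term A B j X m) sums
      ((A + of_nat j) * hyp A B j X + hyp A B (Suc j) X)"
    by (intro sums_add sums_mult hyp_sums of_nat_hyp_term_sums assms)
  moreover have "(A + of_nat j) * hyp_term A B j X m + of_nat m * hyp_term A B j X m
      = A * hyp_term (A + 1) B j X m" for m
  proof -
    have "A * hyp_term (A + 1) B j X m = (A + of_nat (m + j)) * hyp_term A B j X m"
      by (simp only: hyp_term_def mult.assoc[symmetric] hyp_coeff_raise_A[OF assms])
    then show ?thesis
      by (simp add: distrib_right add_ac)
  qed
  ultimately show ?thesis
    using sums_unique2[OF sums_mult[OF hyp_sums[OF assms(1) A1]]] by simp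
qed

text \<open>Raising A and lowering B produce the same derivative term \<open>hyp A B 1 X\<close>;
  subtracting the two relations eliminates it.\<close>

lemma hyp_contiguous_1:
  assumes "exp_stable (B - 1)" "A * B = B * A"
  shows "(B - (A + 1)) * hyp A B 0 X = (B - 1) * hyp A (B - 1) 0 X - A * hyp (A + 1) B 0 X"
proof -
  have "exp_stable B"
    using exp_stable_add_of_nat[OF assms(1), of 1] by simp
  from hyp_raise_A[OF this assms(2), of 0 X]
  have "A * hyp (A + 1) B 0 X = A * hyp A B 0 X + hyp A B 1 X"
    by simp
  moreover have "A * (B - 1) = (B - 1) * A"
    using assms(2) by (simp add: left_diff_distrib right_diff_distrib)
  from hyp_lower_B[OF assms(1) this, of 0 X]
  have "(B - 1) * hyp A (B - 1) 0 X = (B - 1) * hyp A B 0 X + hyp A B 1 X"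
    by simp
  ultimately show ?thesis
    by (simp add: algebra_simps)
qed

text \<open>The constant terms cancel. In the remaining ones n + 1 from
  \<open>hyp_coeff_diff_A\<close> reduces the factorial, and the index shift leaves one factor
  \<open>X\<close> in front.\<close>

lemma hyp_contiguous_2:
  assumes stable: "exp_stable B" and comm: "A * B = B * A" and X: "A * X = X * A" "B * X = X * B"
  shows "B * hyp A B 0 X - B * hyp (A - 1) B 0 X = X * hyp A (B + 1) 0 X"
proof -
  have A1: "(A - 1) * B = B * (A - 1)"
    using comm by (simp add: left_diff_distrib right_diff_distrib)
  have B1: "exp_stable (B + 1)" "A * (B + 1) = (B + 1) * A"
    using exp_stable_add_of_nat[OF stable, of 1] comm by (simp_all add: distrib_left distrib_right)
  define d where "d = (\<lambda>m. B * hyp_term A B 0 X m - B * hyp_term (A - 1) B 0 X m)"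
  have "X * hyp_coeff A (B + 1) m = hyp_coeff A (B + 1) m * X" for m
  proof (rule bicommutantD[symmetric])
    show "hyp_coeff A (B + 1) m \<in> bicommutant {A, B}"
      by (intro bicommutant_hyp_coeff B1 bicommutant_intros bicommutant_base) auto
  qed (use X in auto)
  note XC = this
  have "d (Suc m) = X * hyp_term A (B + 1) 0 X m" for m
  proof -
    have "d (Suc m) = (of_nat (Suc m) * hyp_coeff A (B + 1) m) * (X ^ Suc m /\<^sub>R fact (Suc m))"
      by (simp only: d_def hyp_term_def hyp_coeff_diff_A[OF stable comm, symmetric] mult.assoc left_diff_distrib add_0_right)
    also have "\<dots> = hyp_coeff A (B + 1) m * X * (X ^ m /\<^sub>R fact m)"
      by (simp add: of_nat_mult_eq_scaleR divide_simps mult.assoc del: of_nat_Suc)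
    finally show ?thesis
      by (simp only: XC[symmetric] hyp_term_def mult.assoc add_0_right)
  qed
  then have "(\<lambda>m. d (Suc m)) sums (X * hyp A (B + 1) 0 X)"
    using sums_mult[OF hyp_sums[OF B1, of 0 X], of X] by simp
  moreover have "d 0 = 0"
    by (simp add: d_def hyp_term_def hyp_coeff_def)
  ultimately have "d sums (X * hyp A (B + 1) 0 X)"
    by (simp add: sums_Suc_iff)
  moreover have "d sums (B * hyp A B 0 X - B * hyp (A - 1) B 0 X)"
    unfolding d_def by (intro sums_diff sums_mult hyp_sums stable comm A1)
  ultimately show ?thesis
    by (rule sums_unique2[symmetric])
qed

section \<open>Boundedness along stable directions\<close>

lemma power_div_fact_le_exp:
  assumes "x \<ge> (0::real)"
  shows "x ^ j / fact j \<le> exp x"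
proof -
  have "(\<Sum>n\<in>{j}. x ^ n /\<^sub>R fact n) \<le> (\<Sum>n. x ^ n /\<^sub>R fact n)"
    by (rule sum_le_suminf[OF summable_exp_generic]) (use assms in auto)
  then show ?thesis
    by (simp add: exp_def divide_inverse mult.commute)
qed

text \<open>The decay rate absorbs the polynomial factor, since (\<delta> s)^j / j! is at most
  exp(\<delta> s).\<close>

lemma exp_stable_power_exp_bound:
  fixes Y :: "'a::{real_normed_algebra_1,banach}"
  assumes "exp_stable Y"
  shows "\<exists>K. \<forall>s\<ge>0. norm ((- (s *\<^sub>R Y)) ^ j * exp (- (s *\<^sub>R Y))) \<le> K"
proof -
  obtain C \<delta> where C: "\<delta> > 0" "\<And>s. s \<ge> 0 \<Longrightarrow> norm (exp (- (s *\<^sub>R Y))) \<le> C * exp (- (\<delta> * s))"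
    using assms unfolding exp_stable_def by blast
  have "C \<ge> 0"
    using order_trans[OF norm_ge_zero C(2)[of 0]] by simp
  have "norm ((- (s *\<^sub>R Y)) ^ j * exp (- (s *\<^sub>R Y))) \<le> norm Y ^ j * (fact j / \<delta> ^ j) * C" if s: "s \<ge> 0" for s
  proof -
    have "s ^ j = (fact j / \<delta> ^ j) * ((\<delta> * s) ^ j / fact j)"
      using C(1) by (simp add: power_mult_distrib)
    also have "\<dots> \<le> (fact j / \<delta> ^ j) * exp (\<delta> * s)"
      using C(1) s by (intro mult_left_mono power_div_fact_le_exp) auto
    finally have "s ^ j \<le> (fact j / \<delta> ^ j) * exp (\<delta> * s)" .
    moreover have "norm ((- (s *\<^sub>R Y)) ^ j) \<le> norm Y ^ j * s ^ j"
      using norm_power_ineq[of "- (s *\<^sub>R Y)" j] s by (simp add: power_mult_distrib mult.commute)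
    ultimately have "norm ((- (s *\<^sub>R Y)) ^ j) \<le> norm Y ^ j * ((fact j / \<delta> ^ j) * exp (\<delta> * s))"
      by (meson mult_left_mono norm_ge_zero order_trans zero_le_power)
    then have "norm ((- (s *\<^sub>R Y)) ^ j * exp (- (s *\<^sub>R Y)))
        \<le> (norm Y ^ j * ((fact j / \<delta> ^ j) * exp (\<delta> * s))) * (C * exp (- (\<delta> * s)))"
      using C(2)[OF s] C(1) by (intro order_trans[OF norm_mult_ineq] mult_mono) auto
    also have "\<dots> = norm Y ^ j * (fact j / \<delta> ^ j) * C"
      by (simp add: exp_minus field_simps)
    finally show ?thesis .
  qed
  then show ?thesis
    by blast
qed

lemma exp_shifted_sums:
  fixes X :: "'a::{real_normed_algebra_1,banach}"
  shows "(\<lambda>m. X ^ (m + j) /\<^sub>R fact m) sums (X ^ j * exp X)"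
proof -
  have "X ^ j * (X ^ m /\<^sub>R fact m) = X ^ (m + j) /\<^sub>R fact m" for m
    by (simp add: power_add[symmetric] add.commute)
  then show ?thesis
    using sums_mult[OF exp_converges, of "X ^ j" X] by simp
qed

section \<open>Euler's integral when \<open>B - A\<close> is stable\<close>

context
  fixes A B :: "'r::finite sqmat"
  assumes A: "exp_stable A" and B: "exp_stable B" and D: "exp_stable (B - A)" and comm: "A * B = B * A"
begin

lemma comm_diff: "A * (B - A) = (B - A) * A"
  using comm by (simp add: left_diff_distrib right_diff_distrib)

text \<open>With \<open>P = A\<close> and \<open>Q = B - A\<close> the recursion of the moments is
  that of the coefficients, so the two sequences differ by the moment of order 0 only.\<close>

lemma hyp_coeff_times_moment: "hyp_coeff A B n * beta_moment A (B - A) 0 = beta_moment A (B - A) n"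
proof (induction n)
  case 0
  then show ?case
    using sq_inv(1)[of "1 :: 'r sqmat" 1] by (simp add: hyp_coeff_def)
next
  case (Suc n)
  obtain V where V: "V * (B + of_nat n) = 1"
    using exp_stable_invertible[OF exp_stable_add_of_nat[OF B]] by blast
  have "(B + of_nat n) * (hyp_coeff A B (Suc n) * beta_moment A (B - A) 0)
      = (A + of_nat n) * (hyp_coeff A B n * beta_moment A (B - A) 0)"
    by (simp only: mult.assoc[symmetric] hyp_coeff_Suc[OF B comm])
  also have "\<dots> = (A + of_nat n) * beta_moment A (B - A) n"
    by (simp only: Suc)
  also have "\<dots> = (B + of_nat n) * beta_moment A (B - A) (Suc n)"
    using beta_moment_Suc[OF A D comm_diff, of n] by simp
  finally have "V * (B + of_nat n) * (hyp_coeff A B (Suc n) * beta_moment A (B - A) 0)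
      = V * (B + of_nat n) * beta_moment A (B - A) (Suc n)"
    by (simp only: mult.assoc)
  then show ?case
    by (simp only: V mult_1_left)
qed

lemma beta_moment_0_invertible: "\<exists>V. beta_moment A (B - A) 0 * V = 1"
proof (rule ccontr)
  assume "\<nexists>V. beta_moment A (B - A) 0 * V = 1"
  then obtain Z where Z: "Z \<noteq> 0" "beta_moment A (B - A) 0 * Z = 0"
    by (rule noninvertible_imp_annihilates)
  have "beta_moment A (B - A) n * Z = 0" for n
    using Z(2) by (simp only: hyp_coeff_times_moment[of n, symmetric] mult.assoc mult_zero_right)
  then have "Z = 0"
    by (rule beta_moments_annihilate_imp_zero[OF A D])
  with Z(1) show False ..
qed

text \<open>Expand the exponential under the integral. For 0 < u < 1 the term with index m is at
  most \<open>c m * norm (W u)\<close>, with \<open>c\<close> summable and \<open>W\<close>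
  integrable, so sum and integral may be exchanged.\<close>

lemma exp_moment_sums:
  "(\<lambda>m. (X ^ (m + j) /\<^sub>R fact m) * beta_moment A (B - A) (m + j)) sums
    (LBINT u:{0<..<1}. ((u *\<^sub>R X) ^ j * exp (u *\<^sub>R X)) * beta_weight A (B - A) u)"
proof -
  define w where "w = beta_weight A (B - A)"
  define g where "g = (\<lambda>m u. (X ^ (m + j) /\<^sub>R fact m) * (u ^ (m + j) *\<^sub>R w u))"
  define f where "f = (\<lambda>m (u::real). indicator {0<..<1} u *\<^sub>R g m u)"
  define W where "W = (\<lambda>u::real. indicator {0<..<1} u *\<^sub>R w u)"
  define c where "c = (\<lambda>m. norm X ^ j * (norm X ^ m /\<^sub>R fact m))"
  note lin = set_integral_bounded_linear[OF bounded_linear_mult_right beta_moment_integrable[OF A D]]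
  have int_f: "integrable lborel (f m)" for m
    using lin(1)[of "X ^ (m + j) /\<^sub>R fact m" "m + j"]
    unfolding f_def g_def w_def set_integrable_def by simp
  have integral_f: "integral\<^sup>L lborel (f m) = (X ^ (m + j) /\<^sub>R fact m) * beta_moment A (B - A) (m + j)" for m
    using lin(2)[of "X ^ (m + j) /\<^sub>R fact m" "m + j"]
    unfolding f_def g_def w_def set_lebesgue_integral_def beta_moment_def by simp
  have int_W: "integrable lborel W"
    using beta_moment_integrable[OF A D, of 0] unfolding W_def w_def set_integrable_def by simp
  have c: "summable c"
    unfolding c_def by (intro summable_mult summable_exp_generic)
  have norm_f: "norm (f m u) \<le> c m * norm (W u)" for m u
  proof (cases "0 < u \<and> u < 1")
    case True
    have "norm (X ^ (m + j) /\<^sub>R fact m) \<le> norm X ^ (m + j) /\<^sub>R fact m"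
      using norm_power_ineq[of X "m + j"] by (simp add: mult_left_mono)
    moreover have "norm (u ^ (m + j) *\<^sub>R w u) \<le> norm (w u)"
      using True power_le_one[of u "m + j"] by (simp add: mult_left_le_one_le)
    ultimately have "norm (g m u) \<le> (norm X ^ (m + j) /\<^sub>R fact m) * norm (w u)"
      unfolding g_def by (intro order_trans[OF norm_mult_ineq] mult_mono) auto
    then show ?thesis
      using True by (simp add: f_def W_def c_def power_add mult_ac)
  qed (auto simp: f_def W_def)
  have "AE u in lborel. summable (\<lambda>m. norm (f m u))"
  proof (intro AE_I2)
    fix u
    show "summable (\<lambda>m. norm (f m u))"
      by (rule summable_comparison_test'[OF summable_mult2[OF c, of "norm (W u)"], where N = 0]) (simp add: norm_f)
  qed
  moreover have "summable (\<lambda>m. \<integral>u. norm (f m u) \<partial>lborel)"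
  proof (rule summable_comparison_test'[OF summable_mult2[OF c], where N = 0])
    fix m
    have "(\<integral>u. norm (f m u) \<partial>lborel) \<le> (\<integral>u. c m * norm (W u) \<partial>lborel)"
      by (intro integral_mono integrable_norm integrable_mult_right int_f int_W norm_f)
    also have "\<dots> = c m * (\<integral>u. norm (W u) \<partial>lborel)"
      by simp
    finally show "norm (\<integral>u. norm (f m u) \<partial>lborel) \<le> c m * (\<integral>u. norm (W u) \<partial>lborel)"
      by (simp add: integral_nonneg)
  qed
  ultimately have "(\<lambda>m. integral\<^sup>L lborel (f m)) sums (\<integral>u. (\<Sum>m. f m u) \<partial>lborel)"
    by (intro sums_integral int_f)
  moreover have "(\<Sum>m. f m u) = indicator {0<..<1} u *\<^sub>R (((u *\<^sub>R X) ^ j * exp (u *\<^sub>R X)) * w u)" for u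
  proof -
    have "f m u = indicator {0<..<1} u *\<^sub>R (((u *\<^sub>R X) ^ (m + j) /\<^sub>R fact m) * w u)" for m
      by (simp add: f_def g_def scaleR_power)
    moreover have "(\<lambda>m. indicator {0<..<1} u *\<^sub>R (((u *\<^sub>R X) ^ (m + j) /\<^sub>R fact m) * w u)) sums
        (indicator {0<..<1} u *\<^sub>R (((u *\<^sub>R X) ^ j * exp (u *\<^sub>R X)) * w u))"
      by (intro sums_scaleR_right sums_mult2 exp_shifted_sums)
    ultimately show ?thesis
      by (simp add: sums_iff)
  qed
  ultimately show ?thesis
    by (simp add: integral_f set_lebesgue_integral_def w_def)
qed

text \<open>Right multiplication by \<open>V\<close> turns moments into coefficients. The powers of
  \<open>X\<close> must pass the coefficients, hence the commutation with A and B.\<close>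

lemma hyp_eq_integral:
  assumes V: "beta_moment A (B - A) 0 * V = 1" and X: "A * X = X * A" "B * X = X * B"
  shows "hyp A B j X = (LBINT u:{0<..<1}. ((u *\<^sub>R X) ^ j * exp (u *\<^sub>R X)) * beta_weight A (B - A) u) * V"
proof -
  have "hyp_term A B j X m = (X ^ (m + j) /\<^sub>R fact m) * beta_moment A (B - A) (m + j) * V" for m
  proof -
    have hc: "hyp_coeff A B (m + j) \<in> bicommutant {A, B}"
      by (intro bicommutant_hyp_coeff B bicommutant_base) auto
    have "A * X ^ k = X ^ k * A" "B * X ^ k = X ^ k * B" for k
      by (rule power_commuting_commutes[OF X(1)[symmetric], symmetric],
          rule power_commuting_commutes[OF X(2)[symmetric], symmetric])
    then have "s * (X ^ k /\<^sub>R fact m) = (X ^ k /\<^sub>R fact m) * s" if "s \<in> {A, B}" for s k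
      using that by auto
    from bicommutantD[OF hc this]
    have commX: "hyp_coeff A B (m + j) * (X ^ (m + j) /\<^sub>R fact m) = (X ^ (m + j) /\<^sub>R fact m) * hyp_coeff A B (m + j)"
      by blast
    have "beta_moment A (B - A) (m + j) * V = hyp_coeff A B (m + j) * (beta_moment A (B - A) 0 * V)"
      by (simp only: hyp_coeff_times_moment mult.assoc[symmetric])
    then have "hyp_coeff A B (m + j) = beta_moment A (B - A) (m + j) * V"
      by (simp only: V mult_1_right)
    then have "(X ^ (m + j) /\<^sub>R fact m) * hyp_coeff A B (m + j) = (X ^ (m + j) /\<^sub>R fact m) * beta_moment A (B - A) (m + j) * V"
      by (simp only: mult.assoc)
    with commX show ?thesis
      unfolding hyp_term_def by (rule trans)
  qed
  then have "hyp_term A B j X = (\<lambda>m. (X ^ (m + j) /\<^sub>R fact m) * beta_moment A (B - A) (m + j) * V)"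
    by (rule ext)
  with hyp_sums[OF B comm, of j X]
  have "(\<lambda>m. (X ^ (m + j) /\<^sub>R fact m) * beta_moment A (B - A) (m + j) * V) sums hyp A B j X"
    by (simp only:)
  then show ?thesis
    by (rule sums_unique2[OF _ sums_mult2[OF exp_moment_sums]])
qed

text \<open>Scaling by u in (0,1) maps the ray -sY into itself, so one bound for (-sY)^j exp(-sY)
  serves the whole integral.\<close>

lemma hyp_bounded_base:
  assumes Y: "exp_stable Y" "A * Y = Y * A" "B * Y = Y * B"
  shows "\<exists>K. \<forall>s\<ge>0. norm (hyp A B j (- (s *\<^sub>R Y))) \<le> K"
proof -
  obtain V where V: "beta_moment A (B - A) 0 * V = 1"
    using beta_moment_0_invertible by blast
  obtain K where K: "\<And>s. s \<ge> 0 \<Longrightarrow> norm ((- (s *\<^sub>R Y)) ^ j * exp (- (s *\<^sub>R Y))) \<le> K"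
    using exp_stable_power_exp_bound[OF Y(1)] by blast
  define w where "w = (\<lambda>u::real. indicator {0<..<1} u *\<^sub>R beta_weight A (B - A) u)"
  have "integrable lborel w"
    using beta_moment_integrable[OF A D, of 0] unfolding w_def set_integrable_def by simp
  have "norm (hyp A B j (- (s *\<^sub>R Y))) \<le> (K * (\<integral>u. norm (w u) \<partial>lborel)) * norm V" if "s \<ge> 0" for s
  proof -
    define X where "X = - (s *\<^sub>R Y)"
    define h where "h = (\<lambda>u::real. indicator {0<..<1} u *\<^sub>R (((u *\<^sub>R X) ^ j * exp (u *\<^sub>R X)) * beta_weight A (B - A) u))"
    have "norm (h u) \<le> K * norm (w u)" for u
    proof (cases "0 < u \<and> u < 1")
      case True
      have "u *\<^sub>R X = - ((u * s) *\<^sub>R Y)"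
        by (simp add: X_def)
      then have "norm ((u *\<^sub>R X) ^ j * exp (u *\<^sub>R X)) \<le> K"
        using K[of "u * s"] True that by (simp only: mult_nonneg_nonneg order_less_imp_le)
      then have "norm (((u *\<^sub>R X) ^ j * exp (u *\<^sub>R X)) * beta_weight A (B - A) u) \<le> K * norm (beta_weight A (B - A) u)"
        by (rule order_trans[OF norm_mult_ineq mult_right_mono]) simp
      moreover have "indicator {0<..<1} u = (1::real)"
        using True by simp
      ultimately show ?thesis
        unfolding h_def w_def by (simp only: scaleR_one)
    qed (auto simp: h_def w_def)
    then have "(\<integral>u. norm (h u) \<partial>lborel) \<le> (\<integral>u. K * norm (w u) \<partial>lborel)"
      using \<open>integrable lborel w\<close>
      by (intro integral_mono' integrable_mult_right integrable_norm) (auto intro: order_trans[OF norm_ge_zero])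
    with integral_norm_bound[of lborel h] have "norm (\<integral>u. h u \<partial>lborel) \<le> (\<integral>u. K * norm (w u) \<partial>lborel)"
      by (rule order_trans)
    also have "\<dots> = K * (\<integral>u. norm (w u) \<partial>lborel)"
      by simp
    finally have "norm (\<integral>u. h u \<partial>lborel) \<le> K * (\<integral>u. norm (w u) \<partial>lborel)" .
    moreover have "hyp A B j X = (\<integral>u. h u \<partial>lborel) * V"
      using hyp_eq_integral[OF V, of X j] Y(2,3) by (simp add: h_def set_lebesgue_integral_def X_def)
    ultimately show ?thesis
      unfolding X_def[symmetric] by (auto intro!: order_trans[OF norm_mult_ineq] mult_right_mono)
  qed
  then show ?thesis
    by blast
qed

end

text \<open>When \<open>B - A\<close> is not stable there is no Euler integral; \<open>B\<close> is then lowered from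
  \<open>B + k\<close>, at the price of the shifted series.\<close>

theorem hyp_bounded:
  fixes A B Y :: "'r::finite sqmat"
  assumes stable: "exp_stable A" "exp_stable B" "exp_stable Y"
    and comm: "A * B = B * A" "A * Y = Y * A" "B * Y = Y * B"
  shows "\<exists>K. \<forall>s\<ge>0. norm (hyp A B j (- (s *\<^sub>R Y))) \<le> K"
proof -
  \<comment> \<open>Generalised over \<open>B\<close> and \<open>j\<close>, because one step passes
    to \<open>B + 1\<close> with both \<open>j\<close> and \<open>Suc j\<close>.\<close>
  have "\<exists>K. \<forall>s\<ge>0. norm (hyp A B j (- (s *\<^sub>R Y))) \<le> K"
    if "exp_stable (B + of_nat k - A)" "exp_stable B" "A * B = B * A" "B * Y = Y * B" for k j and B :: "'r sqmat"
    using that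
  proof (induction k arbitrary: B j)
    case 0
    then show ?case
      using hyp_bounded_base[OF stable(1) _ _ _ stable(3) comm(2)] by simp
  next
    case (Suc k)
    have B1: "exp_stable (B + 1)" "A * (B + 1) = (B + 1) * A" "(B + 1) * Y = Y * (B + 1)"
      using exp_stable_add_of_nat[OF Suc.prems(2), of 1] Suc.prems(3,4) by (simp_all add: distrib_left distrib_right)
    have "B + 1 + of_nat k - A = B + of_nat (Suc k) - A"
      by simp
    with Suc.prems(1) have k: "exp_stable (B + 1 + of_nat k - A)"
      by (simp only:)
    obtain K where K: "\<And>s. s \<ge> 0 \<Longrightarrow> norm (hyp A (B + 1) j (- (s *\<^sub>R Y))) \<le> K"
      using Suc.IH[OF k B1, of j] by blast
    obtain L where L: "\<And>s. s \<ge> 0 \<Longrightarrow> norm (hyp A (B + 1) (Suc j) (- (s *\<^sub>R Y))) \<le> L"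
      using Suc.IH[OF k B1, of "Suc j"] by blast
    obtain V where V: "V * B = 1"
      using exp_stable_invertible[OF Suc.prems(2)] by blast
    have "norm (hyp A B j (- (s *\<^sub>R Y))) \<le> norm V * (norm (B + of_nat j) * K + L)" if "s \<ge> 0" for s
    proof -
      have "hyp A B j X = V * ((B + of_nat j) * hyp A (B + 1) j X + hyp A (B + 1) (Suc j) X)" for X
        by (simp only: hyp_lower_B[OF Suc.prems(2,3), symmetric] mult.assoc[symmetric] V mult_1_left)
      then show ?thesis
        using K[OF that] L[OF that]
        by (auto intro!: order_trans[OF norm_mult_ineq] mult_left_mono order_trans[OF norm_triangle_ineq] add_mono)
    qed
    then show ?case
      by blast
  qed
  moreover obtain k :: nat where "norm (B - A) < real k"
    using reals_Archimedean2 by blast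
  then have "exp_stable (B + of_nat k - A)"
    using exp_stable_add_large[of "B - A" "real k"] by (simp add: algebra_simps)
  ultimately show ?thesis
    using stable(2) comm by blast
qed

section \<open>The extended beta matrix function\<close>

lemma bicommutant_hyp:
  assumes "A \<in> bicommutant S" "B \<in> bicommutant S" "X \<in> bicommutant S" "exp_stable B" "A * B = B * A"
  shows "hyp A B j X \<in> bicommutant S"
proof (rule bicommutant_limit)
  show "(\<lambda>n. \<Sum>m<n. hyp_term A B j X m) \<longlonglongrightarrow> hyp A B j X"
    using hyp_sums[OF assms(4,5)] by (simp only: sums_def)
  have "hyp_term A B j X m \<in> bicommutant S" for m
    unfolding hyp_term_def using assms by (intro bicommutant_intros bicommutant_hyp_coeff)
  then show "(\<Sum>m<n. hyp_term A B j X m) \<in> bicommutant S" for n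
    by (induction n) (simp_all add: bicommutant_add, simp add: bicommutant_def)
qed

lemma borel_measurable_hyp: "hyp A B j \<in> borel_measurable borel"
proof -
  have "(\<lambda>X. hyp_term A B j X m) \<in> borel_measurable borel" for m
    unfolding hyp_term_def by (intro borel_measurable_continuous_onI continuous_intros)
  then have "(\<lambda>X. hyp A B j X) \<in> borel_measurable borel"
    unfolding hyp_def by (rule borel_measurable_suminf)
  then show ?thesis .
qed

definition hyp_kernel :: "'r::finite sqmat \<Rightarrow> 'r sqmat \<Rightarrow> 'r sqmat \<Rightarrow> real \<Rightarrow> 'r sqmat" where
  "hyp_kernel A B Y t = hyp A B 0 (- ((1 / (t * (1 - t))) *\<^sub>R Y))"

definition ebeta :: "'r::finite sqmat \<Rightarrow> 'r sqmat \<Rightarrow> 'r sqmat \<Rightarrow> 'r sqmat \<Rightarrow> 'r sqmat \<Rightarrow> 'r sqmat" where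
  "ebeta A B Y P Q = (LBINT t:{0<..<1}. hyp_kernel A B Y t * beta_weight P Q t)"

definition commuting_stable :: "'r::finite sqmat \<Rightarrow> 'r sqmat \<Rightarrow> 'r sqmat \<Rightarrow> bool" where
  "commuting_stable A B Y \<longleftrightarrow> exp_stable A \<and> exp_stable B \<and> exp_stable Y \<and>
     A * B = B * A \<and> A * Y = Y * A \<and> B * Y = Y * B"

text \<open>The number 1/(t(1-t)) is positive on the whole interval, so the bound along the ray
  applies uniformly up to the endpoints.\<close>

lemma hyp_kernel_bounded:
  assumes "commuting_stable A B Y"
  shows "\<exists>K. \<forall>t. 0 < t \<longrightarrow> t < 1 \<longrightarrow> norm (hyp_kernel A B Y t) \<le> K"
proof -
  obtain K where "\<And>s. s \<ge> 0 \<Longrightarrow> norm (hyp A B 0 (- (s *\<^sub>R Y))) \<le> K"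
    using hyp_bounded[of A B Y 0] assms unfolding commuting_stable_def by blast
  then have "norm (hyp_kernel A B Y t) \<le> K" if "0 < t" "t < 1" for t
    unfolding hyp_kernel_def using that by simp
  then show ?thesis
    by blast
qed

lemma hyp_kernel_measurable: "set_borel_measurable lborel {0<..<1} (hyp_kernel A B Y)"
proof -
  have "(\<lambda>t. hyp A B 0 (- ((1 / (t * (1 - t))) *\<^sub>R Y))) \<in> borel_measurable borel"
    by (rule measurable_compose[OF _ borel_measurable_hyp]) measurable
  then show ?thesis
    unfolding set_borel_measurable_def hyp_kernel_def by measurable
qed

lemma ebeta_integrable:
  assumes "commuting_stable A B Y" "exp_stable P" "exp_stable Q"
  shows "set_integrable lborel {0<..<1} (\<lambda>t. hyp_kernel A B Y t * beta_weight P Q t)"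
proof -
  obtain K where "\<And>t. 0 < t \<Longrightarrow> t < 1 \<Longrightarrow> norm (hyp_kernel A B Y t) \<le> K"
    using hyp_kernel_bounded[OF assms(1)] by blast
  then show ?thesis
    by (rule beta_weight_integrable[OF assms(2,3) hyp_kernel_measurable])
qed

lemma ebeta_mult_left:
  assumes "commuting_stable A B Y" "exp_stable P" "exp_stable Q"
  shows "set_integrable lborel {0<..<1} (\<lambda>t. Z * (hyp_kernel A B Y t * beta_weight P Q t))"
    and "Z * ebeta A B Y P Q = (LBINT t:{0<..<1}. Z * (hyp_kernel A B Y t * beta_weight P Q t))"
proof -
  note * = set_integral_bounded_linear[OF bounded_linear_mult_right[of Z] ebeta_integrable[OF assms]]
  show "set_integrable lborel {0<..<1} (\<lambda>t. Z * (hyp_kernel A B Y t * beta_weight P Q t))"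
    by (rule *(1))
  show "Z * ebeta A B Y P Q = (LBINT t:{0<..<1}. Z * (hyp_kernel A B Y t * beta_weight P Q t))"
    unfolding ebeta_def by (rule *(2)[symmetric])
qed

lemma bicommutant_ebeta:
  assumes "commuting_stable A B Y" "exp_stable P" "exp_stable Q"
    and S: "A \<in> bicommutant S" "B \<in> bicommutant S" "Y \<in> bicommutant S" "P \<in> bicommutant S" "Q \<in> bicommutant S"
  shows "ebeta A B Y P Q \<in> bicommutant S"
  unfolding ebeta_def
proof (rule bicommutant_set_integral[OF ebeta_integrable[OF assms(1-3)]])
  fix t
  have "hyp_kernel A B Y t \<in> bicommutant S"
    unfolding hyp_kernel_def using assms(1) unfolding commuting_stable_def
    by (intro bicommutant_hyp bicommutant_intros S) auto
  moreover have "beta_weight P Q t \<in> bicommutant S"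
    unfolding beta_weight_def by (intro bicommutant_intros S)
  ultimately show "hyp_kernel A B Y t * beta_weight P Q t \<in> bicommutant S"
    by (rule bicommutant_mult)
qed

text \<open>Raising \<open>P\<close> by N multiplies the integrand by t^N, which is at most 1; the
  case N = 0 dominates all others.\<close>

lemma ebeta_shift_bounded:
  assumes "commuting_stable A B Y" "exp_stable P" "exp_stable Q"
  shows "\<exists>K. \<forall>N. norm (ebeta A B Y (P + of_nat N) Q) \<le> K"
proof -
  obtain K where K: "\<And>t. 0 < t \<Longrightarrow> t < 1 \<Longrightarrow> norm (hyp_kernel A B Y t) \<le> K"
    using hyp_kernel_bounded[OF assms(1)] by blast
  define w where "w = (\<lambda>t::real. indicator {0<..<1} t *\<^sub>R (hyp_kernel A B Y t * beta_weight P Q t))"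
  have w: "integrable lborel w"
    using ebeta_integrable[OF assms] unfolding set_integrable_def w_def .
  have "norm (ebeta A B Y (P + of_nat N) Q) \<le> (\<integral>t. norm (w t) \<partial>lborel)" for N
  proof -
    define h where "h = (\<lambda>t::real. indicator {0<..<1} t *\<^sub>R (hyp_kernel A B Y t * beta_weight (P + of_nat N) Q t))"
    have "norm (h t) \<le> norm (w t)" for t
    proof (cases "0 < t \<and> t < 1")
      case True
      then have "rpow t (P + of_nat N - 1) = t ^ N *\<^sub>R rpow t (P - 1)"
        using rpow_add_of_nat[of t "P - 1" N] by (simp add: algebra_simps)
      then have "h t = t ^ N *\<^sub>R w t"
        by (simp add: h_def w_def beta_weight_def)
      moreover have "t ^ N \<le> 1"
        using True by (intro power_le_one) auto
      ultimately show ?thesis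
        using True by (simp add: mult_left_le_one_le)
    qed (auto simp: h_def w_def)
    then have "(\<integral>t. norm (h t) \<partial>lborel) \<le> (\<integral>t. norm (w t) \<partial>lborel)"
      by (intro integral_mono' integrable_norm w) auto
    with integral_norm_bound[of lborel h] have "norm (\<integral>t. h t \<partial>lborel) \<le> (\<integral>t. norm (w t) \<partial>lborel)"
      by (rule order_trans)
    then show ?thesis
      by (simp only: ebeta_def set_lebesgue_integral_def h_def)
  qed
  then show ?thesis
    by blast
qed

lemma ebeta_contiguous_1:
  assumes cs: "commuting_stable A B Y" and B1: "exp_stable (B - 1)" and PQ: "exp_stable P" "exp_stable Q"
  shows "(B - (A + 1)) * ebeta A B Y P Q = (B - 1) * ebeta A (B - 1) Y P Q - A * ebeta (A + 1) B Y P Q"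
proof -
  have cs1: "commuting_stable A (B - 1) Y"
    using cs B1 by (simp add: commuting_stable_def left_diff_distrib right_diff_distrib)
  have cs2: "commuting_stable (A + 1) B Y"
    using cs exp_stable_add_of_nat[of A 1] by (simp add: commuting_stable_def distrib_left distrib_right)
  have "(B - 1) * ebeta A (B - 1) Y P Q - A * ebeta (A + 1) B Y P Q
     = (LBINT t:{0<..<1}. (B - 1) * (hyp_kernel A (B - 1) Y t * beta_weight P Q t)
          - A * (hyp_kernel (A + 1) B Y t * beta_weight P Q t))"
    unfolding ebeta_mult_left(2)[OF cs1 PQ] ebeta_mult_left(2)[OF cs2 PQ]
    by (rule set_integral_diff(2)[OF ebeta_mult_left(1)[OF cs1 PQ] ebeta_mult_left(1)[OF cs2 PQ], symmetric])
  also have "\<dots> = (LBINT t:{0<..<1}. (B - (A + 1)) * (hyp_kernel A B Y t * beta_weight P Q t))"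
  proof -
    have "A * B = B * A"
      using cs by (simp add: commuting_stable_def)
    then have "(B - 1) * (hyp_kernel A (B - 1) Y t * W) - A * (hyp_kernel (A + 1) B Y t * W)
        = (B - (A + 1)) * (hyp_kernel A B Y t * W)" for t W
      unfolding hyp_kernel_def mult.assoc[symmetric] left_diff_distrib[symmetric]
      by (simp only: hyp_contiguous_1[OF B1])
    then show ?thesis
      by (simp only:)
  qed
  finally show ?thesis
    unfolding ebeta_mult_left(2)[OF cs PQ] by simp
qed

lemma ebeta_contiguous_2:
  assumes cs: "commuting_stable A B Y" and A1: "exp_stable (A - 1)"
    and P: "exp_stable P" "exp_stable (P - 1)" and Q: "exp_stable Q" "exp_stable (Q - 1)"
  shows "B * ebeta A B Y P Q - B * ebeta (A - 1) B Y P Q + Y * ebeta A (B + 1) Y (P - 1) (Q - 1) = 0"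
proof -
  note cs' = cs[unfolded commuting_stable_def]
  have cs1: "commuting_stable (A - 1) B Y"
    using cs A1 by (simp add: commuting_stable_def left_diff_distrib right_diff_distrib)
  have cs2: "commuting_stable A (B + 1) Y"
    using cs exp_stable_add_of_nat[of B 1] by (simp add: commuting_stable_def distrib_left distrib_right)
  have "B * ebeta A B Y P Q - B * ebeta (A - 1) B Y P Q
     = (LBINT t:{0<..<1}. B * (hyp_kernel A B Y t * beta_weight P Q t)
          - B * (hyp_kernel (A - 1) B Y t * beta_weight P Q t))"
    unfolding ebeta_mult_left(2)[OF cs P(1) Q(1)] ebeta_mult_left(2)[OF cs1 P(1) Q(1)]
    by (rule set_integral_diff(2)[OF ebeta_mult_left(1)[OF cs P(1) Q(1)]
          ebeta_mult_left(1)[OF cs1 P(1) Q(1)], symmetric])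
  also have "\<dots> = (LBINT t:{0<..<1}. (- Y) * (hyp_kernel A (B + 1) Y t * beta_weight (P - 1) (Q - 1) t))"
  proof (rule set_lebesgue_integral_cong)
    show "\<forall>t. t \<in> {0<..<1} \<longrightarrow> B * (hyp_kernel A B Y t * beta_weight P Q t)
          - B * (hyp_kernel (A - 1) B Y t * beta_weight P Q t)
        = (- Y) * (hyp_kernel A (B + 1) Y t * beta_weight (P - 1) (Q - 1) t)"
    proof (intro allI impI)
      fix t :: real assume "t \<in> {0<..<1}"
      then have t: "0 < t" "t < 1"
        by auto
      define X where "X = - ((1 / (t * (1 - t))) *\<^sub>R Y)"
      define W where "W = beta_weight (P - 1) (Q - 1) t"
      have XY: "A * X = X * A" "B * X = X * B"
        using cs' by (simp_all add: X_def)
      \<comment> \<open>The factor t(1-t) freed by lowering both exponents cancels the denominator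
        of \<open>X\<close> and leaves \<open>- Y\<close>.\<close>
      have "beta_weight P Q t = (t * (1 - t)) *\<^sub>R W"
        using t rpow_diff_1[of t "P - 1"] rpow_diff_1[of "1 - t" "Q - 1"]
        by (simp add: beta_weight_def W_def)
      then have "B * (hyp_kernel A B Y t * beta_weight P Q t) - B * (hyp_kernel (A - 1) B Y t * beta_weight P Q t)
          = (t * (1 - t)) *\<^sub>R ((B * hyp A B 0 X - B * hyp (A - 1) B 0 X) * W)"
        by (simp only: hyp_kernel_def X_def[symmetric] mult_scaleR_right left_diff_distrib
            scaleR_right_diff_distrib mult.assoc)
      also have "B * hyp A B 0 X - B * hyp (A - 1) B 0 X = X * hyp A (B + 1) 0 X"
        by (rule hyp_contiguous_2) (use cs' XY in auto)
      also have "(t * (1 - t)) *\<^sub>R (X * hyp A (B + 1) 0 X * W) = ((t * (1 - t)) *\<^sub>R X) * (hyp A (B + 1) 0 X * W)"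
        by (simp only: mult_scaleR_left mult.assoc)
      also have "(t * (1 - t)) *\<^sub>R X = - Y"
        using t by (simp add: X_def)
      finally show "B * (hyp_kernel A B Y t * beta_weight P Q t) - B * (hyp_kernel (A - 1) B Y t * beta_weight P Q t)
          = (- Y) * (hyp_kernel A (B + 1) Y t * beta_weight (P - 1) (Q - 1) t)"
        by (simp only: hyp_kernel_def X_def[symmetric] W_def)
    qed
  qed simp
  also have "\<dots> = (- Y) * ebeta A (B + 1) Y (P - 1) (Q - 1)"
    by (rule ebeta_mult_left(2)[OF cs2 P(2) Q(2), symmetric])
  finally show ?thesis
    by simp
qed

section \<open>The gamma matrix function\<close>

text \<open>The weight is the norm of the complex gamma integrand; its Borel measurability permits
  the return from the completed measure.\<close>

lemma Gamma_weight_integrable: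
  assumes "x > 0"
  shows "set_integrable lborel {0<..} (\<lambda>t::real. exp (- t) * t powr (x - 1))"
proof -
  have "(\<lambda>t. norm (complex_of_real t powr (complex_of_real x - 1) / of_real (exp t))) absolutely_integrable_on {0<..}"
    using absolutely_integrable_norm[OF absolutely_integrable_Gamma_integral'[of "complex_of_real x"]] assms
    by (simp add: o_def)
  then have "set_integrable lebesgue {0<..} (\<lambda>t::real. exp (- t) * t powr (x - 1))"
  proof (rule set_integrable_cong[THEN iffD1, rotated -1])
    fix t :: real assume "t \<in> {0<..}"
    then show "norm (complex_of_real t powr (complex_of_real x - 1) / of_real (exp t)) = exp (- t) * t powr (x - 1)"
      by (simp add: norm_divide norm_powr_real_powr exp_minus field_simps)
  qed auto
  moreover have "(\<lambda>t::real. indicator {0<..} t *\<^sub>R (exp (- t) * t powr (x - 1))) \<in> borel_measurable lborel"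
    by measurable
  ultimately show ?thesis
    unfolding set_integrable_def by (simp add: integrable_completion)
qed

definition gam :: "'r::finite sqmat \<Rightarrow> 'r sqmat" where
  "gam P = (LBINT t:{0<..}. exp (- t) *\<^sub>R rpow t (P - 1))"

lemma gam_integrable:
  fixes P :: "'r::finite sqmat"
  assumes "exp_stable P"
  shows "set_integrable lborel {0<..} (\<lambda>t. exp (- t) *\<^sub>R rpow t (P - 1))"
proof -
  obtain C \<delta> where C: "\<delta> > 0" "C \<ge> 0" "\<And>t. 0 < t \<Longrightarrow> t \<le> 1 \<Longrightarrow> norm (rpow t P) \<le> C * t powr \<delta>"
    by (rule exp_stable_rpow_bound[OF assms]) (rule that)
  \<comment> \<open>For t > 1 the matrix power is at most t^(k-1), and adding 1 makes
    \<open>k\<close> positive. Stability of \<open>P\<close> controls the part near 0.\<close>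
  define k where "k = norm (P - 1) + 1"
  have "k > 0"
    by (simp add: k_def add_nonneg_pos)
  have "set_integrable lborel {0<..} (\<lambda>t::real. C * (exp (- t) * t powr (\<delta> - 1)) + exp (- t) * t powr (k - 1))"
    by (intro set_integral_add set_integrable_mult_right Gamma_weight_integrable C \<open>k > 0\<close>)
  then show ?thesis
  proof (rule set_integrable_bound)
    have "continuous_on {0<..} (\<lambda>t. exp (- t) *\<^sub>R rpow t (P - 1))"
      by (intro continuous_intros continuous_on_rpow) auto
    then show "set_borel_measurable lborel {0<..} (\<lambda>t. exp (- t) *\<^sub>R rpow t (P - 1))"
      unfolding set_borel_measurable_def
      using borel_measurable_continuous_on_indicator[of "{0<..}::real set"] by (simp del: scaleR_scaleR)
    show "AE t in lborel. t \<in> {0<..} \<longrightarrow> norm (exp (- t) *\<^sub>R rpow t (P - 1))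
        \<le> norm (C * (exp (- t) * t powr (\<delta> - 1)) + exp (- t) * t powr (k - 1))"
    proof (intro AE_I2 impI)
      fix t :: real assume "t \<in> {0<..}"
      then have t: "t > 0"
        by simp
      have "norm (rpow t (P - 1)) \<le> C * t powr (\<delta> - 1) + t powr (k - 1)"
      proof (cases "t \<le> 1")
        case True
        have "norm (rpow t (P - 1)) \<le> C * t powr (\<delta> - 1)"
          using C(3)[OF t True] t divide_right_mono[of _ _ t] by (simp add: norm_rpow_diff_1 powr_diff)
        then show ?thesis
          by (simp add: add_increasing2)
      next
        case False
        then have "norm (rpow t (P - 1)) \<le> t powr (k - 1)"
          using norm_rpow_ge_1[of t "P - 1"] by (simp add: k_def)
        then show ?thesis
          using C(2) by (simp add: add_increasing)
      qed
      then have "exp (- t) * norm (rpow t (P - 1)) \<le> exp (- t) * (C * t powr (\<delta> - 1) + t powr (k - 1))"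
        by (rule mult_left_mono) simp
      also have "\<dots> = C * (exp (- t) * t powr (\<delta> - 1)) + exp (- t) * t powr (k - 1)"
        by (simp add: algebra_simps)
      finally show "norm (exp (- t) *\<^sub>R rpow t (P - 1))
          \<le> norm (C * (exp (- t) * t powr (\<delta> - 1)) + exp (- t) * t powr (k - 1))"
        by simp
    qed
  qed
qed

lemma bicommutant_gam:
  assumes "exp_stable P" "P \<in> bicommutant S"
  shows "gam P \<in> bicommutant S"
  unfolding gam_def
  by (rule bicommutant_set_integral[OF gam_integrable[OF assms(1)]]) (intro bicommutant_intros assms)

text \<open>Split P - 1 into the scalar l - 1 and P - l; the second part annihilates
  \<open>W\<close>.\<close>

lemma rpow_eigenvector:
  fixes P W :: "'r::finite sqmat"
  assumes "t > 0" "P * W = cscalar l * W"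
  shows "rpow t (P - 1) * W = cscalar (of_real t powr (l - 1)) * W"
proof -
  define N where "N = ln t *\<^sub>R (P - cscalar l)"
  have "N * W = 0"
    by (simp add: N_def left_diff_distrib assms(2))
  then have "exp N * W = W"
    by (rule exp_mult_eq_of_annihilates)
  moreover have "ln t *\<^sub>R (P - 1) = cscalar (ln t *\<^sub>R (l - 1)) + N"
    by (simp add: N_def linear_scale[OF bounded_linear.linear[OF bounded_linear_cscalar]]
        cscalar_diff cscalar_1 algebra_simps)
  then have "rpow t (P - 1) = cscalar (exp (ln t *\<^sub>R (l - 1))) * exp N"
    unfolding rpow_def by (simp only: exp_add_commuting[OF cscalar_commute] exp_cscalar)
  moreover have "exp (ln t *\<^sub>R (l - 1)) = of_real t powr (l - 1)"
    using assms(1) by (simp add: powr_def Ln_of_real scaleR_conv_of_real mult.commute)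
  ultimately show ?thesis
    by (simp add: mult.assoc)
qed

lemma gam_invertible:
  fixes P :: "'r::finite sqmat"
  assumes "exp_stable P"
  shows "\<exists>V. gam P * V = 1"
proof (rule ccontr)
  assume "\<nexists>V. gam P * V = 1"
  then obtain Z where Z: "Z \<noteq> 0" "gam P * Z = 0"
    by (rule noninvertible_imp_annihilates)
  obtain l W where W: "W \<noteq> 0" "P * W = cscalar l * W" "\<And>G. G * P = P * G \<Longrightarrow> G * Z = 0 \<Longrightarrow> G * W = 0"
    by (rule ex_eigenvector_in_annihilator[OF Z(1), of P]) (rule that)
  \<comment> \<open>Commuting with \<open>P\<close> is what allows \<open>gam P\<close> to
    annihilate the eigenvector \<open>W\<close> along with \<open>Z\<close>.\<close>
  have "gam P * P = P * gam P"
    using bicommutantD[OF bicommutant_gam[OF assms bicommutant_base[of P "{P}"]], of P] by simp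
  then have gW: "gam P * W = 0"
    using W(3) Z(2) by blast
  have "eigenvalue (mat_of P) l"
    using W(1,2) by (auto simp: eigenvalue_iff_sqmat)
  moreover have "positive_stable (mat_of P)"
    using assms by (simp add: positive_stable_iff_exp_stable)
  ultimately have l: "Re l > 0"
    by (simp add: positive_stable_def)
  define g where "g = (\<lambda>t::real. of_real t powr (l - 1) / of_real (exp t) :: complex)"
  have g_abs: "set_integrable lebesgue {0<..} g"
    using absolutely_integrable_Gamma_integral'[OF l] by (simp add: g_def)
  have "continuous_on {0<..} g"
    unfolding g_def by (intro continuous_intros) auto
  then have "(\<lambda>t. indicator {0<..} t *\<^sub>R g t) \<in> borel_measurable lborel"
    using borel_measurable_continuous_on_indicator[of "{0<..}::real set" g] by simp
  with g_abs have g_int: "set_integrable lborel {0<..} g"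
    unfolding set_integrable_def by (simp add: integrable_completion)
  have g_val: "(LBINT t:{0<..}. g t) = Gamma l"
    using set_borel_integral_eq_integral(2)[OF g_int] Gamma_integral_complex'[OF l]
    by (simp add: g_def integral_unique)
  have bl: "bounded_linear (\<lambda>z. cscalar z * W)"
    using bounded_linear_compose[OF bounded_linear_mult_left bounded_linear_cscalar] .
  have "gam P * W = (LBINT t:{0<..}. (exp (- t) *\<^sub>R rpow t (P - 1)) * W)"
    unfolding gam_def
    by (rule set_integral_bounded_linear(2)[OF bounded_linear_mult_left gam_integrable[OF assms], symmetric])
  also have "\<dots> = (LBINT t:{0<..}. cscalar (g t) * W)"
  proof (rule set_lebesgue_integral_cong)
    show "\<forall>t::real. t \<in> {0<..} \<longrightarrow> (exp (- t) *\<^sub>R rpow t (P - 1)) * W = cscalar (g t) * W"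
    proof (intro allI impI)
      fix t :: real assume "t \<in> {0<..}"
      have "g t = exp (- t) *\<^sub>R (of_real t powr (l - 1))"
        by (simp add: g_def exp_minus scaleR_conv_of_real divide_inverse mult.commute)
      then have "cscalar (g t) = exp (- t) *\<^sub>R (cscalar (of_real t powr (l - 1)) :: 'r sqmat)"
        by (simp only: linear_scale[OF bounded_linear.linear[OF bounded_linear_cscalar]])
      with rpow_eigenvector[OF _ W(2), of t] \<open>t \<in> {0<..}\<close>
      show "(exp (- t) *\<^sub>R rpow t (P - 1)) * W = cscalar (g t) * W"
        by simp
    qed
  qed simp
  also have "\<dots> = cscalar (Gamma l) * W"
    using set_integral_bounded_linear(2)[OF bl g_int] by (simp only: g_val)
  finally have "cmod (Gamma l) * norm W = 0"
    using gW norm_cscalar_mult[of "Gamma l" W] by simp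
  \<comment> \<open>By convention \<open>Gamma\<close> takes the value 0 at its poles, the
    nonpositive integers, and nowhere else.\<close>
  moreover have "Gamma l \<noteq> 0"
    using l by (auto simp: Gamma_eq_zero_iff elim!: nonpos_Ints_cases)
  ultimately show False
    using W(1) by simp
qed

definition beta_fun :: "'r::finite sqmat \<Rightarrow> 'r sqmat \<Rightarrow> 'r sqmat" where
  "beta_fun P Q = gam P * gam Q * sq_inv (gam (P + Q))"

lemma beta_fun_invertible:
  assumes "exp_stable P" "exp_stable Q" "P * Q = Q * P"
  shows "\<exists>V. beta_fun P Q * V = 1"
proof -
  obtain U where U: "gam P * U = 1"
    using gam_invertible[OF assms(1)] by blast
  obtain V where V: "gam Q * V = 1"
    using gam_invertible[OF assms(2)] by blast
  obtain W where W: "gam (P + Q) * W = 1"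
    using gam_invertible[OF exp_stable_add[OF assms]] by blast
  have "beta_fun P Q * (gam (P + Q) * (V * U)) = gam P * (gam Q * (sq_inv (gam (P + Q)) * gam (P + Q) * (V * U)))"
    by (simp only: beta_fun_def mult.assoc)
  also have "\<dots> = gam P * (gam Q * V * U)"
    by (simp only: sq_inv(2)[OF W] mult_1_left mult.assoc)
  also have "\<dots> = 1"
    by (simp only: U V mult_1_left)
  finally show ?thesis
    by blast
qed

lemma bicommutant_beta_fun:
  assumes "exp_stable P" "exp_stable Q" "P * Q = Q * P" "P \<in> bicommutant S" "Q \<in> bicommutant S"
  shows "beta_fun P Q \<in> bicommutant S"
proof -
  obtain W where "gam (P + Q) * W = 1"
    using gam_invertible exp_stable_add[OF assms(1-3)] by blast
  then show ?thesis
    unfolding beta_fun_def using assms exp_stable_add[OF assms(1-3)]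
    by (intro bicommutant_mult bicommutant_gam bicommutant_sq_inv bicommutant_add)
qed

section \<open>The triple series\<close>

lemma norm_poch_Suc_le:
  fixes B :: "'a::real_normed_algebra_1"
  shows "norm (poch B (Suc n)) \<le> norm (poch B n) * (norm B + real n)"
proof -
  have "norm (B + of_nat n) \<le> norm B + real n"
    using norm_triangle_ineq[of B "of_nat n"] by simp
  then show ?thesis
    by (auto intro!: order_trans[OF norm_mult_ineq] mult_left_mono)
qed

text \<open>Modelled on the binomial series of (1-x)^(-B): the ratio of successive majorants is x
  (norm B + n)/(n + 1), which tends to x < 1.\<close>

lemma binomial_type_summable:
  fixes B :: "'a::real_normed_algebra_1"
  assumes "0 \<le> x" "x < 1"
  shows "summable (\<lambda>n. norm (poch B n) * (x ^ n / fact n))"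
proof -
  \<comment> \<open>The midpoint between x and 1. The choice of \<open>N\<close> ensures norm B x
    \<le> n (c - x) for n \<ge> N, which makes the ratio at most \<open>c\<close>.\<close>
  define c where "c = (1 + x) / 2"
  obtain N :: nat where N: "norm B * x / (c - x) < real N"
    using reals_Archimedean2 by blast
  have c: "c < 1" "c > x"
    using assms by (auto simp: c_def)
  show ?thesis
  proof (rule summable_ratio_test[OF c(1)])
    fix n assume "n \<ge> N"
    then have "norm B * x / (c - x) \<le> real n"
      using N by linarith
    then have "norm B * x \<le> real n * (c - x)"
      using c(2) by (simp add: field_simps)
    then have le: "(norm B + real n) * x \<le> c * (real n + 1)"
      using assms(1) c by (simp add: algebra_simps)
    have "norm (poch B (Suc n)) * (x ^ Suc n / fact (Suc n))
        \<le> (norm (poch B n) * (norm B + real n)) * (x ^ Suc n / fact (Suc n))"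
      using assms(1) by (intro mult_right_mono norm_poch_Suc_le) auto
    also have "\<dots> = norm (poch B n) * (x ^ n / fact n) * (((norm B + real n) * x) / (real n + 1))"
      by (simp add: field_simps)
    also have "\<dots> \<le> norm (poch B n) * (x ^ n / fact n) * c"
      using le assms(1) by (intro mult_left_mono) (auto simp: divide_le_eq)
    finally show "norm (norm (poch B (Suc n)) * (x ^ Suc n / fact (Suc n)))
        \<le> c * norm (norm (poch B n) * (x ^ n / fact n))"
      using assms(1) by (simp add: mult_ac del: power_Suc fact_Suc poch.simps)
  qed
qed

lemma summable_on_nat_triple_product:
  fixes f g h :: "nat \<Rightarrow> real"
  assumes "summable f" "summable g" "summable h" "\<And>n. f n \<ge> 0" "\<And>n. g n \<ge> 0" "\<And>n. h n \<ge> 0"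
  shows "(\<lambda>(m, n, p). f m * (g n * h p)) summable_on UNIV"
proof -
  have f: "(f has_sum suminf f) UNIV" and g: "(g has_sum suminf g) UNIV" and h: "(h has_sum suminf h) UNIV"
    using assms by (auto intro!: sums_nonneg_imp_has_sum summable_sums)
  have "(\<lambda>(n, p). g n * h p) summable_on (UNIV \<times> UNIV)"
  proof (rule summable_on_SigmaI[where g = "\<lambda>n. g n * suminf h"])
    show "(\<lambda>n. g n * suminf h) summable_on UNIV"
      using has_sum_cmult_left[OF g] summable_on_def by blast
  qed (use assms has_sum_cmult_right[OF h] in auto)
  then have gh: "((\<lambda>(n, p). g n * h p) has_sum infsum (\<lambda>(n, p). g n * h p) UNIV) UNIV"
    by simp
  have "(\<lambda>(m, n, p). f m * (g n * h p)) summable_on (UNIV \<times> UNIV)"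
  proof (rule summable_on_SigmaI[where g = "\<lambda>m. f m * infsum (\<lambda>(n, p). g n * h p) UNIV"])
    show "(\<lambda>m. f m * infsum (\<lambda>(n, p). g n * h p) UNIV) summable_on UNIV"
      using has_sum_cmult_left[OF f] summable_on_def by blast
    show "((\<lambda>y. case (m, y) of (m, n, p) \<Rightarrow> f m * (g n * h p)) has_sum f m * infsum (\<lambda>(n, p). g n * h p) UNIV) UNIV" for m
      using has_sum_cmult_right[OF gh, of "f m"] by (simp add: case_prod_unfold)
  qed (use assms in auto)
  then show ?thesis
    by simp
qed

section \<open>Linear operations on the triple sum\<close>

context
  fixes B1 B2 B3 :: "'r::finite sqmat" and z w v :: complex
begin

text \<open>Only the sum of the indices enters \<open>T\<close>, and the B1, B2, B3 factors follow
  it on the right. Left multiplication of \<open>T\<close> therefore passes through the sum without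
  any commutation with them.\<close>

definition triple_term :: "(nat \<Rightarrow> 'r sqmat) \<Rightarrow> nat \<times> nat \<times> nat \<Rightarrow> 'r sqmat" where
  "triple_term T = (\<lambda>(m, n, p). T (m + n + p) * (poch B1 m * poch B2 n * poch B3 p
     * cscalar (z ^ m * w ^ n * v ^ p / (fact m * fact n * fact p))))"

definition triple_sum :: "(nat \<Rightarrow> 'r sqmat) \<Rightarrow> 'r sqmat" where
  "triple_sum T = infsum (triple_term T) UNIV"

context
  assumes zwv: "norm z < 1" "norm w < 1" "norm v < 1"
begin

lemma triple_term_summable:
  assumes "\<And>N. norm (T N) \<le> K"
  shows "triple_term T summable_on UNIV"
proof -
  define r where "r = (\<lambda>(B :: 'r sqmat) (z :: complex) n. norm (poch B n) * (norm z ^ n / fact n))"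
  have r: "summable (r B z)" if "norm z < 1" for B z
    unfolding r_def using that by (intro binomial_type_summable) auto
  have r0: "r B z n \<ge> 0" for B z n
    by (simp add: r_def)
  have K: "K \<ge> 0"
    using order_trans[OF norm_ge_zero assms] .
  have "(\<lambda>(m, n, p). r B1 z m * (r B2 w n * r B3 v p)) summable_on UNIV"
    by (intro summable_on_nat_triple_product r zwv r0)
  then have sum: "(\<lambda>x. K * (case x of (m, n, p) \<Rightarrow> r B1 z m * (r B2 w n * r B3 v p))) summable_on UNIV"
    by (rule summable_on_cmult_right)
  have "(\<lambda>x. norm (triple_term T x)) summable_on UNIV"
  proof (rule Infinite_Sum.abs_summable_on_comparison_test'[OF sum])
    fix x :: "nat \<times> nat \<times> nat"
    obtain m n p where x: "x = (m, n, p)"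
      by (cases x)
    define c where "c = z ^ m * w ^ n * v ^ p / (fact m * fact n * fact p)"
    have "norm (T (m + n + p) * (poch B1 m * poch B2 n * poch B3 p * cscalar c))
        \<le> K * norm (cscalar c * (poch B1 m * poch B2 n * poch B3 p))"
      unfolding cscalar_commute
      by (rule order_trans[OF norm_mult_ineq]) (rule mult_right_mono[OF assms], simp)
    also have "\<dots> \<le> K * (cmod c * (norm (poch B1 m) * norm (poch B2 n) * norm (poch B3 p)))"
      unfolding norm_cscalar_mult
      by (intro mult_left_mono K order_trans[OF norm_mult_ineq] mult_right_mono norm_mult_ineq) auto
    also have "cmod c = norm z ^ m * norm w ^ n * norm v ^ p / (fact m * fact n * fact p)"
      by (simp add: c_def norm_mult norm_divide norm_power)
    finally show "norm (triple_term T x) \<le> K * (case x of (m, n, p) \<Rightarrow> r B1 z m * (r B2 w n * r B3 v p))"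
      by (simp add: x triple_term_def c_def r_def mult_ac)
  qed
  then show ?thesis
    by (rule Infinite_Sum.abs_summable_summable)
qed

lemma triple_sum_mult:
  assumes "\<And>N. norm (T N) \<le> K"
  shows "Z * triple_sum T = triple_sum (\<lambda>N. Z * T N)"
proof -
  have "((\<lambda>x. Z * triple_term T x) has_sum Z * triple_sum T) UNIV"
    unfolding triple_sum_def by (intro has_sum_cmult_right has_sum_infsum triple_term_summable[OF assms])
  moreover have "Z * triple_term T x = triple_term (\<lambda>N. Z * T N) x" for x
    by (simp add: triple_term_def case_prod_unfold mult.assoc)
  ultimately show ?thesis
    unfolding triple_sum_def[of "\<lambda>N. Z * T N"] by (simp only: infsumI)
qed

lemma triple_sum_add:
  assumes "\<And>N. norm (T N) \<le> K" "\<And>N. norm (U N) \<le> L"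
  shows "triple_sum T + triple_sum U = triple_sum (\<lambda>N. T N + U N)"
proof -
  have "triple_term (\<lambda>N. T N + U N) = (\<lambda>x. triple_term T x + triple_term U x)"
    by (simp add: fun_eq_iff triple_term_def case_prod_unfold distrib_right)
  then show ?thesis
    unfolding triple_sum_def
    by (simp only: infsum_add[OF triple_term_summable[OF assms(1)] triple_term_summable[OF assms(2)]])
qed

lemma triple_sum_diff:
  assumes "\<And>N. norm (T N) \<le> K" "\<And>N. norm (U N) \<le> L"
  shows "triple_sum T - triple_sum U = triple_sum (\<lambda>N. T N - U N)"
proof -
  have "triple_sum T + (- 1) * triple_sum U = triple_sum (\<lambda>N. T N + (- 1) * U N)"
    unfolding triple_sum_mult[OF assms(2)] by (rule triple_sum_add[OF assms(1), of _ L]) (simp add: assms(2))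
  then show ?thesis
    by simp
qed

end

end

text \<open>The coefficient of all terms with m + n + p = N, where P and Q stand for A1 and C1 -
  A1.\<close>

definition lauricella ::
  "'r::finite sqmat \<Rightarrow> 'r sqmat \<Rightarrow> 'r sqmat \<Rightarrow> 'r sqmat \<Rightarrow> 'r sqmat \<Rightarrow> nat \<Rightarrow> 'r sqmat" where
  "lauricella A B Y P Q N = ebeta A B Y (P + of_nat N) Q * sq_inv (beta_fun P Q)"

lemma lauricella_bounded:
  assumes "commuting_stable A B Y" "exp_stable P" "exp_stable Q"
  shows "\<exists>K. \<forall>N. norm (lauricella A B Y P Q N) \<le> K"
proof -
  obtain K where K: "\<And>N. norm (ebeta A B Y (P + of_nat N) Q) \<le> K"
    using ebeta_shift_bounded[OF assms] by blast
  have "norm (lauricella A B Y P Q N) \<le> K * norm (sq_inv (beta_fun P Q))" for N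
    unfolding lauricella_def by (rule order_trans[OF norm_mult_ineq mult_right_mono[OF K]]) simp
  then show ?thesis
    by blast
qed

section \<open>Transfer to the matrix functions\<close>

lemma mat_of_simps:
  "mat_of (X + Z) = mat_of X + mat_of Z" "mat_of (X - Z) = mat_of X - mat_of Z"
  "mat_of (- X) = - mat_of X" "mat_of (X * Z) = mat_of X ** mat_of Z"
  "mat_of (c *\<^sub>R X) = c *\<^sub>R mat_of X" "mat_of 1 = mat 1"
  by (simp_all add: plus_sqmat.rep_eq minus_sqmat.rep_eq uminus_sqmat.rep_eq times_sqmat.rep_eq
      scaleR_sqmat.rep_eq one_sqmat.rep_eq)

lemma mat_of_of_nat: "mat_of (of_nat n) = mat (of_nat n)"
proof (induction n)
  case 0
  then show ?case
    by (simp add: zero_sqmat.rep_eq mat_def vec_eq_iff)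
qed (simp add: mat_of_simps mat_add_complex)

lemma mat_pow_mat_of: "mat_pow (mat_of X) n = mat_of (X ^ n)"
  by (induction n) (simp_all add: mat_of_simps power_Suc2 del: power_Suc)

lemma mat_powr_mat_of: "mat_powr t (mat_of X) = mat_of (rpow t X)"
proof -
  have "mat_exp (mat_of Z) = mat_of (exp Z)" for Z :: "'a sqmat"
    unfolding mat_exp_def exp_def bounded_linear.suminf[OF bounded_linear_mat_of summable_exp_generic]
    by (simp add: mat_pow_mat_of mat_of_simps divide_inverse)
  then show ?thesis
    unfolding mat_powr_def rpow_def mat_of_simps(5)[symmetric] by blast
qed

lemma mat_pochhammer_mat_of: "mat_pochhammer (mat_of X) n = mat_of (poch X n)"
  by (induction n) (simp_all add: mat_of_simps mat_of_of_nat)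

lemma mat_of_sq_inv: "matrix_inv (mat_of X) = mat_of (sq_inv X)"
  by (simp add: sq_inv_def)

lemma mat_1F1_mat_of:
  assumes "exp_stable B" "A * B = B * A"
  shows "mat_1F1 (mat_of A) (mat_of B) (mat_of X) = mat_of (hyp A B 0 X)"
proof -
  have "mat_of (hyp A B 0 X) = (\<Sum>n. mat_of (hyp_term A B 0 X n))"
    unfolding hyp_def
    by (rule bounded_linear.suminf[OF bounded_linear_mat_of sums_summable[OF hyp_sums[OF assms]]])
  then show ?thesis
    by (simp only: mat_1F1_def hyp_term_def hyp_coeff_def mat_pow_mat_of mat_pochhammer_mat_of mat_of_sq_inv
        mat_of_simps(4,5)[symmetric] add_0_right inverse_eq_divide)
qed

lemma mat_Gamma_mat_of:
  assumes "exp_stable P"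
  shows "mat_Gamma (mat_of P) = mat_of (gam P)"
  using set_integral_bounded_linear(2)[OF bounded_linear_mat_of gam_integrable[OF assms]]
  unfolding mat_Gamma_def gam_def mat_of_simps(6)[symmetric] mat_of_simps(2)[symmetric]
    mat_powr_mat_of mat_of_simps(5) by simp

lemma mat_Beta_mat_of:
  assumes "exp_stable P" "exp_stable Q" "P * Q = Q * P"
  shows "mat_Beta (mat_of P) (mat_of Q) = mat_of (beta_fun P Q)"
  unfolding mat_Beta_def beta_fun_def mat_of_simps(1)[symmetric]
    mat_Gamma_mat_of[OF assms(1)] mat_Gamma_mat_of[OF assms(2)] mat_Gamma_mat_of[OF exp_stable_add[OF assms]]
    mat_of_sq_inv mat_of_simps(4) ..

lemma ext_Beta_mat_of:
  assumes "commuting_stable A B Y" "exp_stable P" "exp_stable Q"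
  shows "ext_Beta (mat_of A) (mat_of B) (mat_of Y) (mat_of P) (mat_of Q) = mat_of (ebeta A B Y P Q)"
proof -
  have "mat_1F1 (mat_of A) (mat_of B) (mat_of X) = mat_of (hyp A B 0 X)" for X
    using assms(1) by (intro mat_1F1_mat_of) (auto simp: commuting_stable_def)
  then show ?thesis
    unfolding ext_Beta_def mat_of_simps(6)[symmetric] mat_of_simps(2)[symmetric]
      mat_of_simps(5)[symmetric] mat_of_simps(3)[symmetric] mat_powr_mat_of
      mat_of_simps(4)[symmetric]
    using set_integral_bounded_linear(2)[OF bounded_linear_mat_of ebeta_integrable[OF assms]]
    by (simp add: ebeta_def hyp_kernel_def beta_weight_def mult.assoc mat_of_simps(4)[symmetric])
qed

text \<open>In terms of \<open>P\<close> and \<open>Q\<close> the shift of (A1, C1) by (I, 2I)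
  lowers both parameters by I.\<close>

lemma ext_Lauricella_D_mat_of:
  assumes "commuting_stable A B Y" "exp_stable P" "exp_stable Q" "P * Q = Q * P"
    and "norm z < 1" "norm w < 1" "norm v < 1" and C: "C = P + Q"
  shows "ext_Lauricella_D (mat_of A) (mat_of B) (mat_of Y) (mat_of P) (mat_of B1) (mat_of B2) (mat_of B3)
    (mat_of C) z w v = mat_of (triple_sum B1 B2 B3 z w v (lauricella A B Y P Q))"
proof -
  obtain K where K: "\<And>N. norm (lauricella A B Y P Q N) \<le> K"
    using lauricella_bounded[OF assms(1-3)] by blast
  let ?t = "triple_term B1 B2 B3 z w v (lauricella A B Y P Q)"
  have Q: "mat_of C - mat_of P = mat_of Q"
    by (simp add: C mat_of_simps)
  have "((\<lambda>x. mat_of (?t x)) has_sum mat_of (triple_sum B1 B2 B3 z w v (lauricella A B Y P Q))) UNIV"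
    unfolding triple_sum_def
    by (rule has_sum_bounded_linear[OF bounded_linear_mat_of has_sum_infsum[OF triple_term_summable[OF assms(5-7) K]]])
  moreover have t: "mat_of (?t (m, n, p)) =
      ext_Beta (mat_of A) (mat_of B) (mat_of Y) (mat_of P + mat (of_nat (m + n + p))) (mat_of C - mat_of P)
        ** matrix_inv (mat_Beta (mat_of P) (mat_of C - mat_of P))
        ** mat_pochhammer (mat_of B1) m ** mat_pochhammer (mat_of B2) n ** mat_pochhammer (mat_of B3) p
        ** mat (z ^ m * w ^ n * v ^ p / (fact m * fact n * fact p))" for m n p
  proof -
    have c: "mat (z ^ m * w ^ n * v ^ p / (fact m * fact n * fact p))
        = mat_of (cscalar (z ^ m * w ^ n * v ^ p / (fact m * fact n * fact p)))"
      by (simp add: cscalar_def)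
    show ?thesis
      unfolding c Q mat_of_of_nat[symmetric] mat_of_simps(1)[symmetric]
        ext_Beta_mat_of[OF assms(1) exp_stable_add_of_nat[OF assms(2)] assms(3)]
        mat_Beta_mat_of[OF assms(2-4)] mat_of_sq_inv mat_pochhammer_mat_of
      by (simp only: triple_term_def lauricella_def mat_of_simps(4)[symmetric] prod.case mult.assoc)
  qed
  ultimately show ?thesis
    unfolding ext_Lauricella_D_def t[symmetric] by (intro infsumI) (simp add: case_prod_unfold)
qed

theorem theorem5p9:
  fixes A B A1 B1 B2 B3 C1 Y :: "complex ^ 'r::finite ^ 'r"
    and z w v :: complex
  assumes "positive_stable A" and "positive_stable B" and "positive_stable A1"
    and "positive_stable B1" and "positive_stable B2" and "positive_stable B3"
    and "positive_stable C1" and "positive_stable (C1 - A1)" and "positive_stable Y"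
    and "\<forall>M \<in> {A, B, A1, C1, Y}. \<forall>N \<in> {A, B, A1, C1, Y}. M ** N = N ** M"
    and "norm z < 1" and "norm w < 1" and "norm v < 1"
  shows
    "(positive_stable (B - mat 1) \<longrightarrow>
        (B - (A + mat 1)) ** ext_Lauricella_D A B Y A1 B1 B2 B3 C1 z w v
        = (B - mat 1) ** ext_Lauricella_D A (B - mat 1) Y A1 B1 B2 B3 C1 z w v
          - A ** ext_Lauricella_D (A + mat 1) B Y A1 B1 B2 B3 C1 z w v)
     \<and>
     (positive_stable (A - mat 1) \<and> positive_stable (A1 - mat 1)
        \<and> positive_stable (C1 - A1 - mat 1) \<longrightarrow>
        B ** ext_Lauricella_D A B Y A1 B1 B2 B3 C1 z w v
        - B ** ext_Lauricella_D (A - mat 1) B Y A1 B1 B2 B3 C1 z w v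
        + matrix_inv (mat_Beta A1 (C1 - A1)) ** mat_Beta (A1 - mat 1) (C1 - A1 - mat 1) ** Y
          ** ext_Lauricella_D A (B + mat 1) Y (A1 - mat 1) B1 B2 B3 (C1 - mat 2) z w v
        = 0)"
proof -
  define a b y p q where "a = sq A" and "b = sq B" and "y = sq Y" and "p = sq A1" and "q = sq (C1 - A1)"
  define b1 b2 b3 where "b1 = sq B1" and "b2 = sq B2" and "b3 = sq B3"
  have eqs: "A = mat_of a" "B = mat_of b" "Y = mat_of y" "A1 = mat_of p" "C1 = mat_of (p + q)"
    "B1 = mat_of b1" "B2 = mat_of b2" "B3 = mat_of b3"
    by (simp_all add: a_def b_def y_def p_def q_def b1_def b2_def b3_def mat_of_simps)
  have stable: "exp_stable a" "exp_stable b" "exp_stable y" "exp_stable p" "exp_stable q"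
    using assms(1-3,8,9) by (simp_all add: positive_stable_iff_exp_stable a_def b_def y_def p_def q_def)
  define S where "S = sq ` {A, B, A1, C1, Y}"
  have comm_S: "s * t = t * s" if st: "s \<in> S" "t \<in> S" for s t
  proof -
    obtain M N where "M \<in> {A, B, A1, C1, Y}" "s = sq M" "N \<in> {A, B, A1, C1, Y}" "t = sq N"
      using st unfolding S_def image_iff by blast
    with assms(10) show ?thesis
      by (simp only: sq_mult[symmetric])
  qed
  have comm: "X * Z = Z * X" if "X \<in> bicommutant S" "Z \<in> bicommutant S" for X Z
    by (rule bicommutant_commute[OF comm_S that])
  have base: "a \<in> bicommutant S" "b \<in> bicommutant S" "y \<in> bicommutant S" "p \<in> bicommutant S" "q \<in> bicommutant S"
    unfolding a_def b_def y_def p_def q_def sq_diff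
    by (intro bicommutant_intros bicommutant_base; simp add: S_def)+
  have pq: "p * q = q * p"
    by (intro comm base)
  have cs: "commuting_stable a b y"
    unfolding commuting_stable_def by (intro conjI stable comm base)
  define \<Sigma> where "\<Sigma> = triple_sum b1 b2 b3 z w v"
  note mult = triple_sum_mult[OF assms(11-13), where ?B1.0 = b1 and ?B2.0 = b2 and ?B3.0 = b3, folded \<Sigma>_def]
  note add = triple_sum_add[OF assms(11-13), where ?B1.0 = b1 and ?B2.0 = b2 and ?B3.0 = b3, folded \<Sigma>_def]
  note diff = triple_sum_diff[OF assms(11-13), where ?B1.0 = b1 and ?B2.0 = b2 and ?B3.0 = b3, folded \<Sigma>_def]
  note transfer = ext_Lauricella_D_mat_of[OF _ _ _ _ assms(11-13), where ?B1.0 = b1 and ?B2.0 = b2 and ?B3.0 = b3, folded \<Sigma>_def]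
  have bounded_mult: "norm (Z * T N) \<le> norm Z * K" if "\<And>N. norm (T N) \<le> K" for Z :: "'r sqmat" and T and N :: nat and K
    by (rule order_trans[OF norm_mult_ineq mult_left_mono[OF that]]) simp
  have one: "(mat 1 :: complex^'r^'r) = mat_of 1"
    by (simp add: mat_of_simps)
  have part1: "(B - (A + mat 1)) ** ext_Lauricella_D A B Y A1 B1 B2 B3 C1 z w v
        = (B - mat 1) ** ext_Lauricella_D A (B - mat 1) Y A1 B1 B2 B3 C1 z w v
          - A ** ext_Lauricella_D (A + mat 1) B Y A1 B1 B2 B3 C1 z w v"
    if "positive_stable (B - mat 1)"
  proof -
    have B1: "exp_stable (b - 1)"
      using that by (simp add: positive_stable_iff_exp_stable b_def sq_diff sq_one)
    have cs1: "commuting_stable a (b - 1) y"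
      using cs B1 by (simp add: commuting_stable_def left_diff_distrib right_diff_distrib)
    have cs2: "commuting_stable (a + 1) b y"
      using cs exp_stable_add_of_nat[of a 1] by (simp add: commuting_stable_def distrib_left distrib_right)
    obtain K0 where K0: "\<And>N. norm (lauricella a b y p q N) \<le> K0"
      using lauricella_bounded[OF cs stable(4,5)] by blast
    obtain K1 where K1: "\<And>N. norm (lauricella a (b - 1) y p q N) \<le> K1"
      using lauricella_bounded[OF cs1 stable(4,5)] by blast
    obtain K2 where K2: "\<And>N. norm (lauricella (a + 1) b y p q N) \<le> K2"
      using lauricella_bounded[OF cs2 stable(4,5)] by blast
    have "(b - 1) * \<Sigma> (lauricella a (b - 1) y p q) - a * \<Sigma> (lauricella (a + 1) b y p q)
        = \<Sigma> (\<lambda>N. (b - 1) * lauricella a (b - 1) y p q N - a * lauricella (a + 1) b y p q N)"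
      unfolding mult[OF K1] mult[OF K2] by (rule diff[OF bounded_mult[OF K1] bounded_mult[OF K2]])
    \<comment> \<open>All three functions have the same P and Q, so the inverse beta matrix is a
      common right factor and the relation of the extended beta functions applies.\<close>
    also have "(\<lambda>N. (b - 1) * lauricella a (b - 1) y p q N - a * lauricella (a + 1) b y p q N)
        = (\<lambda>N. (b - (a + 1)) * lauricella a b y p q N)"
      unfolding lauricella_def mult.assoc[symmetric] left_diff_distrib[symmetric]
      by (simp only: ebeta_contiguous_1[OF cs B1 exp_stable_add_of_nat[OF stable(4)] stable(5)])
    also have "\<Sigma> \<dots> = (b - (a + 1)) * \<Sigma> (lauricella a b y p q)"
      by (rule mult[OF K0, symmetric])
    finally show ?thesis
      unfolding eqs one mat_of_simps(1)[symmetric] mat_of_simps(2)[symmetric]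
        transfer[OF cs stable(4,5) pq refl] transfer[OF cs1 stable(4,5) pq refl] transfer[OF cs2 stable(4,5) pq refl]
        mat_of_simps(4)[symmetric]
      by simp
  qed
  have part2: "B ** ext_Lauricella_D A B Y A1 B1 B2 B3 C1 z w v
        - B ** ext_Lauricella_D (A - mat 1) B Y A1 B1 B2 B3 C1 z w v
        + matrix_inv (mat_Beta A1 (C1 - A1)) ** mat_Beta (A1 - mat 1) (C1 - A1 - mat 1) ** Y
          ** ext_Lauricella_D A (B + mat 1) Y (A1 - mat 1) B1 B2 B3 (C1 - mat 2) z w v
        = 0"
    if "positive_stable (A - mat 1)" "positive_stable (A1 - mat 1)" "positive_stable (C1 - A1 - mat 1)"
  proof -
    have st: "exp_stable (a - 1)" "exp_stable (p - 1)" "exp_stable (q - 1)"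
      using that by (simp_all add: positive_stable_iff_exp_stable a_def p_def q_def sq_diff sq_one)
    have cs1: "commuting_stable (a - 1) b y"
      using cs st(1) by (simp add: commuting_stable_def left_diff_distrib right_diff_distrib)
    have cs2: "commuting_stable a (b + 1) y"
      using cs exp_stable_add_of_nat[of b 1] by (simp add: commuting_stable_def distrib_left distrib_right)
    have pq1: "(p - 1) * (q - 1) = (q - 1) * (p - 1)"
      by (intro comm bicommutant_intros base)
    obtain K0 where K0: "\<And>N. norm (lauricella a b y p q N) \<le> K0"
      using lauricella_bounded[OF cs stable(4,5)] by blast
    obtain K1 where K1: "\<And>N. norm (lauricella (a - 1) b y p q N) \<le> K1"
      using lauricella_bounded[OF cs1 stable(4,5)] by blast
    obtain K2 where K2: "\<And>N. norm (lauricella a (b + 1) y (p - 1) (q - 1) N) \<le> K2"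
      using lauricella_bounded[OF cs2 st(2,3)] by blast
    define G where "G = sq_inv (beta_fun p q)"
    define H where "H = beta_fun (p - 1) (q - 1)"
    obtain V where V: "beta_fun p q * V = 1"
      using beta_fun_invertible[OF stable(4,5) pq] by blast
    obtain W where W: "H * W = 1"
      unfolding H_def using beta_fun_invertible[OF st(2,3) pq1] by blast
    have G: "G \<in> bicommutant S"
      unfolding G_def by (rule bicommutant_sq_inv[OF bicommutant_beta_fun[OF stable(4,5) pq base(4,5)] V])
    have H: "H \<in> bicommutant S"
      unfolding H_def by (rule bicommutant_beta_fun[OF st(2,3) pq1]) (intro bicommutant_intros base)+
    \<comment> \<open>The shifted function carries the inverse of \<open>H\<close> on the right.
      Once \<open>H\<close> has moved past y and the extended beta matrix it cancels, and
      \<open>G\<close> moves to the right, where the other two functions have it.\<close>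
    have key: "(G * H * y) * lauricella a (b + 1) y (p - 1) (q - 1) N
        = (y * ebeta a (b + 1) y (p + of_nat N - 1) (q - 1)) * G" for N
    proof -
      define E where "E = ebeta a (b + 1) y (p + of_nat N - 1) (q - 1)"
      have eq: "p - 1 + of_nat N = p + of_nat N - 1"
        by simp
      have "exp_stable (p + of_nat N - 1)"
        using exp_stable_add_of_nat[OF st(2), of N] by (simp only: eq)
      then have "E \<in> bicommutant S"
        unfolding E_def by (intro bicommutant_ebeta cs2 st bicommutant_intros base)
      then have yE: "y * E \<in> bicommutant S"
        by (intro bicommutant_intros base)
      have "(G * H * y) * lauricella a (b + 1) y (p - 1) (q - 1) N = G * (H * (y * E)) * sq_inv H"
        by (simp only: lauricella_def eq E_def H_def mult.assoc)
      also have "\<dots> = G * (y * E) * (H * sq_inv H)"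
        by (simp only: comm[OF H yE] mult.assoc)
      also have "\<dots> = (y * E) * G"
        by (simp only: sq_inv(1)[OF W] mult_1_right comm[OF G yE])
      finally show ?thesis
        by (simp only: E_def)
    qed
    \<comment> \<open>The difference is one summand of the next addition, so it needs a bound of its
      own.\<close>
    have bd: "norm (b * lauricella a b y p q N - b * lauricella (a - 1) b y p q N) \<le> norm b * K0 + norm b * K1" for N
      by (rule order_trans[OF norm_triangle_ineq4 add_mono[OF bounded_mult[OF K0] bounded_mult[OF K1]]])
    have d: "\<Sigma> (\<lambda>N. b * lauricella a b y p q N) - \<Sigma> (\<lambda>N. b * lauricella (a - 1) b y p q N)
        = \<Sigma> (\<lambda>N. b * lauricella a b y p q N - b * lauricella (a - 1) b y p q N)"
      by (rule diff[OF bounded_mult[OF K0] bounded_mult[OF K1]])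
    have "b * \<Sigma> (lauricella a b y p q) - b * \<Sigma> (lauricella (a - 1) b y p q)
        + (G * H * y) * \<Sigma> (lauricella a (b + 1) y (p - 1) (q - 1))
        = \<Sigma> (\<lambda>N. (b * lauricella a b y p q N - b * lauricella (a - 1) b y p q N)
            + (G * H * y) * lauricella a (b + 1) y (p - 1) (q - 1) N)"
      unfolding mult[OF K0] mult[OF K1] mult[OF K2] d
      by (rule add[OF bd bounded_mult[OF K2]])
    also have "(\<lambda>N. (b * lauricella a b y p q N - b * lauricella (a - 1) b y p q N)
            + (G * H * y) * lauricella a (b + 1) y (p - 1) (q - 1) N) = (\<lambda>N. 0)"
    proof
      fix N
      have "exp_stable (p + of_nat N - 1)"
        using exp_stable_add_of_nat[OF st(2), of N] by (simp add: algebra_simps)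
      from ebeta_contiguous_2[OF cs st(1) exp_stable_add_of_nat[OF stable(4)] this stable(5) st(3)]
      show "(b * lauricella a b y p q N - b * lauricella (a - 1) b y p q N)
            + (G * H * y) * lauricella a (b + 1) y (p - 1) (q - 1) N = 0"
        unfolding key unfolding lauricella_def G_def[symmetric] mult.assoc[symmetric]
          left_diff_distrib[symmetric] distrib_right[symmetric]
        by (simp only: mult_zero_left)
    qed
    also have "\<Sigma> (\<lambda>N. 0) = 0"
      \<comment> \<open>The zero family multiplied by 0.\<close>
      using mult[of "\<lambda>N. 0" 0 0] by simp
    finally have main: "b * \<Sigma> (lauricella a b y p q) - b * \<Sigma> (lauricella (a - 1) b y p q)
        + (G * H * y) * \<Sigma> (lauricella a (b + 1) y (p - 1) (q - 1)) = 0" .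
    have two: "(mat 2 :: complex^'r^'r) = mat_of (1 + 1)"
      using mat_of_of_nat[of 2, where 'a = 'r] by simp
    \<comment> \<open>This identifies C1 - 2I with the sum of the two lowered parameters, as the
      transfer requires.\<close>
    have shift: "p + q - (1 + 1) = (p - 1) + (q - 1)"
      by simp
    have q: "p + q - p = q"
      by simp
    show ?thesis
      unfolding eqs one two q mat_of_simps(1)[symmetric] mat_of_simps(2)[symmetric]
        transfer[OF cs stable(4,5) pq refl] transfer[OF cs1 stable(4,5) pq refl]
        transfer[OF cs2 st(2,3) pq1 shift] mat_Beta_mat_of[OF stable(4,5) pq] mat_Beta_mat_of[OF st(2,3) pq1]
        mat_of_sq_inv mat_of_simps(4)[symmetric] G_def[symmetric] H_def[symmetric] main
      by (rule zero_sqmat.rep_eq)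
  qed
  show ?thesis
    using part1 part2 by blast
qed

end
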